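(* Let $f:\mathbb{C}\to\widehat{\mathbb{C}}$ be a meromorphic map of degree larger than $1$ and let $U$ be a simply connected invariant Baker domain of $f$, such that $f|_U$ is of doubly parabolic type (i.e. $\varrho_U(f^{n+1}(z),f^n(z))\to 0$ as $n\to\infty$ for $z\in U$). Suppose that the degree of $f$ on $U$ is finite. Then the set of points $z$ in the boundary of $U$ whose forward trajectories $\{f^n(z)\}_{n\ge 0}$ are dense in the boundary of $U$ has full harmonic measure. More generally, the same conclusion holds if, instead of assuming that the degree of $f$ on $U$ is finite, one assumes that the associated inner function $g=\varphi^{-1}\circ f\circ\varphi$, where $\varphi:\mathbb{D}\to U$ is a Riemann map, has non-singular Denjoy--Wolff point.
   Context: $\mathbb{D}$ is the open unit disc and $\widehat{\mathbb{C}}$ the Riemann sphere; closures and boundaries are taken in $\mathbb{C}$. The Fatou set of $f$ is the set of points having a neighbourhood on which all iterates $f^n$ are defined and form a normal family; its connected components are the Fatou components. An invariant Baker domain is a Fatou component $U\subset\mathbb{C}$ with $f(U)\subset U$ such that $f^n\to\infty$ locally uniformly on $U$ as $n\to\infty$. The degree of $f$ on $U$ is the degree of the holomorphic map $f|_U:U\to U$. $\varrho_U$ denotes the hyperbolic distance in $U$, normalized so that $d\varrho_{\mathbb{D}}(z)=\frac{2|dz|}{1-|z|^2}$. Harmonic measure: for a Riemann map $\varphi:\mathbb{D}\to U$, radial limits of $\varphi$ exist at Lebesgue-almost every point of $\partial\mathbb{D}$, and the harmonic measure on $\partial U$ is the image of normalized Lebesgue measure on $\partial\mathbb{D}$ under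 this boundary map. Having full harmonic measure means that the complement in $\partial U$ has harmonic measure zero (this does not depend on the choice of $\varphi$). Associated inner function: $g=\varphi^{-1}\circ f\circ\varphi:\mathbb{D}\to\mathbb{D}$ is an inner function, i.e. a holomorphic self-map of $\mathbb{D}$ whose radial limits have modulus $1$ at almost every point of $\partial\mathbb{D}$. Since $U$ is a Baker domain, $g$ has no fixed point in $\mathbb{D}$, and by the Denjoy--Wolff theorem there is a point $p\in\partial\mathbb{D}$ (the Denjoy--Wolff point) with $g^n\to p$ locally uniformly on $\mathbb{D}$. A point $\zeta\in\partial\mathbb{D}$ is singular for $g$ if $g$ cannot be extended holomorphically to any neighbourhood of $\zeta$, and non-singular otherwise. Type: by Cowen's theorem, for a holomorphic $h:\mathbb{D}\to\mathbb{D}$ with Denjoy--Wolff point in $\partial\mathbb{D}$ there exist a simply connected domain $V\subset\mathbb{D}$, a domain $\Omega$ equal to $\mathbb{H}=\{\operatorname{Re}z>0\}$ or $\mathbb{C}$, a holomorphic map $\psi:\mathbb{D}\to\Omega$ and a Möbius transformation $T$ of $\Omega$ onto itself such that $V$ is absorbing in $\mathbb{D}$ for $h$ (i.e. $h(V)\subset V$ and for each compact $K\subset\mathbb{D}$ there is $n\ge0$ with $h^n(K)\subset V$), $\psi(V)$ is absorbing in $\Omega$ for $T$, $\psi\circ h=T\circ\psi$ on $\mathbb{D}$, and $\psi$ is univalent on $V$. Up to conjugation by a Möbius map preserving $\Omega$, exactly one of the following holds: $\Omega=\mathbb{H}$, $T(\omega)=a\omega$ with $a>1$ (hyperbolic type);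 $\Omega=\mathbb{H}$, $T(\omega)=\omega\pm i$ (simply parabolic type); $\Omega=\mathbb{C}$, $T(\omega)=\omega+1$ (doubly parabolic type). The type of $f|_U$ is the type of $g$. It is known that $f|_U$ is of doubly parabolic type if and only if $\varrho_U(f^{n+1}(z),f^n(z))\to0$ for some (equivalently every) $z\in U$. *)

theory Defs
  imports "HOL-Complex_Analysis.Complex_Analysis" "HOL-Probability.Probability"
    "HOL-Real_Asymp.Real_Asymp"
begin

section \<open>The Riemann sphere\<close>

datatype riemann_sphere = Fin (the_Fin: complex) | Infty
  where "the_Fin Infty = 0"

text \<open>
  Stereographic projection onto the unit sphere of \<open>\<complex> \<times> \<real>\<close>; the metric on the Riemann sphere is
  the chordal metric \<open>2|z - w| / (sqrt (1 + |z|\<^sup>2) * sqrt (1 + |w|\<^sup>2))\<close> induced by it.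
\<close>

fun stereographic :: "riemann_sphere \<Rightarrow> complex \<times> real" where
  "stereographic (Fin z) =
     (2 * z / of_real (1 + (cmod z)\<^sup>2), ((cmod z)\<^sup>2 - 1) / (1 + (cmod z)\<^sup>2))"
| "stereographic Infty = (0, 1)"

lemma stereographic_snd_Fin_neq_1: "((cmod z)\<^sup>2 - 1) / (1 + (cmod z)\<^sup>2) \<noteq> 1"
proof -
  have "1 + (cmod z)\<^sup>2 > 0" by (simp add: add_pos_nonneg)
  then show ?thesis by (simp add: divide_simps)
qed

lemma inj_stereographic: "inj stereographic"
proof (rule injI)
  fix x y assume eq: "stereographic x = stereographic y"
  show "x = y"
  proof (cases x; cases y)
    fix z w assume xy: "x = Fin z" "y = Fin w"
    define a where "a = (cmod z)\<^sup>2"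
    define b where "b = (cmod w)\<^sup>2"
    have ab: "1 + a > 0" "1 + b > 0" by (simp_all add: a_def b_def add_pos_nonneg)
    have "(a - 1) / (1 + a) = (b - 1) / (1 + b)"
      using eq by (simp add: xy a_def b_def)
    then have "a = b" using ab by (simp add: field_simps)
    moreover have "2 * z / of_real (1 + a) = 2 * w / of_real (1 + b)"
      using eq by (simp add: xy a_def b_def)
    moreover have "of_real (1 + a) \<noteq> (0::complex)"
      using ab by (metis less_irrefl of_real_eq_0_iff)
    ultimately have "z = w" by simp
    then show "x = y" by (simp add: xy)
  qed (use eq stereographic_snd_Fin_neq_1 in \<open>auto simp: eq_commute[of 1]\<close>)
qed

instantiation riemann_sphere :: metric_space
begin

definition dist_riemann_sphere :: "riemann_sphere \<Rightarrow> riemann_sphere \<Rightarrow> real" where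
  "dist_riemann_sphere x y = dist (stereographic x) (stereographic y)"

definition uniformity_riemann_sphere :: "(riemann_sphere \<times> riemann_sphere) filter" where
  "uniformity_riemann_sphere = (INF e\<in>{0<..}. principal {(x, y). dist x y < e})"

definition open_riemann_sphere :: "riemann_sphere set \<Rightarrow> bool" where
  "open_riemann_sphere S \<longleftrightarrow> (\<forall>x\<in>S. \<forall>\<^sub>F (x', y) in uniformity. x' = x \<longrightarrow> y \<in> S)"

instance
proof
  fix x y z :: riemann_sphere
  show "dist x y = 0 \<longleftrightarrow> x = y"
    by (simp add: dist_riemann_sphere_def inj_eq[OF inj_stereographic])
  show "dist x y \<le> dist x z + dist y z"
    by (simp add: dist_riemann_sphere_def dist_triangle2)
qed (rule uniformity_riemann_sphere_def open_riemann_sphere_def)+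

end

section \<open>Meromorphic maps, degree, iteration\<close>

text \<open>
  A meromorphic map takes the value \<open>Infty\<close> exactly at its poles. The map that is identically
  \<open>Infty\<close> is thereby excluded.
\<close>

definition meromorphic_map :: "(complex \<Rightarrow> riemann_sphere) \<Rightarrow> bool" where
  "meromorphic_map f \<longleftrightarrow>
     (\<lambda>z. the_Fin (f z)) nicely_meromorphic_on UNIV \<and>
     (\<forall>z. f z = Infty \<longleftrightarrow> is_pole (\<lambda>z. the_Fin (f z)) z)"

definition local_multiplicity :: "(complex \<Rightarrow> riemann_sphere) \<Rightarrow> complex \<Rightarrow> nat" where
  "local_multiplicity f z = (case f z of
       Fin w \<Rightarrow> nat (zorder (\<lambda>x. the_Fin (f x) - w) z)
     | Infty \<Rightarrow> nat (- zorder (\<lambda>x. the_Fin (f x)) z))"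

text \<open>The number of preimages of \<open>w\<close> in \<open>A\<close>, counted with multiplicity.\<close>

definition preimage_count ::
  "(complex \<Rightarrow> riemann_sphere) \<Rightarrow> complex set \<Rightarrow> riemann_sphere \<Rightarrow> enat" where
  "preimage_count f A w =
     (SUP F \<in> {F. finite F \<and> F \<subseteq> {z\<in>A. f z = w}}. enat (\<Sum>z\<in>F. local_multiplicity f z))"

text \<open>
  For a rational map restricted to the plane the supremum is needed because a value taken at
  infinity has fewer preimages in the plane than the degree; transcendental maps have degree
  \<open>\<infinity>\<close>. If a Fatou component \<open>U\<close> is mapped properly into itself, every point of \<open>U\<close> has
  the same number of preimages in \<open>U\<close>, and this number is \<open>map_degree f U\<close>.
\<close>

definition map_degree :: "(complex \<Rightarrow> riemann_sphere) \<Rightarrow> complex set \<Rightarrow> enat" where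
  "map_degree f A = (if f constant_on A then 0 else (SUP w. preimage_count f A w))"

text \<open>
  The map is not defined at infinity, so \<open>f\<^sup>n\<close> is defined at \<open>z\<close> only if none of the earlier
  iterates of \<open>z\<close> is \<open>Infty\<close>; outside its domain \<open>iterate f n\<close> has the dummy value \<open>Infty\<close>.
\<close>

primrec iterate :: "(complex \<Rightarrow> riemann_sphere) \<Rightarrow> nat \<Rightarrow> complex \<Rightarrow> riemann_sphere" where
  "iterate f 0 z = Fin z"
| "iterate f (Suc n) z = (case iterate f n z of Fin w \<Rightarrow> f w | Infty \<Rightarrow> Infty)"

definition iterate_defined :: "(complex \<Rightarrow> riemann_sphere) \<Rightarrow> nat \<Rightarrow> complex \<Rightarrow> bool" where
  "iterate_defined f n z \<longleftrightarrow> (\<forall>k<n. iterate f k z \<noteq> Infty)"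

section \<open>Fatou components and Baker domains\<close>

definition locally_uniform_limit ::
  "complex set \<Rightarrow> (nat \<Rightarrow> complex \<Rightarrow> 'a::metric_space) \<Rightarrow> (complex \<Rightarrow> 'a) \<Rightarrow> bool" where
  "locally_uniform_limit A F g \<longleftrightarrow>
     (\<forall>K. compact K \<and> K \<subseteq> A \<longrightarrow> uniform_limit K F g sequentially)"

definition normal_family :: "complex set \<Rightarrow> (complex \<Rightarrow> riemann_sphere) set \<Rightarrow> bool" where
  "normal_family V \<F> \<longleftrightarrow>
     (\<forall>s :: nat \<Rightarrow> complex \<Rightarrow> riemann_sphere. range s \<subseteq> \<F> \<longrightarrow>
        (\<exists>r g. strict_mono (r :: nat \<Rightarrow> nat) \<and> locally_uniform_limit V (s \<circ> r) g))"

definition fatou_set :: "(complex \<Rightarrow> riemann_sphere) \<Rightarrow> complex set" where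
  "fatou_set f = {z. \<exists>V. open V \<and> z \<in> V \<and>
     (\<forall>n. \<forall>w\<in>V. iterate_defined f n w) \<and> normal_family V (range (iterate f))}"

definition invariant_Baker_domain :: "(complex \<Rightarrow> riemann_sphere) \<Rightarrow> complex set \<Rightarrow> bool" where
  "invariant_Baker_domain f U \<longleftrightarrow>
     U \<in> components (fatou_set f) \<and> f ` U \<subseteq> Fin ` U \<and>
     locally_uniform_limit U (iterate f) (\<lambda>_. Infty)"

definition dense_trajectory_points :: "(complex \<Rightarrow> riemann_sphere) \<Rightarrow> complex set \<Rightarrow> complex set" where
  "dense_trajectory_points f A = {z\<in>A. \<exists>x :: nat \<Rightarrow> complex.
     (\<forall>n. iterate f n z = Fin (x n)) \<and> range x \<subseteq> A \<and> A \<subseteq> closure (range x)}"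

section \<open>Riemann maps, the associated inner function and its type\<close>

abbreviation unit_disc :: "complex set" where
  "unit_disc \<equiv> ball 0 1"

abbreviation unit_circle :: "complex set" where
  "unit_circle \<equiv> sphere 0 1"

definition Riemann_map :: "(complex \<Rightarrow> complex) \<Rightarrow> complex set \<Rightarrow> bool" where
  "Riemann_map \<phi> U \<longleftrightarrow> \<phi> holomorphic_on unit_disc \<and> bij_betw \<phi> unit_disc U"

definition associated_inner_function ::
  "(complex \<Rightarrow> complex) \<Rightarrow> (complex \<Rightarrow> riemann_sphere) \<Rightarrow> complex \<Rightarrow> complex" where
  "associated_inner_function \<phi> f z = inv_into unit_disc \<phi> (the_Fin (f (\<phi> z)))"

definition Denjoy_Wolff_point :: "(complex \<Rightarrow> complex) \<Rightarrow> complex \<Rightarrow> bool" where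
  "Denjoy_Wolff_point g p \<longleftrightarrow>
     p \<in> unit_circle \<and> locally_uniform_limit unit_disc (\<lambda>n. g ^^ n) (\<lambda>_. p)"

definition singular_point :: "(complex \<Rightarrow> complex) \<Rightarrow> complex \<Rightarrow> bool" where
  "singular_point g \<zeta> \<longleftrightarrow> \<zeta> \<in> unit_circle \<and>
     \<not> (\<exists>N h. open N \<and> \<zeta> \<in> N \<and> h holomorphic_on N \<and> (\<forall>z \<in> N \<inter> unit_disc. h z = g z))"

definition absorbing :: "(complex \<Rightarrow> complex) \<Rightarrow> complex set \<Rightarrow> complex set \<Rightarrow> bool" where
  "absorbing h V W \<longleftrightarrow>
     V \<subseteq> W \<and> h ` V \<subseteq> V \<and> (\<forall>K. compact K \<and> K \<subseteq> W \<longrightarrow> (\<exists>n. (h ^^ n) ` K \<subseteq> V))"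

definition Cowen_model ::
  "(complex \<Rightarrow> complex) \<Rightarrow> complex set \<Rightarrow> complex set \<Rightarrow>
   (complex \<Rightarrow> complex) \<Rightarrow> (complex \<Rightarrow> complex) \<Rightarrow> bool" where
  "Cowen_model h V \<Omega> \<psi> T \<longleftrightarrow>
     open V \<and> V \<noteq> {} \<and> connected V \<and> simply_connected V \<and> absorbing h V unit_disc \<and>
     \<psi> holomorphic_on unit_disc \<and> \<psi> ` unit_disc \<subseteq> \<Omega> \<and> absorbing T (\<psi> ` V) \<Omega> \<and>
     (\<forall>z\<in>unit_disc. \<psi> (h z) = T (\<psi> z)) \<and> inj_on \<psi> V"

text \<open>
  A conjugation of \<open>T\<close> by a Moebius map \<open>A\<close> preserving the plane is absorbed by replacing \<open>\<psi>\<close>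
  with \<open>A \<circ> \<psi>\<close>, so \<open>T\<close> may be taken in normal form.
\<close>

definition doubly_parabolic_type :: "(complex \<Rightarrow> complex) \<Rightarrow> bool" where
  "doubly_parabolic_type h \<longleftrightarrow> (\<exists>V \<psi>. Cowen_model h V UNIV \<psi> (\<lambda>\<omega>. \<omega> + 1))"

section \<open>Harmonic measure\<close>

text \<open>Normalized Lebesgue measure on the unit circle.\<close>

definition circle_measure :: "complex measure" where
  "circle_measure =
     distr (uniform_measure lborel {0..2 * pi}) (restrict_space borel unit_circle) cis"

text \<open>
  Where the radial limit does not exist (for a Riemann map, on a null set), the value is an
  unspecified constant not depending on the point.
\<close>

definition radial_limit :: "(complex \<Rightarrow> complex) \<Rightarrow> complex \<Rightarrow> complex" where
  "radial_limit \<phi> \<zeta> = Lim (at_left 1) (\<lambda>r::real. \<phi> (of_real r * \<zeta>))"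

definition harmonic_measure :: "(complex \<Rightarrow> complex) \<Rightarrow> complex measure" where
  "harmonic_measure \<phi> = distr circle_measure borel (radial_limit \<phi>)"

lemma prob_space_circle_measure: "prob_space circle_measure"
proof -
  have "prob_space (uniform_measure lborel {0..2 * pi})"
    by (rule prob_space_uniform_measure) auto
  moreover have "cis \<in> uniform_measure lborel {0..2 * pi} \<rightarrow>\<^sub>M restrict_space borel unit_circle"
  proof (rule measurable_restrict_space2)
    have "cis \<in> borel_measurable borel"
      by (intro borel_measurable_continuous_onI continuous_intros)
    then show "cis \<in> borel_measurable (uniform_measure lborel {0..2 * pi})"
      by (simp cong: measurable_cong_sets)
  qed auto
  ultimately show ?thesis
    unfolding circle_measure_def by (rule prob_space.prob_space_distr)
qed

lemma measurable_radial_limit: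
  assumes "continuous_on unit_disc \<phi>"
  shows "radial_limit \<phi> \<in> borel_measurable circle_measure"
proof -
  let ?M = "restrict_space borel unit_circle :: complex measure"
  define u where "u = (\<lambda>(r::real) \<zeta>. \<phi> (of_real r * \<zeta>))"
  define c where "c = (\<lambda>\<zeta>. lim (\<lambda>n. u (1 - 1 / real (Suc n)) \<zeta>))"
  define I where "I = (\<lambda>N. {1 - 1 / real (Suc N)<..<1})"
  define E where "E \<zeta> \<longleftrightarrow>
    (\<forall>k. \<exists>N. \<forall>q::rat. of_rat q \<in> I N \<longrightarrow> dist (u (of_rat q) \<zeta>) (c \<zeta>) \<le> 1 / real (Suc k))" for \<zeta>
  have I_sub: "I N \<subseteq> {0..<1}" for N
  proof
    fix x assume "x \<in> I N"
    moreover have "0 \<le> 1 - 1 / real (Suc N)" by simp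
    ultimately show "x \<in> {0..<1}"
      unfolding I_def greaterThanLessThan_iff atLeastLessThan_iff by linarith
  qed
  have u_meas: "u r \<in> borel_measurable ?M" if "r \<in> {0..<1}" for r
    unfolding u_def
    by (intro borel_measurable_continuous_on_restrict continuous_on_compose2[OF assms] continuous_intros)
       (use that in \<open>auto simp: norm_mult\<close>)
  have c_meas: "c \<in> borel_measurable ?M"
    unfolding c_def by (intro borel_measurable_lim_metric u_meas) auto
  have seq: "filterlim (\<lambda>n. 1 - 1 / real (Suc n)) (at_left 1) sequentially"
    by real_asymp
  have E_iff: "E \<zeta> \<longleftrightarrow> (\<exists>l. ((\<lambda>r. u r \<zeta>) \<longlongrightarrow> l) (at_left 1))"
    and lim_c: "((\<lambda>r. u r \<zeta>) \<longlongrightarrow> l) (at_left 1) \<Longrightarrow> l = c \<zeta>" if "\<zeta> \<in> unit_circle" for \<zeta> l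
  proof -
    have cont: "continuous_on {0..<1} (\<lambda>r. u r \<zeta>)"
      unfolding u_def
      by (intro continuous_on_compose2[OF assms] continuous_intros)
         (use that in \<open>auto simp: norm_mult\<close>)
    show lim_c: "l = c \<zeta>" if "((\<lambda>r. u r \<zeta>) \<longlongrightarrow> l) (at_left 1)" for l
      unfolding c_def using filterlim_compose[OF that seq] by (simp add: limI)
    show "E \<zeta> \<longleftrightarrow> (\<exists>l. ((\<lambda>r. u r \<zeta>) \<longlongrightarrow> l) (at_left 1))"
    proof
      assume E: "E \<zeta>"
      have "((\<lambda>r. u r \<zeta>) \<longlongrightarrow> c \<zeta>) (at_left 1)"
      proof (rule tendstoI)
        fix e :: real assume "e > 0"
        then obtain k where k: "1 / real (Suc k) < e"
          using nat_approx_posE by (metis)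
        obtain N where N: "\<And>q::rat. of_rat q \<in> I N \<Longrightarrow> dist (u (of_rat q) \<zeta>) (c \<zeta>) \<le> 1 / real (Suc k)"
          using E unfolding E_def by blast
        have le: "dist (u r \<zeta>) (c \<zeta>) \<le> 1 / real (Suc k)" if r: "r \<in> I N" for r
        proof (rule ccontr)
          assume "\<not> ?thesis"
          then have gt: "dist (u r \<zeta>) (c \<zeta>) > 1 / real (Suc k)" by linarith
          have "isCont (\<lambda>r. u r \<zeta>) r"
            using continuous_on_subset[OF cont I_sub[of N]] r
            by (simp add: continuous_on_eq_continuous_at I_def)
          then have "((\<lambda>s. u s \<zeta>) \<longlongrightarrow> u r \<zeta>) (nhds r)"
            using tendsto_at_iff_tendsto_nhds[of "\<lambda>s. u s \<zeta>" r] by (simp add: isCont_def)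
          then have "((\<lambda>s. dist (u s \<zeta>) (c \<zeta>)) \<longlongrightarrow> dist (u r \<zeta>) (c \<zeta>)) (nhds r)"
            by (intro tendsto_dist tendsto_const)
          from order_tendstoD(1)[OF this gt]
          have "\<forall>\<^sub>F s in nhds r. dist (u s \<zeta>) (c \<zeta>) > 1 / real (Suc k)" .
          moreover have "\<forall>\<^sub>F s in nhds r. s \<in> I N"
            using r by (intro eventually_nhds_in_open) (auto simp: I_def)
          ultimately have "\<forall>\<^sub>F s in nhds r. s \<in> I N \<and> dist (u s \<zeta>) (c \<zeta>) > 1 / real (Suc k)"
            by eventually_elim simp
          then obtain d where d: "d > 0"
            and d': "\<And>s. dist s r < d \<Longrightarrow> s \<in> I N \<and> dist (u s \<zeta>) (c \<zeta>) > 1 / real (Suc k)"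
            by (auto simp: eventually_nhds_metric)
          obtain q :: rat where "r < of_rat q" "of_rat q < r + d"
            using of_rat_dense[of r "r + d"] d by auto
          with d'[of "of_rat q"] N[of q] show False
            by (auto simp: dist_real_def)
        qed
        have "\<forall>\<^sub>F r in at_left 1. r \<in> I N"
          unfolding I_def by (rule eventually_at_leftI[of "1 - 1 / real (Suc N)"]) auto
        then show "\<forall>\<^sub>F r in at_left 1. dist (u r \<zeta>) (c \<zeta>) < e"
          by eventually_elim (use le k in force)
      qed
      then show "\<exists>l. ((\<lambda>r. u r \<zeta>) \<longlongrightarrow> l) (at_left 1)" by blast
    next
      assume "\<exists>l. ((\<lambda>r. u r \<zeta>) \<longlongrightarrow> l) (at_left 1)"
      then have lim: "((\<lambda>r. u r \<zeta>) \<longlongrightarrow> c \<zeta>) (at_left 1)" using lim_c by blast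
      show "E \<zeta>" unfolding E_def
      proof
        fix k
        have "\<forall>\<^sub>F r in at_left 1. dist (u r \<zeta>) (c \<zeta>) < 1 / real (Suc k)"
          by (rule tendstoD[OF lim]) simp
        then obtain b where b: "b < 1" "\<And>r. b < r \<Longrightarrow> r < 1 \<Longrightarrow> dist (u r \<zeta>) (c \<zeta>) < 1 / real (Suc k)"
          by (auto simp: eventually_at_left[of "0::real" 1])
        then obtain N where "1 / real (Suc N) < 1 - b"
          using nat_approx_posE[of "1 - b"] by auto
        with b(2) show "\<exists>N. \<forall>q::rat. of_rat q \<in> I N \<longrightarrow>
            dist (u (of_rat q) \<zeta>) (c \<zeta>) \<le> 1 / real (Suc k)"
          by (intro exI[of _ N]) (force simp: I_def intro: less_imp_le)
      qed
    qed
  qed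
  have E_meas: "Measurable.pred ?M E"
    unfolding E_def
  proof (intro pred_intros_countable)
    fix k N :: nat and q :: rat
    show "Measurable.pred ?M (\<lambda>\<zeta>. of_rat q \<in> I N \<longrightarrow> dist (u (of_rat q) \<zeta>) (c \<zeta>) \<le> 1 / real (Suc k))"
    proof (cases "of_rat q \<in> I N")
      case True
      then have [measurable]: "u (of_rat q) \<in> borel_measurable ?M"
        using I_sub by (intro u_meas) blast
      show ?thesis using c_meas by measurable
    qed simp
  qed
  have eq: "radial_limit \<phi> \<zeta> = (if E \<zeta> then c \<zeta> else (THE l. False))" if "\<zeta> \<in> space ?M" for \<zeta>
  proof (cases "E \<zeta>")
    case True
    then have "((\<lambda>r. u r \<zeta>) \<longlongrightarrow> c \<zeta>) (at_left 1)"
      using E_iff lim_c that by (metis space_restrict_space2 sets.top sets_borel space_borel inf_top_right space_restrict_space)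
    then show ?thesis
      using True by (auto simp: radial_limit_def u_def intro!: tendsto_Lim)
  next
    case False
    then have "\<And>l. \<not> ((\<lambda>r. u r \<zeta>) \<longlongrightarrow> l) (at_left 1)"
      using E_iff that by (auto simp: space_restrict_space)
    then show ?thesis
      using False by (simp add: radial_limit_def Topological_Spaces.Lim_def u_def)
  qed
  have "(\<lambda>\<zeta>. if E \<zeta> then c \<zeta> else (THE l. False)) \<in> borel_measurable ?M"
    using E_meas c_meas by measurable
  then have "radial_limit \<phi> \<in> borel_measurable ?M"
    using eq by (subst measurable_cong) auto
  then show ?thesis
    by (simp add: circle_measure_def cong: measurable_cong_sets)
qed

lemma prob_space_harmonic_measure:
  assumes "Riemann_map \<phi> U"
  shows "prob_space (harmonic_measure \<phi>)"
  unfolding harmonic_measure_def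
  by (intro prob_space.prob_space_distr prob_space_circle_measure measurable_radial_limit
        holomorphic_on_imp_continuous_on)
     (use assms in \<open>simp add: Riemann_map_def\<close>)

text \<open>The completion makes sense of null sets that are not Borel.\<close>

definition full_harmonic_measure :: "(complex \<Rightarrow> complex) \<Rightarrow> complex set \<Rightarrow> complex set \<Rightarrow> bool" where
  "full_harmonic_measure \<phi> U A \<longleftrightarrow> frontier U - A \<in> null_sets (completion (harmonic_measure \<phi>))"

end

theory Submission
  imports Defs
begin

text \<open>
  The associated inner function \<open>g\<close> has a boundary map \<open>G\<close> of the circle, which transports Poisson
  measures: the image under \<open>G\<close> of the harmonic measure at \<open>z\<close> is the harmonic measure at \<open>g z\<close>. As
  the type is doubly parabolic, \<open>g\<^sup>n\<close> contracts the hyperbolic distance to zero, so that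
  bounded \<open>g\<close>-invariant Poisson integrals are constant, i.e. \<open>G\<close> is ergodic. If
  \<open>\<Sum> 1 - \<bar>g\<^sup>n 0\<bar>\<close> diverges, \<open>G\<close> has no wandering sets of positive measure, and
  almost every orbit visits every set of positive measure. The divergence is a matter of local dynamics
  at a non-singular Denjoy--Wolff point: in a half-plane coordinate with that point at infinity, the type
  excludes all maps but \<open>w + O(1/w)\<close>, for which \<open>\<bar>w\<^sub>n\<bar>\<^sup>2\<close> grows at most linearly, while
  the height of \<open>w\<^sub>n\<close> does not decrease (Julia's lemma). If the degree is finite, \<open>g\<close> stays
  away from some value near the circle and hence extends across it by reflection. Finally, \<open>\<phi>\<close> has
  radial limits almost everywhere, intertwining \<open>G\<close> with \<open>f\<close> on the boundary of \<open>U\<close>, and every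
  disc centred at the boundary of \<open>U\<close> has positive harmonic measure.
\<close>

section \<open>Differentiability of Lipschitz functions\<close>

text \<open>Boundary behaviour is phrased through radial limits, and the obstacle is that these do
  not compose by themselves: \<open>g\<close> carries a radius to a curve that need not end
  radially, the Riemann map is unbounded in general, and \<open>f\<close> may have poles on the
  frontier of \<open>U\<close>. Two devices deal with this. Boundary functions are identified by
  comparing their Poisson integrals, which avoids nontangential limits altogether. And
  \<open>\<phi>\<close> is written through a bounded nonvanishing function, a Moebius image of a
  square root of \<open>\<phi> - z0\<close>, whose radial limits are almost never zero; hence
  \<open>\<phi>\<close> has finite limits along almost all radii and along their images under
  \<open>g\<close>, and the latter exclude poles. The series enters because the preimage of a set
  \<open>W\<close> under the \<open>n\<close>-th iterate of \<open>G\<close> has at least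
  \<open>(1 - |g^n 0|) / 2\<close> times the measure of \<open>W\<close>, so that disjoint preimages
  of a set of positive measure would make it converge. In the case of finite degree no Denjoy--Wolff
  point is given in advance; it arises as the limit of the orbit of 0, whose steps tend to zero
  while its limit points lie among finitely many fixed points.\<close>

lemma emeasure_interval_measure_le_Lipschitz:
  fixes F :: "real \<Rightarrow> real"
  assumes mono: "\<And>x y. x \<le> y \<Longrightarrow> F x \<le> F y"
    and lip: "\<And>x y. x \<le> y \<Longrightarrow> F y - F x \<le> K * (y - x)"
    and cont: "continuous_on UNIV F"
    and A: "A \<in> sets borel"
  shows "emeasure (interval_measure F) A \<le> ennreal K * emeasure lborel A"
proof -
  \<comment> \<open>The complementary function is monotone as well, and the interval measures of
    \<open>F\<close> and \<open>G\<close> add up to \<open>K\<close> times Lebesgue measure; so each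
    of them is dominated by it.\<close>
  define G where "G = (\<lambda>x. K * x - F x)"
  have K: "K \<ge> 0" using mono[of 0 1] lip[of 0 1] by simp
  have monoG: "G x \<le> G y" if "x \<le> y" for x y
    using lip[OF that] by (simp add: G_def algebra_simps)
  have contG: "continuous_on UNIV G" unfolding G_def by (intro continuous_intros cont)
  have rc: "continuous (at_right a) H" if "continuous_on UNIV H" for a and H :: "real \<Rightarrow> real"
    using that by (simp add: continuous_on_eq_continuous_at continuous_at_imp_continuous_within)
  let ?M = "interval_measure F" and ?N = "interval_measure G"
  note eF = emeasure_interval_measure_Ioc[of _ _ F, OF _ mono rc[OF cont]]
  note eG = emeasure_interval_measure_Ioc[of _ _ G, OF _ monoG rc[OF contG]]
  have Ioc: "emeasure ?M {a<..b} + emeasure ?N {a<..b} = ennreal K * emeasure lborel {a<..b}" for a b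
  proof (cases "a \<le> b")
    case True
    have "F b - F a \<ge> 0" "G b - G a \<ge> 0" using mono[OF True] monoG[OF True] by auto
    moreover have "(F b - F a) + (G b - G a) = K * (b - a)"
      by (simp add: G_def algebra_simps)
    ultimately show ?thesis
      using True K by (simp add: eF eG ennreal_plus[symmetric] ennreal_mult[symmetric] del: ennreal_plus)
  qed simp
  have fin: "emeasure ?M {a<..b} < \<infinity>" "emeasure ?N {a<..b} < \<infinity>" for a b
    by (cases "a \<le> b"; simp add: eF eG)+
  \<comment> \<open>Intersecting with a bounded interval keeps all the measures finite, so that the
    complement case of the induction over the generated sigma-algebra may cancel.\<close>
  have eq: "emeasure ?M (A \<inter> {a<..b}) + emeasure ?N (A \<inter> {a<..b}) = ennreal K * emeasure lborel (A \<inter> {a<..b})"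
    for a b
  proof -
    let ?G = "range (\<lambda>(a, b). {a<..b::real})"
    have 1: "A \<in> sigma_sets UNIV ?G" using A by (simp add: borel_sigma_sets_Ioc)
    have 2: "Int_stable ?G"
      by (auto simp: Int_stable_def)
    have 3: "?G \<subseteq> Pow UNIV" by auto
    from 2 3 1 show ?thesis
    proof (induction rule: sigma_sets_induct_disjoint)
      case (basic A)
      then obtain c d where "A = {c<..d}" by auto
      then show ?case using Ioc by (simp add: Int_greaterThanAtMost)
    next
      case (compl A)
      have Ab: "A \<in> sets borel" using compl by (simp add: borel_sigma_sets_Ioc)
      have d: "(UNIV - A) \<inter> {a<..b} = {a<..b} - (A \<inter> {a<..b})" by auto
      have finA: "emeasure M (A \<inter> {a<..b}) \<noteq> \<infinity>" if "emeasure M {a<..b} < \<infinity>" "sets M = sets borel" for M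
        using that emeasure_mono[of "A \<inter> {a<..b}" "{a<..b}" M] by (auto simp: top_unique)
      have dd: "emeasure M ((UNIV - A) \<inter> {a<..b}) + emeasure M (A \<inter> {a<..b}) = emeasure M {a<..b}"
        if "sets M = sets borel" for M
        using Ab that by (subst plus_emeasure) (auto intro!: arg_cong[where f="emeasure M"])
      have f1: "emeasure ?M (A \<inter> {a<..b}) \<noteq> \<infinity>" "emeasure ?N (A \<inter> {a<..b}) \<noteq> \<infinity>"
        using finA[OF fin(1)] finA[OF fin(2)] by simp_all
      then have fs: "emeasure ?M (A \<inter> {a<..b}) + emeasure ?N (A \<inter> {a<..b}) \<noteq> \<top>"
        by simp
      have "(emeasure ?M ((UNIV - A) \<inter> {a<..b}) + emeasure ?N ((UNIV - A) \<inter> {a<..b}))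
          + (emeasure ?M (A \<inter> {a<..b}) + emeasure ?N (A \<inter> {a<..b}))
          = emeasure ?M {a<..b} + emeasure ?N {a<..b}"
        using dd[of ?M] dd[of ?N] by (simp add: ac_simps)
      also have "\<dots> = ennreal K * (emeasure lborel ((UNIV - A) \<inter> {a<..b}) + emeasure lborel (A \<inter> {a<..b}))"
        using Ioc[of a b] dd[of lborel] by simp
      also have "\<dots> = ennreal K * emeasure lborel ((UNIV - A) \<inter> {a<..b})
          + (emeasure ?M (A \<inter> {a<..b}) + emeasure ?N (A \<inter> {a<..b}))"
        using compl by (simp add: distrib_left)
      finally show ?case using fs by (metis ennreal_add_left_cancel add.commute infinity_ennreal_def)
    next
      case (union A)
      have Ab: "A i \<in> sets borel" for i using union by (auto simp: borel_sigma_sets_Ioc)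
      have *: "emeasure M ((\<Union>i. A i) \<inter> {a<..b}) = (\<Sum>i. emeasure M (A i \<inter> {a<..b}))"
        if "sets M = sets borel" for M
        using union(1) Ab that
        by (subst suminf_emeasure) (auto simp: disjoint_family_on_def image_subset_iff intro!: arg_cong[where f="emeasure M"])
      show ?case
        by (simp add: * suminf_add union)
    qed auto
  qed
  have le: "emeasure ?M (A \<inter> {-real n<..real n}) \<le> ennreal K * emeasure lborel A" for n
  proof -
    have "emeasure ?M (A \<inter> {-real n<..real n}) \<le> ennreal K * emeasure lborel (A \<inter> {-real n<..real n})"
      by (subst eq[symmetric]) simp
    also have "\<dots> \<le> ennreal K * emeasure lborel A"
      using A by (intro mult_left_mono emeasure_mono) auto
    finally show ?thesis .
  qed
  have "(\<Union>n. A \<inter> {-real n<..real n}) = A"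
  proof -
    have "\<exists>n. -real n < x \<and> x \<le> real n" for x
    proof -
      obtain n where "\<bar>x\<bar> < real n" using reals_Archimedean2 by blast
      then show ?thesis by (intro exI[of _ n]) auto
    qed
    then show ?thesis by auto
  qed
  moreover have "(SUP n. emeasure ?M (A \<inter> {-real n<..real n})) = emeasure ?M (\<Union>n. A \<inter> {-real n<..real n})"
    using A by (intro SUP_emeasure_incseq) (auto simp: incseq_def)
  ultimately have "emeasure ?M A = (SUP n. emeasure ?M (A \<inter> {-real n<..real n}))" by simp
  also have "\<dots> \<le> ennreal K * emeasure lborel A" by (rule SUP_least) (rule le)
  finally show ?thesis .
qed

text \<open>Vitali covering: almost all of \<open>E\<close> is covered by disjoint small balls on
  which the comparison holds, all of them inside an open set barely larger than \<open>E\<close>;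
  summing over the balls transfers the inequality. Absolute continuity \<open>ac\<close> controls
  the uncovered part of \<open>E\<close> in the upper bound and the excess of the open set in the
  lower bound.\<close>

lemma
  fixes M :: "real measure"
  assumes sM: "sets M = sets borel"
    and ac: "\<And>A. A \<in> sets borel \<Longrightarrow> emeasure M A \<le> ennreal K * emeasure lborel A"
    and E: "E \<in> sets borel" and K: "K \<ge> 0" and c: "c \<ge> 0"
  shows emeasure_le_if_small_intervals_le:
      "(\<And>x d. x \<in> E \<Longrightarrow> d > 0 \<Longrightarrow> \<exists>a r. x \<in> cball a r \<and> 0 < r \<and> r < d \<and>
          emeasure M (cball a r) \<le> ennreal c * emeasure lborel (cball a r)) \<Longrightarrow>
        emeasure M E \<le> ennreal c * emeasure lborel E"
    and emeasure_ge_if_small_intervals_ge: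
      "(\<And>x d. x \<in> E \<Longrightarrow> d > 0 \<Longrightarrow> \<exists>a r. x \<in> cball a r \<and> 0 < r \<and> r < d \<and>
          ennreal c * emeasure lborel (cball a r) \<le> emeasure M (cball a r)) \<Longrightarrow>
        ennreal c * emeasure lborel E \<le> emeasure M E"
proof -
  \<comment> \<open>The property \<open>Q\<close> of the balls is left open so that one covering
    argument serves both inequalities.\<close>
  have cover: "\<exists>C W. countable C \<and> (\<forall>i\<in>C. Q (fst i) (snd i)) \<and>
      disjoint_family_on (\<lambda>(a, r). cball a r) C \<and> (\<Union>(a, r)\<in>C. cball a r) \<subseteq> W \<and>
      E \<subseteq> W \<and> W \<in> sets borel \<and> emeasure lborel (W - E) \<le> ennreal e \<and>
      emeasure lborel (E - (\<Union>(a, r)\<in>C. cball a r)) = 0"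
    if Q: "\<forall>x\<in>E. \<forall>d>0. \<exists>a r. x \<in> cball a r \<and> 0 < r \<and> r < d \<and> Q a r"
      and e: "e > 0" for Q :: "real \<Rightarrow> real \<Rightarrow> bool" and e :: real
  proof -
    obtain T where T: "open T" "E \<subseteq> T" "(T - E) \<in> lmeasurable" "emeasure lebesgue (T - E) < ennreal e"
      using sets_lebesgue_outer_open[of E e] E e by auto
    define I where "I = {(a, r). 0 < r \<and> cball a r \<subseteq> T \<and> Q a r}"
    have S: "\<exists>i. i \<in> I \<and> x \<in> cball (fst i) (snd i) \<and> snd i < d" if "x \<in> E" "d > 0" for x d
    proof -
      have "x \<in> T" using T(2) that(1) by (rule subsetD)
      with T(1) obtain \<delta> where \<delta>: "\<delta> > 0" "ball x \<delta> \<subseteq> T" by (rule openE)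
      have "min d (\<delta>/2) > 0" using that \<delta> by simp
      from Q[rule_format, OF that(1) this] obtain a r where ar: "x \<in> cball a r" "0 < r" "r < min d (\<delta>/2)" "Q a r"
        by (elim exE conjE) (rule that)
      have "cball a r \<subseteq> ball x \<delta>"
        using ar by (auto simp: dist_real_def)
      then show ?thesis using ar \<delta> by (intro exI[of _ "(a, r)"]) (auto simp: I_def)
    qed
    obtain C where C: "countable C" "C \<subseteq> I"
       "pairwise (\<lambda>i j. disjnt (cball (fst i) (snd i)) (cball (fst j) (snd j))) C"
       "negligible(E - (\<Union>i \<in> C. cball (fst i) (snd i)))"
    proof (rule Vitali_covering_theorem_cballs[of I snd E fst])
      show "0 < snd i" if "i \<in> I" for i using that by (auto simp: I_def)
    qed (rule S)
    have "(E - (\<Union>i \<in> C. cball (fst i) (snd i))) \<in> sets borel"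
      using C(1) E by (intro sets.Diff sets.countable_UN') auto
    then have "emeasure lborel (E - (\<Union>i \<in> C. cball (fst i) (snd i))) = 0"
      using C(4) by (simp add: negligible_iff_null_sets null_sets_def)
    moreover have "T \<in> sets borel" using T by auto
    moreover have "emeasure lborel (T - E) \<le> ennreal e"
      using T E by (simp add: less_imp_le)
    moreover have "cball a r \<subseteq> T" if "(a, r) \<in> C" for a r using C(2) that by (auto simp: I_def)
    then have "(\<Union>(a, r)\<in>C. cball a r) \<subseteq> T" by blast
    moreover have "\<forall>i\<in>C. Q (fst i) (snd i)" using C(2) by (auto simp: I_def)
    moreover have "disjoint_family_on (\<lambda>(a, r). cball a r) C"
      using C(3) by (simp add: disjoint_family_on_def pairwise_def disjnt_def case_prod_beta)
    ultimately show ?thesis using C(1) T(1,2)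
      by (intro exI[of _ C] exI[of _ T]) (simp add: case_prod_beta)
  qed
  have U: "emeasure N (\<Union>(a, r)\<in>C. cball a r) = (\<integral>\<^sup>+i. emeasure N (cball (fst i) (snd i)) \<partial>count_space C)"
    if "countable C" "disjoint_family_on (\<lambda>(a, r). cball a r) C" "sets N = sets borel"
    for C :: "(real \<times> real) set" and N :: "real measure"
    using that by (subst emeasure_UN_countable) (auto simp: case_prod_beta)
  have Usets: "(\<Union>(a, r)\<in>C. cball a r) \<in> sets borel" if "countable C" for C :: "(real \<times> real) set"
    using that by (intro sets.countable_UN') auto
  have mono0: "emeasure N E \<le> emeasure N (\<Union>(a, r)\<in>C. cball a r) + emeasure N (E - (\<Union>(a, r)\<in>C. cball a r))"
    if "countable C" "sets N = sets borel" for C :: "(real \<times> real) set" and N :: "real measure"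
    using that E Usets[OF that(1)] by (subst plus_emeasure) (auto intro!: emeasure_mono)
  have ac0: "emeasure M A = 0" if "A \<in> sets borel" "emeasure lborel A = 0" for A
    using ac[OF that(1)] that(2) by simp
  {
    assume "\<And>x d. x \<in> E \<Longrightarrow> d > 0 \<Longrightarrow> \<exists>a r. x \<in> cball a r \<and> 0 < r \<and> r < d \<and>
          emeasure M (cball a r) \<le> ennreal c * emeasure lborel (cball a r)"
    then have QQ: "\<forall>x\<in>E. \<forall>d>0. \<exists>a r. x \<in> cball a r \<and> 0 < r \<and> r < d \<and>
          emeasure M (cball a r) \<le> ennreal c * emeasure lborel (cball a r)" by simp
    show "emeasure M E \<le> ennreal c * emeasure lborel E"
    proof (rule ennreal_le_epsilon)
      fix e :: real assume e: "e > 0"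
      \<comment> \<open>Dividing by \<open>c + 1\<close> rather than \<open>c\<close> covers the
        case \<open>c = 0\<close>.\<close>
      have "e / (c + 1) > 0" using e c by simp
      from cover[OF QQ this] obtain C T where C: "countable C"
        "\<forall>i\<in>C. emeasure M (cball (fst i) (snd i)) \<le> ennreal c * emeasure lborel (cball (fst i) (snd i))"
        "disjoint_family_on (\<lambda>(a, r). cball a r) C" "(\<Union>(a, r)\<in>C. cball a r) \<subseteq> T"
        "E \<subseteq> T" "T \<in> sets borel" "emeasure lborel (T - E) \<le> ennreal (e / (c + 1))"
        "emeasure lborel (E - (\<Union>(a, r)\<in>C. cball a r)) = 0"
        by (elim exE conjE) (rule that)
      have "emeasure M E \<le> emeasure M (\<Union>(a, r)\<in>C. cball a r)"
        using mono0[OF C(1) sM] ac0[OF _ C(8)] E Usets[OF C(1)] by simp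
      also have "\<dots> \<le> (\<integral>\<^sup>+i. ennreal c * emeasure lborel (cball (fst i) (snd i)) \<partial>count_space C)"
        unfolding U[OF C(1,3) sM] using C(2) by (intro nn_integral_mono) auto
      also have "\<dots> = ennreal c * emeasure lborel (\<Union>(a, r)\<in>C. cball a r)"
        using U[OF C(1,3), of lborel] by (simp add: nn_integral_cmult)
      also have "\<dots> \<le> ennreal c * emeasure lborel T"
        using C by (intro mult_left_mono emeasure_mono) auto
      also have "emeasure lborel T = emeasure lborel E + emeasure lborel (T - E)"
        using C E by (subst plus_emeasure) (auto intro!: arg_cong[where f="emeasure lborel"])
      also have "ennreal c * \<dots> \<le> ennreal c * emeasure lborel E + ennreal c * ennreal (e / (c + 1))"
        using C(7) by (simp add: distrib_left mult_left_mono)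
      also have "ennreal c * ennreal (e / (c + 1)) \<le> ennreal e"
        using c e by (simp add: ennreal_mult[symmetric] field_simps)
      finally show "emeasure M E \<le> ennreal c * emeasure lborel E + ennreal e" by (simp add: add_left_mono)
    qed
  }
  {
    assume "\<And>x d. x \<in> E \<Longrightarrow> d > 0 \<Longrightarrow> \<exists>a r. x \<in> cball a r \<and> 0 < r \<and> r < d \<and>
          ennreal c * emeasure lborel (cball a r) \<le> emeasure M (cball a r)"
    then have QQ: "\<forall>x\<in>E. \<forall>d>0. \<exists>a r. x \<in> cball a r \<and> 0 < r \<and> r < d \<and>
          ennreal c * emeasure lborel (cball a r) \<le> emeasure M (cball a r)" by simp
    show "ennreal c * emeasure lborel E \<le> emeasure M E"
    proof (rule ennreal_le_epsilon)
      fix e :: real assume e: "e > 0"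
      have "e / (K + 1) > 0" using e K by simp
      from cover[OF QQ this] obtain C T where C: "countable C"
        "\<forall>i\<in>C. ennreal c * emeasure lborel (cball (fst i) (snd i)) \<le> emeasure M (cball (fst i) (snd i))"
        "disjoint_family_on (\<lambda>(a, r). cball a r) C" "(\<Union>(a, r)\<in>C. cball a r) \<subseteq> T"
        "E \<subseteq> T" "T \<in> sets borel" "emeasure lborel (T - E) \<le> ennreal (e / (K + 1))"
        "emeasure lborel (E - (\<Union>(a, r)\<in>C. cball a r)) = 0"
        by (elim exE conjE) (rule that)
      have "ennreal c * emeasure lborel E \<le> ennreal c * emeasure lborel (\<Union>(a, r)\<in>C. cball a r)"
        using mono0[OF C(1), of lborel] C(8) by (intro mult_left_mono) auto
      also have "\<dots> = (\<integral>\<^sup>+i. ennreal c * emeasure lborel (cball (fst i) (snd i)) \<partial>count_space C)"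
        using U[OF C(1,3), of lborel] by (simp add: nn_integral_cmult)
      also have "\<dots> \<le> emeasure M (\<Union>(a, r)\<in>C. cball a r)"
        unfolding U[OF C(1,3) sM] using C(2) by (intro nn_integral_mono) auto
      also have "\<dots> \<le> emeasure M T"
        using C sM by (intro emeasure_mono) auto
      also have "emeasure M T = emeasure M E + emeasure M (T - E)"
        using C E sM by (subst plus_emeasure) (auto intro!: arg_cong[where f="emeasure M"])
      also have "emeasure M (T - E) \<le> ennreal K * ennreal (e / (K + 1))"
        using ac[of "T - E"] C(6,7) E by (meson sets.Diff mult_left_mono order_trans zero_le)
      also have "ennreal K * ennreal (e / (K + 1)) \<le> ennreal e"
        using K e by (simp add: ennreal_mult[symmetric] field_simps)
      finally show "ennreal c * emeasure lborel E \<le> emeasure M E + ennreal e" by (simp add: add_left_mono)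
    qed
  }
qed

text \<open>Slopes are taken over small intervals with \<open>x\<close> strictly inside. Where they
  come arbitrarily often below \<open>p\<close> and above \<open>q\<close> for some
  \<open>p < q\<close>, the interval measure of \<open>F\<close> is at most \<open>p\<close> times
  and at least \<open>q\<close> times Lebesgue measure, so such points form a null set; countably
  many rational pairs suffice.\<close>

lemma Lipschitz_mono_differentiable_AE:
  fixes F :: "real \<Rightarrow> real"
  assumes mono: "\<And>x y. x \<le> y \<Longrightarrow> F x \<le> F y"
    and lip: "\<And>x y. x \<le> y \<Longrightarrow> F y - F x \<le> K * (y - x)"
  shows "AE x in lborel. \<exists>D. (F has_real_derivative D) (at x)"
proof -
  have K: "K \<ge> 0" using mono[of 0 1] lip[of 0 1] by simp
  have "dist (F x) (F y) \<le> K * dist x y" for x y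
    using mono[of x y] mono[of y x] lip[of x y] lip[of y x]
    by (cases "x \<le> y") (auto simp: dist_real_def abs_if)
  then have "K-lipschitz_on UNIV F" using K by (auto simp: lipschitz_on_def)
  then have cont: "continuous_on UNIV F" by (rule lipschitz_on_continuous_on)
  then have contF: "(F \<longlongrightarrow> F x) (at x within S)" for x S
    by (meson continuous_on_def UNIV_I tendsto_within_subset top_greatest)
  let ?M = "interval_measure F"
  note ac = emeasure_interval_measure_le_Lipschitz[OF mono lip cont]
  have eF: "emeasure ?M {s..t} = ennreal (F t - F s)" if "s \<le> t" for s t
    by (rule emeasure_interval_measure_Icc[OF that mono cont])
  define S where "S p = {x. \<forall>d>0. \<exists>s t. s < x \<and> x < t \<and> t - s < d \<and> F t - F s < p * (t - s)}" for p
  define T where "T q = {x. \<forall>d>0. \<exists>s t. s < x \<and> x < t \<and> t - s < d \<and> F t - F s > q * (t - s)}" for q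
  \<comment> \<open>Whatever \<open>P\<close> is, this is a countable intersection, over the scales
    \<open>1 / (n + 1)\<close>, of unions of open intervals; measurability thus costs no regularity
    of \<open>P\<close>.\<close>
  have G: "{x. \<forall>d>0. \<exists>s t. s < x \<and> x < t \<and> t - s < d \<and> P s t} \<in> sets borel" for P :: "real \<Rightarrow> real \<Rightarrow> bool"
  proof -
    have "{x. \<forall>d>0. \<exists>s t. s < x \<and> x < t \<and> t - s < d \<and> P s t} =
      (\<Inter>n. \<Union>(s, t)\<in>{(s, t). t - s < 1 / real (Suc n) \<and> P s t}. {s<..<t})" (is "?L = ?R")
    proof
      show "?L \<subseteq> ?R"
      proof (intro subsetI INT_I)
        fix x n assume x: "x \<in> ?L"
        have "1 / real (Suc n) > 0" by simp
        then obtain s t where "s < x" "x < t" "t - s < 1 / real (Suc n)" "P s t"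
          using x by blast
        then show "x \<in> (\<Union>(s, t)\<in>{(s, t). t - s < 1 / real (Suc n) \<and> P s t}. {s<..<t})" by force
      qed
      show "?R \<subseteq> ?L"
      proof (intro subsetI CollectI allI impI)
        fix x d :: real assume x: "x \<in> ?R" and d: "d > 0"
        obtain n where n: "1 / real (Suc n) < d" using nat_approx_posE[OF d] by blast
        from x have "x \<in> (\<Union>(s, t)\<in>{(s, t). t - s < 1 / real (Suc n) \<and> P s t}. {s<..<t})" by blast
        then obtain s t where "t - s < 1 / real (Suc n)" "P s t" "s < x" "x < t"
          by (auto simp del: of_nat_Suc)
        then show "\<exists>s t. s < x \<and> x < t \<and> t - s < d \<and> P s t" using n by fastforce
      qed
    qed
    also have "\<dots> \<in> sets borel" by (intro sets.countable_INT'') (auto intro!: borel_open open_UN)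
    finally show ?thesis .
  qed
  have meas: "S p \<in> sets borel" "T p \<in> sets borel" for p unfolding S_def T_def by (intro G)+
  \<comment> \<open>Cutting down to a bounded interval makes the Lebesgue measure a finite number
    \<open>e\<close>, so that \<open>q * e \<le> p * e\<close> forces it to vanish.\<close>
  have null: "emeasure lborel (S p \<inter> T q \<inter> {-real n..real n}) = 0" if pq: "p < q" "p \<ge> 0" for p q n
  proof -
    let ?E = "S p \<inter> T q \<inter> {-real n..real n}"
    have E: "?E \<in> sets borel" using meas by auto
    have ball: "cball ((s + t) / 2) ((t - s) / 2) = {s..t}" for s t :: real
      by (simp add: cball_eq_atLeastAtMost field_simps)
    have "emeasure ?M ?E \<le> ennreal p * emeasure lborel ?E"
    proof (rule emeasure_le_if_small_intervals_le[OF _ ac E K pq(2)])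
      fix x d :: real assume "x \<in> ?E" "d > 0"
      then obtain s t where "s < x" "x < t" "t - s < d" "F t - F s < p * (t - s)"
        by (auto simp: S_def)
      then show "\<exists>a r. x \<in> cball a r \<and> 0 < r \<and> r < d \<and> emeasure ?M (cball a r) \<le> ennreal p * emeasure lborel (cball a r)"
        using pq by (intro exI[of _ "(s + t) / 2"] exI[of _ "(t - s) / 2"])
          (simp add: ball eF ennreal_mult[symmetric] ennreal_leI)
    qed auto
    moreover have "ennreal q * emeasure lborel ?E \<le> emeasure ?M ?E"
    proof (rule emeasure_ge_if_small_intervals_ge[OF _ ac E K])
      fix x d :: real assume "x \<in> ?E" "d > 0"
      then obtain s t where "s < x" "x < t" "t - s < d" "F t - F s > q * (t - s)"
        by (auto simp: T_def)
      then show "\<exists>a r. x \<in> cball a r \<and> 0 < r \<and> r < d \<and> ennreal q * emeasure lborel (cball a r) \<le> emeasure ?M (cball a r)"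
        using pq by (intro exI[of _ "(s + t) / 2"] exI[of _ "(t - s) / 2"])
          (simp add: ball eF ennreal_mult[symmetric] ennreal_leI)
    qed (use pq in auto)
    ultimately have le: "ennreal q * emeasure lborel ?E \<le> ennreal p * emeasure lborel ?E" by simp
    have "emeasure lborel ?E \<le> emeasure lborel {-real n..real n}" by (intro emeasure_mono) auto
    also have "\<dots> < \<infinity>" by simp
    finally obtain e where e: "emeasure lborel ?E = ennreal e" "e \<ge> 0"
      by (cases "emeasure lborel ?E") auto
    then have "q * e \<le> p * e" using le pq by (simp add: ennreal_mult[symmetric] ennreal_le_iff)
    then have "e = 0" using e pq by (metis mult_le_cancel_right not_less order_antisym_conv)
    then show ?thesis using e by simp
  qed
  have AE: "AE x in lborel. \<forall>p\<in>\<rat>. \<forall>q\<in>\<rat>. 0 \<le> p \<longrightarrow> p < q \<longrightarrow> x \<notin> S p \<inter> T q"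
  proof -
    have "AE x in lborel. x \<notin> S p \<inter> T q" if pq: "0 \<le> p" "p < q" for p q
    proof -
      have "AE x in lborel. \<forall>n. x \<notin> S p \<inter> T q \<inter> {-real n..real n}"
        unfolding AE_all_countable
      proof
        fix n show "AE x in lborel. x \<notin> S p \<inter> T q \<inter> {-real n..real n}"
          using null[OF pq(2,1)] meas by (intro AE_not_in) (auto simp: null_sets_def)
      qed
      then show ?thesis
      proof eventually_elim
        case (elim x)
        obtain n where "\<bar>x\<bar> \<le> real n" using real_arch_simple by blast
        then show ?case using elim[rule_format, of n] by auto
      qed
    qed
    then show ?thesis by (simp add: AE_ball_countable countable_rat AE_impI)
  qed
  show ?thesis using AE
  proof eventually_elim
    case (elim x)
    \<comment> \<open>The supremum of these rationals is the lower limit of the slopes at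
      \<open>x\<close>; outside the null set the upper limit agrees with it, so it is the
      derivative.\<close>
    define A where "A = {p \<in> \<rat>. x \<notin> S p}"
    have dpos: "\<exists>s t. s < x \<and> x < t \<and> t - s < d" if "d > 0" for d :: real
      using that by (intro exI[of _ "x - d/3"] exI[of _ "x + d/3"]) auto
    have A_le: "p \<le> K" if "p \<in> A" for p
    proof (rule ccontr)
      assume "\<not> p \<le> K"
      have "x \<in> S p" unfolding S_def
      proof (intro CollectI allI impI)
        fix d :: real assume "d > 0"
        then obtain s t where st: "s < x" "x < t" "t - s < d" using dpos by blast
        have "F t - F s \<le> K * (t - s)" using st lip by simp
        also have "\<dots> < p * (t - s)" using st \<open>\<not> p \<le> K\<close> by (intro mult_strict_right_mono) auto
        finally show "\<exists>s t. s < x \<and> x < t \<and> t - s < d \<and> F t - F s < p * (t - s)" using st by blast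
      qed
      then show False using that by (simp add: A_def)
    qed
    have A0: "0 \<in> A"
    proof -
      have "x \<notin> S 0"
      proof
        assume "x \<in> S 0"
        then have "\<forall>d>0. \<exists>s t. s < x \<and> x < t \<and> t - s < d \<and> F t - F s < 0" by (simp add: S_def)
        then have "\<exists>s t. s < x \<and> x < t \<and> t - s < 1 \<and> F t - F s < 0" by (rule allE[of _ 1]) simp
        then obtain s t where "s < x" "x < t" "F t - F s < 0" by auto
        then show False using mono[of s t] by simp
      qed
      then show ?thesis by (simp add: A_def)
    qed
    have bdd: "bdd_above A" using A_le by (auto simp: bdd_above_def)
    define L where "L = Sup A"
    have L0: "L \<ge> 0" unfolding L_def by (rule cSup_upper[OF A0 bdd])
    have slope: "\<exists>d>0. \<forall>s t. s < x \<and> x < t \<and> t - s < d \<longrightarrow> \<bar>F t - F s - L * (t - s)\<bar> \<le> e * (t - s)"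
      if e: "e > 0" for e
    proof -
      obtain p where p: "p \<in> A" "p > L - e"
        using less_cSup_iff[of A "L - e"] A0 bdd e unfolding L_def by auto
      obtain d1 where d1: "d1 > 0" "\<And>s t. s < x \<Longrightarrow> x < t \<Longrightarrow> t - s < d1 \<Longrightarrow> \<not> F t - F s < p * (t - s)"
        using p by (auto simp: A_def S_def)
      obtain p' where p': "p' \<in> \<rat>" "L < p'" "p' < L + e/2" using Rats_dense_in_real[of L "L + e/2"] e by auto
      obtain q where q: "q \<in> \<rat>" "p' < q" "q < L + e" using Rats_dense_in_real[of p' "L + e"] p' e by auto
      have "x \<in> S p'" using p' cSup_upper[OF _ bdd, of p'] by (auto simp: A_def L_def)
      then have "x \<notin> T q" using elim p' q L0 by auto
      then obtain d2 where d2: "d2 > 0" "\<And>s t. s < x \<Longrightarrow> x < t \<Longrightarrow> t - s < d2 \<Longrightarrow> \<not> F t - F s > q * (t - s)"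
        by (auto simp: T_def)
      have "\<bar>F t - F s - L * (t - s)\<bar> \<le> e * (t - s)" if "s < x" "x < t" "t - s < min d1 d2" for s t
      proof -
        have "p * (t - s) \<le> F t - F s" "F t - F s \<le> q * (t - s)"
          using d1(2)[of s t] d2(2)[of s t] that by auto
        moreover have "(L - e) * (t - s) \<le> p * (t - s)" "q * (t - s) \<le> (L + e) * (t - s)"
          using p q that by (auto intro!: mult_right_mono)
        ultimately show ?thesis by (simp add: algebra_simps abs_le_iff)
      qed
      then show ?thesis using d1 d2 by (intro exI[of _ "min d1 d2"]) auto
    qed
    have "(F has_real_derivative L) (at x)"
      unfolding has_field_derivative_def
    proof (rule has_derivativeI_sandwich[of 1])
      show "bounded_linear ((*) L)" by (rule bounded_linear_mult_right)
    next
      show "norm (F y - F x - L * (y - x)) / norm (y - x) \<le> \<bar>F y - F x - L * (y - x)\<bar> / \<bar>y - x\<bar>" for y by simp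
      show "((\<lambda>y. \<bar>F y - F x - L * (y - x)\<bar> / \<bar>y - x\<bar>) \<longlongrightarrow> 0) (at x)"
      proof (rule tendstoI)
        fix e' :: real assume "e' > 0"
        define e where "e = e' / 2"
        have e: "e > 0" "e < e'" using \<open>e' > 0\<close> by (auto simp: e_def)
        obtain d where d: "d > 0" "\<And>s t. s < x \<Longrightarrow> x < t \<Longrightarrow> t - s < d \<Longrightarrow> \<bar>F t - F s - L * (t - s)\<bar> \<le> e * (t - s)"
          using slope[OF e(1)] by blast
        \<comment> \<open>The slope estimate concerns intervals with \<open>x\<close> strictly
          inside. Letting one endpoint tend to \<open>x\<close> turns it into an estimate for
          difference quotients at \<open>x\<close>, by continuity of \<open>F\<close>.\<close>
        have right: "\<bar>F t - F x - L * (t - x)\<bar> \<le> e * (t - x)" if t: "x < t" "t - x < d" for t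
        proof (rule tendsto_le[OF trivial_limit_at_left_real])
          show "((\<lambda>s. \<bar>F t - F s - L * (t - s)\<bar>) \<longlongrightarrow> \<bar>F t - F x - L * (t - x)\<bar>) (at_left x)"
            by (intro tendsto_intros contF)
          show "((\<lambda>s. e * (t - s)) \<longlongrightarrow> e * (t - x)) (at_left x)" by (intro tendsto_intros)
          have "eventually (\<lambda>s. s \<in> {t - d<..<x}) (at_left x)"
            using t by (intro eventually_at_leftI[of "t - d"]) auto
          then show "\<forall>\<^sub>F s in at_left x. \<bar>F t - F s - L * (t - s)\<bar> \<le> e * (t - s)"
            by eventually_elim (use t d in auto)
        qed
        have left: "\<bar>F x - F s - L * (x - s)\<bar> \<le> e * (x - s)" if s: "s < x" "x - s < d" for s
        proof (rule tendsto_le[OF trivial_limit_at_right_real])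
          show "((\<lambda>t. \<bar>F t - F s - L * (t - s)\<bar>) \<longlongrightarrow> \<bar>F x - F s - L * (x - s)\<bar>) (at_right x)"
            by (intro tendsto_intros contF)
          show "((\<lambda>t. e * (t - s)) \<longlongrightarrow> e * (x - s)) (at_right x)" by (intro tendsto_intros)
          have "eventually (\<lambda>t. t \<in> {x<..<s + d}) (at_right x)"
            using s by (intro eventually_at_rightI[of _ "s + d"]) auto
          then show "\<forall>\<^sub>F t in at_right x. \<bar>F t - F s - L * (t - s)\<bar> \<le> e * (t - s)"
            by eventually_elim (use s d in auto)
        qed
        have "\<bar>F y - F x - L * (y - x)\<bar> / \<bar>y - x\<bar> < e'" if y: "y \<noteq> x" "dist y x < d" for y
        proof (cases "x < y")
          case True
          then have "\<bar>F y - F x - L * (y - x)\<bar> \<le> e * \<bar>y - x\<bar>" using right[of y] y by (auto simp: dist_real_def)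
          also have "\<dots> < e' * \<bar>y - x\<bar>" using e y by simp
          finally show ?thesis using y by (simp add: divide_simps)
        next
          case False
          then have "\<bar>F y - F x - L * (y - x)\<bar> \<le> e * \<bar>y - x\<bar>" using left[of y] y
            by (auto simp: dist_real_def abs_if algebra_simps split: if_splits)
          also have "\<dots> < e' * \<bar>y - x\<bar>" using e y by simp
          finally show ?thesis using y by (simp add: divide_simps)
        qed
        then show "\<forall>\<^sub>F y in at x. dist (\<bar>F y - F x - L * (y - x)\<bar> / \<bar>y - x\<bar>) 0 < e'"
          unfolding eventually_at using d(1) by (intro exI[of _ d]) (auto simp: dist_real_def)
      qed
    qed auto
    then show ?case by blast
  qed
qed

text \<open>Adding \<open>K x\<close> makes a real function with Lipschitz constant \<open>K\<close>
  nondecreasing, and its slopes stay below \<open>2 K\<close>; real and imaginary part are treated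
  separately.\<close>

lemma Lipschitz_complex_differentiable_AE:
  fixes F :: "real \<Rightarrow> complex"
  assumes lip: "K-lipschitz_on UNIV F"
  shows "AE x in lborel. \<exists>D. (F has_vector_derivative D) (at x)"
proof -
  have *: "AE x in lborel. \<exists>D. (h has_real_derivative D) (at x)"
    if h: "\<And>x y. \<bar>h x - h y\<bar> \<le> K * \<bar>x - y\<bar>" for h :: "real \<Rightarrow> real"
  proof -
    have "AE x in lborel. \<exists>D. ((\<lambda>x. h x + K * x) has_real_derivative D) (at x)"
    proof (rule Lipschitz_mono_differentiable_AE[where K = "2 * K"])
      fix x y :: real assume "x \<le> y"
      then show "h x + K * x \<le> h y + K * y" "h y + K * y - (h x + K * x) \<le> 2 * K * (y - x)"
        using h[of x y] by (auto simp: abs_le_iff algebra_simps)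
    qed
    then show ?thesis
    proof eventually_elim
      case (elim x)
      then obtain D where "((\<lambda>x. h x + K * x) has_real_derivative D) (at x)" by blast
      then have "((\<lambda>x. (h x + K * x) - K * x) has_real_derivative D - K) (at x)"
        by (intro DERIV_diff DERIV_cmult_Id)
      then show ?case by auto
    qed
  qed
  have d: "norm (F x - F y) \<le> K * \<bar>x - y\<bar>" for x y
    using lip by (auto simp: lipschitz_on_def dist_norm)
  have "AE x in lborel. \<exists>D. ((\<lambda>x. Re (F x)) has_real_derivative D) (at x)"
    using d abs_Re_le_cmod by (intro *) (metis minus_complex.sel(1) order_trans)
  moreover have "AE x in lborel. \<exists>D. ((\<lambda>x. Im (F x)) has_real_derivative D) (at x)"
    using d abs_Im_le_cmod by (intro *) (metis minus_complex.sel(2) order_trans)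
  ultimately show ?thesis
  proof eventually_elim
    case (elim x)
    then obtain D D' where D: "((\<lambda>x. Re (F x)) has_real_derivative D) (at x)"
       "((\<lambda>x. Im (F x)) has_real_derivative D') (at x)"
      by auto
    have "((\<lambda>x. of_real (Re (F x)) + \<i> * of_real (Im (F x))) has_vector_derivative (of_real D + \<i> * of_real D')) (at x)"
      by (intro has_vector_derivative_add has_vector_derivative_mult_right has_vector_derivative_of_real D)
    then show ?case by (auto simp: complex_eq[symmetric])
  qed
qed

section \<open>Circle measure and radial limits\<close>

lemma sets_circle_measure [measurable_cong]: "sets circle_measure = sets (restrict_space borel unit_circle)"
  by (simp add: circle_measure_def)

lemma space_circle_measure [simp]: "space circle_measure = unit_circle"
  by (simp add: circle_measure_def space_restrict_space)

interpretation circle: prob_space circle_measure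
  by (rule prob_space_circle_measure)

lemma borel_measurable_circle_continuous:
  "continuous_on unit_circle f \<Longrightarrow> f \<in> borel_measurable circle_measure"
  for f :: "complex \<Rightarrow> 'b::topological_space"
  using borel_measurable_continuous_on_restrict[of unit_circle f]
  by (simp cong: measurable_cong_sets add: sets_circle_measure)

lemma circle_integrable_bounded:
  fixes f :: "complex \<Rightarrow> 'b::{banach, second_countable_topology}"
  assumes "f \<in> borel_measurable circle_measure" "\<And>\<xi>. cmod \<xi> = 1 \<Longrightarrow> norm (f \<xi>) \<le> K"
  shows "integrable circle_measure f"
  by (rule circle.integrable_const_bound[of _ K]) (use assms in auto)

lemma circle_integrable_continuous:
  fixes f :: "complex \<Rightarrow> 'b::{banach, second_countable_topology}"
  assumes "continuous_on unit_circle f"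
  shows "integrable circle_measure f"
proof -
  have "bounded (f ` unit_circle)"
    using assms by (intro compact_imp_bounded compact_continuous_image) auto
  then obtain K where "\<forall>x\<in>unit_circle. norm (f x) \<le> K"
    unfolding bounded_iff by blast
  then show ?thesis
    by (intro circle_integrable_bounded[of _ K] borel_measurable_circle_continuous assms) auto
qed

lemma cis_measurable_circle:
  "cis \<in> uniform_measure lborel {0..2 * pi} \<rightarrow>\<^sub>M restrict_space borel unit_circle"
proof (rule measurable_restrict_space2)
  have "cis \<in> borel_measurable borel"
    by (intro borel_measurable_continuous_onI continuous_intros)
  then show "cis \<in> borel_measurable (uniform_measure lborel {0..2 * pi})"
    by (simp cong: measurable_cong_sets)
qed auto

lemma AE_circle_measureI:
  assumes P: "{\<xi> \<in> unit_circle. P \<xi>} \<in> sets circle_measure" and ae: "AE t in lborel. P (cis t)"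
  shows "AE \<xi> in circle_measure. P \<xi>"
proof -
  have "{\<xi> \<in> space (restrict_space borel unit_circle). P \<xi>} \<in> sets (restrict_space borel unit_circle)"
    using P by (simp add: sets_circle_measure space_restrict_space)
  then show ?thesis
    unfolding circle_measure_def
    by (subst AE_distr_iff[OF cis_measurable_circle])
       (auto intro!: AE_uniform_measureI eventually_mono[OF ae])
qed

lemma circle_integral_eq_contour_integral:
  fixes f :: "complex \<Rightarrow> complex"
  assumes f: "continuous_on unit_circle f"
  shows "(LINT \<xi>|circle_measure. f \<xi>) = contour_integral (circlepath 0 1) (\<lambda>\<xi>. f \<xi> / \<xi>) / (2 * of_real pi * \<i>)"
proof -
  have fm: "f \<in> borel_measurable (restrict_space borel unit_circle)"
    by (rule borel_measurable_continuous_on_restrict[OF f])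
  have fc: "continuous_on S (\<lambda>t. f (cis t))" for S
    by (rule continuous_on_compose2[OF f]) (auto intro!: continuous_intros)
  have m: "(\<lambda>t. f (cis t)) \<in> borel_measurable borel"
    using fc by (rule borel_measurable_continuous_onI)
  have "(LINT \<xi>|circle_measure. f \<xi>) = (LINT t|uniform_measure lborel {0..2 * pi}. f (cis t))"
    unfolding circle_measure_def by (rule integral_distr[OF cis_measurable_circle fm])
  also have "\<dots> = (LINT t|density lborel (\<lambda>t. ennreal (indicator {0..2*pi} t / (2 * pi))). f (cis t))"
  proof -
    have "uniform_measure lborel {0..2 * pi} = density lborel (\<lambda>t. ennreal (indicator {0..2*pi} t / (2 * pi)))"
      unfolding uniform_measure_def
      by (intro density_cong) (auto simp: indicator_def divide_ennreal ennreal_1[symmetric] simp del: ennreal_1)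
    then show ?thesis by simp
  qed
  also have "\<dots> = (LINT t|lborel. (indicator {0..2*pi} t / (2 * pi)) *\<^sub>R f (cis t))"
    using m by (subst integral_density) auto
  also have "\<dots> = (LINT t|lborel. (indicator {0..2*pi} t *\<^sub>R f (cis t)) / (2 * of_real pi))"
    by (intro Bochner_Integration.integral_cong) (auto simp: scaleR_conv_of_real)
  also have "\<dots> = (LINT t:{0..2*pi}|lborel. f (cis t)) / (2 * of_real pi)"
    unfolding set_lebesgue_integral_def by simp
  also have "(LINT t:{0..2*pi}|lborel. f (cis t)) = integral {0..2*pi} (\<lambda>t. f (cis t))"
    by (intro set_borel_integral_eq_integral borel_integrable_atLeastAtMost' fc)
  also have "integral {0..2*pi} (\<lambda>t. f (cis t)) = contour_integral (circlepath 0 1) (\<lambda>\<xi>. f \<xi> / \<xi>) / \<i>"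
    unfolding circlepath_def
    by (subst contour_integral_part_circlepath_eq) (simp_all add: field_simps)
  finally show ?thesis by (simp add: field_simps)
qed

text \<open>The factor \<open>\<xi>\<close> in the numerator accounts for
  \<open>d\<xi> / (2 pi i)\<close> being \<open>\<xi>\<close> times normalized arc length.\<close>

lemma circle_integral_Cauchy:
  assumes F: "continuous_on (cball 0 1) F" "F holomorphic_on unit_disc" and z: "cmod z < 1"
  shows "(LINT \<xi>|circle_measure. F \<xi> * \<xi> / (\<xi> - z)) = F z"
proof -
  have c: "continuous_on unit_circle F" using F(1) by (rule continuous_on_subset) auto
  have "continuous_on unit_circle (\<lambda>\<xi>. F \<xi> * \<xi> / (\<xi> - z))"
    using z by (intro continuous_intros c) auto
  then have "(LINT \<xi>|circle_measure. F \<xi> * \<xi> / (\<xi> - z)) =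
      contour_integral (circlepath 0 1) (\<lambda>\<xi>. (F \<xi> * \<xi> / (\<xi> - z)) / \<xi>) / (2 * of_real pi * \<i>)"
    by (rule circle_integral_eq_contour_integral)
  also have "contour_integral (circlepath 0 1) (\<lambda>\<xi>. (F \<xi> * \<xi> / (\<xi> - z)) / \<xi>) =
      contour_integral (circlepath 0 1) (\<lambda>\<xi>. F \<xi> / (\<xi> - z))"
    by (rule contour_integral_cong) (auto simp: dist_norm)
  also have "\<dots> = 2 * of_real pi * \<i> * F z"
    by (rule contour_integral_unique[OF Cauchy_integral_circlepath]) (use F z in auto)
  finally show ?thesis by simp
qed

lemma circle_integral_Cauchy_deriv:
  assumes F: "continuous_on (cball 0 1) F" "F holomorphic_on unit_disc" and z: "cmod z < 1"
  shows "(LINT \<xi>|circle_measure. F \<xi> * \<xi> / (\<xi> - z)\<^sup>2) = deriv F z"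
proof -
  have c: "continuous_on unit_circle F" using F(1) by (rule continuous_on_subset) auto
  have "continuous_on unit_circle (\<lambda>\<xi>. F \<xi> * \<xi> / (\<xi> - z)\<^sup>2)"
    using z by (intro continuous_intros c) auto
  then have "(LINT \<xi>|circle_measure. F \<xi> * \<xi> / (\<xi> - z)\<^sup>2) =
      contour_integral (circlepath 0 1) (\<lambda>\<xi>. (F \<xi> * \<xi> / (\<xi> - z)\<^sup>2) / \<xi>) / (2 * of_real pi * \<i>)"
    by (rule circle_integral_eq_contour_integral)
  also have "contour_integral (circlepath 0 1) (\<lambda>\<xi>. (F \<xi> * \<xi> / (\<xi> - z)\<^sup>2) / \<xi>) =
      contour_integral (circlepath 0 1) (\<lambda>\<xi>. F \<xi> / (\<xi> - z)\<^sup>2)"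
    by (rule contour_integral_cong) (auto simp: dist_norm)
  also have "\<dots> / (2 * of_real pi * \<i>) = deriv F z"
    using DERIV_imp_deriv[OF Cauchy_derivative_integral_circlepath(2)[OF F(1) F(2), of z]] z by simp
  finally show ?thesis .
qed

lemma circle_integral_mean:
  assumes F: "continuous_on (cball 0 1) F" "F holomorphic_on unit_disc"
  shows "(LINT \<xi>|circle_measure. F \<xi>) = F 0"
proof -
  have "(LINT \<xi>|circle_measure. F \<xi>) = (LINT \<xi>|circle_measure. F \<xi> * \<xi> / (\<xi> - 0))"
    by (intro Bochner_Integration.integral_cong) auto
  then show ?thesis using circle_integral_Cauchy[OF F, of 0] by simp
qed

section \<open>Poisson kernel and Poisson formula\<close>

definition Poisson_kernel :: "complex \<Rightarrow> complex \<Rightarrow> real" where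
  "Poisson_kernel z \<xi> = (1 - (cmod z)\<^sup>2) / (cmod (\<xi> - z))\<^sup>2"

lemma continuous_on_Poisson_kernel:
  assumes "cmod z < 1"
  shows "continuous_on unit_circle (Poisson_kernel z)"
  unfolding Poisson_kernel_def using assms by (intro continuous_intros) auto

lemma measurable_Poisson_kernel:
  "cmod z < 1 \<Longrightarrow> Poisson_kernel z \<in> borel_measurable circle_measure"
  by (intro borel_measurable_circle_continuous continuous_on_Poisson_kernel)

lemma Poisson_kernel_nonneg: "cmod z < 1 \<Longrightarrow> 0 \<le> Poisson_kernel z \<xi>"
  by (simp add: Poisson_kernel_def abs_square_le_1 less_imp_le)

lemma Poisson_kernel_bounds:
  assumes "cmod z < 1" "cmod \<xi> = 1"
  shows "Poisson_kernel z \<xi> \<le> (1 + cmod z) / (1 - cmod z)"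
    and "(1 - cmod z) / (1 + cmod z) \<le> Poisson_kernel z \<xi>"
proof -
  have l: "1 - cmod z \<le> cmod (\<xi> - z)" "cmod (\<xi> - z) \<le> 1 + cmod z"
    using norm_triangle_ineq2[of \<xi> z] norm_triangle_ineq4[of \<xi> z] assms by auto
  have sq: "(1 - cmod z)\<^sup>2 \<le> (cmod (\<xi> - z))\<^sup>2" "(cmod (\<xi> - z))\<^sup>2 \<le> (1 + cmod z)\<^sup>2"
    using l assms by (auto intro!: power_mono)
  have p: "0 < (1 - cmod z)\<^sup>2" "0 < 1 + cmod z" "0 < 1 - cmod z"
    using assms by (auto simp: add_pos_nonneg)
  have p2: "0 < (cmod (\<xi> - z))\<^sup>2" using p(1) sq(1) by linarith
  have e: "1 - (cmod z)\<^sup>2 = (1 + cmod z) * (1 - cmod z)" by (simp add: power2_eq_square algebra_simps)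
  have "Poisson_kernel z \<xi> \<le> ((1 + cmod z) * (1 - cmod z)) / (1 - cmod z)\<^sup>2"
    unfolding Poisson_kernel_def e using sq p p2 by (intro divide_left_mono) auto
  also have "\<dots> = (1 + cmod z) / (1 - cmod z)" using p by (simp add: power2_eq_square)
  finally show "Poisson_kernel z \<xi> \<le> (1 + cmod z) / (1 - cmod z)" .
  have "(1 - cmod z) / (1 + cmod z) = ((1 + cmod z) * (1 - cmod z)) / (1 + cmod z)\<^sup>2"
    using p by (simp add: power2_eq_square)
  also have "\<dots> \<le> Poisson_kernel z \<xi>"
    unfolding Poisson_kernel_def e using sq p p2 by (intro divide_left_mono) auto
  finally show "(1 - cmod z) / (1 + cmod z) \<le> Poisson_kernel z \<xi>" .
qed

text \<open>The Cauchy kernel plus a term that is holomorphic in \<open>\<xi>\<close> on the disc,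
  continuous up to the circle and zero at the origin. By the mean value property the second term
  integrates to zero against holomorphic functions, so the Poisson formula reduces to
  Cauchy's.\<close>

lemma Poisson_kernel_conv:
  assumes "cmod z < 1" "cmod \<xi> = 1"
  shows "of_real (Poisson_kernel z \<xi>) = \<xi> / (\<xi> - z) + cnj z * \<xi> / (1 - cnj z * \<xi>)"
proof -
  have x: "\<xi> * cnj \<xi> = 1" using assms(2) by (simp add: complex_norm_square[symmetric])
  have n: "\<xi> \<noteq> 0" "\<xi> - z \<noteq> 0" using assms by auto
  have i: "1 - cnj z * \<xi> = \<xi> * cnj (\<xi> - z)" using x by (simp add: algebra_simps)
  have n2: "1 - cnj z * \<xi> \<noteq> 0" unfolding i using n by simp
  have "of_real (Poisson_kernel z \<xi>) = (1 - z * cnj z) / ((\<xi> - z) * cnj (\<xi> - z))"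
    by (simp only: Poisson_kernel_def complex_norm_square of_real_divide of_real_diff of_real_1)
  also have "\<dots> = (1 - z * cnj z) * \<xi> / ((\<xi> - z) * (1 - cnj z * \<xi>))"
  proof -
    have "(1 - z * cnj z) * \<xi> / ((\<xi> - z) * (1 - cnj z * \<xi>)) = (\<xi> * (1 - z * cnj z)) / (\<xi> * ((\<xi> - z) * cnj (\<xi> - z)))"
      unfolding i by (simp only: mult_ac)
    then show ?thesis using n by (simp del: complex_cnj_diff)
  qed
  also have "\<dots> = \<xi> / (\<xi> - z) + cnj z * \<xi> / (1 - cnj z * \<xi>)"
  proof -
    have "\<xi> / (\<xi> - z) + cnj z * \<xi> / (1 - cnj z * \<xi>)
        = (\<xi> * (1 - cnj z * \<xi>) + cnj z * \<xi> * (\<xi> - z)) / ((\<xi> - z) * (1 - cnj z * \<xi>))"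
      using n n2 by (simp add: add_frac_eq)
    also have "\<xi> * (1 - cnj z * \<xi>) + cnj z * \<xi> * (\<xi> - z) = (1 - z * cnj z) * \<xi>"
      by (simp add: algebra_simps)
    finally show ?thesis by simp
  qed
  finally show ?thesis .
qed

lemma Poisson_formula:
  assumes F: "continuous_on (cball 0 1) F" "F holomorphic_on unit_disc" and z: "cmod z < 1"
  shows "(LINT \<xi>|circle_measure. Poisson_kernel z \<xi> *\<^sub>R F \<xi>) = F z"
proof -
  have c: "continuous_on unit_circle F" using F(1) by (rule continuous_on_subset) auto
  have nz: "1 - cnj z * \<xi> \<noteq> 0" if "cmod \<xi> \<le> 1" for \<xi>
  proof -
    have "cmod (cnj z * \<xi>) \<le> cmod z * 1"
      unfolding norm_mult complex_mod_cnj using that by (intro mult_left_mono) auto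
    then have "cmod (cnj z * \<xi>) < 1" using z by simp
    then show ?thesis by auto
  qed
  have "(LINT \<xi>|circle_measure. Poisson_kernel z \<xi> *\<^sub>R F \<xi>) =
      (LINT \<xi>|circle_measure. F \<xi> * \<xi> / (\<xi> - z) + F \<xi> * (cnj z * \<xi> / (1 - cnj z * \<xi>)))"
    by (intro Bochner_Integration.integral_cong)
       (auto simp: scaleR_conv_of_real Poisson_kernel_conv z algebra_simps)
  also have "\<dots> = (LINT \<xi>|circle_measure. F \<xi> * \<xi> / (\<xi> - z)) +
      (LINT \<xi>|circle_measure. F \<xi> * (cnj z * \<xi> / (1 - cnj z * \<xi>)))"
    using z nz by (intro Bochner_Integration.integral_add circle_integrable_continuous continuous_intros c) auto
  also have "(LINT \<xi>|circle_measure. F \<xi> * (cnj z * \<xi> / (1 - cnj z * \<xi>))) = F 0 * (cnj z * 0 / (1 - cnj z * 0))"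
    using nz by (intro circle_integral_mean continuous_intros holomorphic_intros F) auto
  finally show ?thesis using circle_integral_Cauchy[OF F z] by simp
qed

lemma Poisson_kernel_integral:
  assumes "cmod z < 1"
  shows "(LINT \<xi>|circle_measure. Poisson_kernel z \<xi>) = 1"
proof -
  have "complex_of_real (LINT \<xi>|circle_measure. Poisson_kernel z \<xi>) = (LINT \<xi>|circle_measure. Poisson_kernel z \<xi> *\<^sub>R 1)"
    unfolding integral_complex_of_real[symmetric] by (simp add: scaleR_conv_of_real)
  also have "\<dots> = 1" using assms by (intro Poisson_formula) auto
  finally show ?thesis by (metis of_real_eq_1_iff)
qed

section \<open>Fatou's theorem on radial limits\<close>

lemma Fatou_kernel_norm:
  assumes \<zeta>: "cmod \<zeta> = 1" and \<xi>: "cmod \<xi> = 1" and r: "0 \<le> r" "r < 1"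
  defines "z \<equiv> of_real r * \<zeta>"
  shows "cmod (\<xi> / (\<xi> - z)\<^sup>2 - (cnj \<zeta>)\<^sup>2 * (\<xi> / (1 - cnj z * \<xi>)\<^sup>2)) =
    (1 - r\<^sup>2) * cmod (\<xi> - \<zeta>) * cmod (\<xi> + \<zeta>) / cmod (\<xi> - z) ^ 4"
proof -
  have x: "\<xi> * cnj \<xi> = 1" "\<zeta> * cnj \<zeta> = 1" using \<xi> \<zeta> by (simp_all add: complex_norm_square[symmetric])
  have zn: "cmod z < 1" using \<zeta> r by (simp add: z_def norm_mult)
  have i: "1 - cnj z * \<xi> = \<xi> * cnj (\<xi> - z)" using x by (simp add: algebra_simps)
  then have ni: "cmod (1 - cnj z * \<xi>) = cmod (\<xi> - z)"
    using \<xi> by (simp only: norm_mult complex_mod_cnj mult_1_left)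
  have n: "\<xi> - z \<noteq> 0" using zn \<xi> by auto
  have n2: "1 - cnj z * \<xi> \<noteq> 0" using ni n by (metis norm_eq_zero)
  have e: "\<xi> / (\<xi> - z)\<^sup>2 - (cnj \<zeta>)\<^sup>2 * (\<xi> / (1 - cnj z * \<xi>)\<^sup>2) =
     \<xi> * ((1 - cnj z * \<xi>)\<^sup>2 - (cnj \<zeta> * (\<xi> - z))\<^sup>2) / ((\<xi> - z)\<^sup>2 * (1 - cnj z * \<xi>)\<^sup>2)"
    unfolding power_mult_distrib[of "cnj \<zeta>"] using n n2 by (simp add: field_simps)
  \<comment> \<open>A difference of squares. Its factors carry \<open>1 + r\<close> and
    \<open>1 - r\<close>, whose product is the numerator of the Poisson kernel, and the two chords
    from \<open>\<xi>\<close> to \<open>\<zeta>\<close> and to \<open>-\<zeta>\<close>; the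
    denominators of the two kernels have the same modulus on the circle.\<close>
  have "(1 - cnj z * \<xi>)\<^sup>2 - (cnj \<zeta> * (\<xi> - z))\<^sup>2 =
      (1 - cnj z * \<xi> - cnj \<zeta> * (\<xi> - z)) * (1 - cnj z * \<xi> + cnj \<zeta> * (\<xi> - z))"
    by (simp add: power2_eq_square algebra_simps)
  also have "1 - cnj z * \<xi> - cnj \<zeta> * (\<xi> - z) = (1 + of_real r) * (1 - cnj \<zeta> * \<xi>)"
  proof -
    have "cnj \<zeta> * z = of_real r" using x by (simp add: z_def mult.left_commute[of "cnj \<zeta>"] mult.commute[of "cnj \<zeta>"])
    then show ?thesis by (simp add: z_def algebra_simps)
  qed
  also have "1 - cnj z * \<xi> + cnj \<zeta> * (\<xi> - z) = (1 - of_real r) * (1 + cnj \<zeta> * \<xi>)"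
  proof -
    have "cnj \<zeta> * z = of_real r" using x by (simp add: z_def mult.left_commute[of "cnj \<zeta>"] mult.commute[of "cnj \<zeta>"])
    then show ?thesis by (simp add: z_def algebra_simps)
  qed
  also have "1 - cnj \<zeta> * \<xi> = - cnj \<zeta> * (\<xi> - \<zeta>)" using x by (simp add: algebra_simps)
  also have "1 + cnj \<zeta> * \<xi> = cnj \<zeta> * (\<xi> + \<zeta>)" using x by (simp add: algebra_simps)
  finally have f: "(1 - cnj z * \<xi>)\<^sup>2 - (cnj \<zeta> * (\<xi> - z))\<^sup>2 =
      (1 + of_real r) * (- cnj \<zeta> * (\<xi> - \<zeta>)) * ((1 - of_real r) * (cnj \<zeta> * (\<xi> + \<zeta>)))" .
  have rr: "cmod (1 + of_real r) = 1 + r" "cmod (1 - of_real r) = 1 - r"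
    using r by (metis abs_of_nonneg add_nonneg_nonneg norm_of_real of_real_1 of_real_add zero_le_one)
       (metis r(2) abs_of_nonneg diff_ge_0_iff_ge less_imp_le norm_of_real of_real_1 of_real_diff)
  show ?thesis
  proof -
    have "cmod (\<xi> * ((1 + of_real r) * (- cnj \<zeta> * (\<xi> - \<zeta>)) * ((1 - of_real r) * (cnj \<zeta> * (\<xi> + \<zeta>))))
        / ((\<xi> - z)\<^sup>2 * (1 - cnj z * \<xi>)\<^sup>2)) =
      ((1 + r) * cmod (\<xi> - \<zeta>) * ((1 - r) * cmod (\<xi> + \<zeta>))) / ((cmod (\<xi> - z))\<^sup>2 * (cmod (\<xi> - z))\<^sup>2)"
      by (simp only: norm_mult norm_divide norm_power norm_minus_cancel complex_mod_cnj \<xi> \<zeta> ni rr mult_1_left)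
    also have "\<dots> = (1 - r\<^sup>2) * cmod (\<xi> - \<zeta>) * cmod (\<xi> + \<zeta>) / cmod (\<xi> - z) ^ 4"
      by (simp add: power_add[symmetric] power2_eq_square[of r] algebra_simps)
    finally show ?thesis unfolding e f .
  qed
qed

text \<open>
  The kernel \<open>\<xi> / (\<xi> - z)\<^sup>2\<close> of the Cauchy formula for the derivative is not integrable against
  \<open>\<epsilon> \<bar>\<xi> - \<zeta>\<bar>\<close> uniformly in \<open>z\<close>. Subtracting the kernel reflected in the circle, which annihilates
  holomorphic functions, improves it to a multiple of the Poisson kernel.
\<close>

lemma deriv_radial_limit:
  assumes F: "continuous_on (cball 0 1) F" "F holomorphic_on unit_disc" and \<zeta>: "cmod \<zeta> = 1"
    and D: "\<And>e. e > 0 \<Longrightarrow> \<exists>d>0. \<forall>\<xi>. cmod \<xi> = 1 \<and> cmod (\<xi> - \<zeta>) < d \<longrightarrow>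
        cmod (F \<xi> - F \<zeta> - L * (\<xi> - \<zeta>)) \<le> e * cmod (\<xi> - \<zeta>)"
  shows "((\<lambda>r. deriv F (of_real r * \<zeta>)) \<longlongrightarrow> L) (at_left 1)"
proof -
  \<comment> \<open>Removing the first-order part at \<open>\<zeta>\<close> leaves a function that
    is small compared with the chord near \<open>\<zeta>\<close> and whose derivative differs from
    that of \<open>F\<close> by exactly \<open>L\<close>.\<close>
  define R where "R = (\<lambda>\<xi>. F \<xi> - F \<zeta> - L * (\<xi> - \<zeta>))"
  have R: "continuous_on (cball 0 1) R" "R holomorphic_on unit_disc"
    unfolding R_def by (intro continuous_intros holomorphic_intros F)+
  have Rc: "continuous_on unit_circle R" using R(1) by (rule continuous_on_subset) auto
  have dR: "deriv R z = deriv F z - L" if "cmod z < 1" for z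
  proof -
    have "(F has_field_derivative deriv F z) (at z)"
      using that by (intro holomorphic_derivI[OF F(2)]) auto
    then show ?thesis unfolding R_def by (intro DERIV_imp_deriv) (auto intro!: derivative_eq_intros)
  qed
  have "bounded (R ` unit_circle)" using Rc by (intro compact_imp_bounded compact_continuous_image) auto
  then obtain C0 where C0: "\<forall>x\<in>unit_circle. cmod (R x) \<le> C0" unfolding bounded_iff by blast
  define C where "C = max C0 0"
  have C: "C \<ge> 0" "cmod (R x) \<le> C" if "cmod x = 1" for x using C0 that by (auto simp: C_def le_max_iff_disj)
  have C_nonneg: "C \<ge> 0" by (simp add: C_def)
  show ?thesis
  proof (rule tendstoI)
    fix e0 :: real assume e0: "e0 > 0"
    \<comment> \<open>The estimate near \<open>\<zeta>\<close> loses a factor 8: a factor 2 from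
      \<open>|\<xi> + \<zeta>|\<close> and a factor 4 from the square of
      \<open>|\<xi> - \<zeta>| \<le> 2 p\<close>. So half of \<open>e0\<close> is left for the rest
      of the circle.\<close>
    define e where "e = e0 / 16"
    have e: "e > 0" using e0 by (simp add: e_def)
    obtain d where d: "d > 0" "\<And>\<xi>. cmod \<xi> = 1 \<Longrightarrow> cmod (\<xi> - \<zeta>) < d \<Longrightarrow> cmod (R \<xi>) \<le> e * cmod (\<xi> - \<zeta>)"
      using D[OF e] by (auto simp: R_def)
    \<comment> \<open>Away from \<open>\<zeta>\<close> the distance \<open>p\<close> is at least
      \<open>d / 2\<close> and each of the chords \<open>|\<xi> - \<zeta>|\<close>,
      \<open>|\<xi> + \<zeta>|\<close> is at most 2. The remaining factor
      \<open>1 - r\<^sup>2\<close> makes this part vanish in the limit.\<close>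
    define B where "B = 4 * C / (d / 2) ^ 4"
    have B: "B \<ge> 0" using C_nonneg by (simp add: B_def)
    have key: "cmod (deriv F (of_real r * \<zeta>) - L) \<le> 8 * e + (1 - r\<^sup>2) * B" if r: "0 \<le> r" "r < 1" for r
    proof -
      define z where "z = of_real r * \<zeta>"
      have z: "cmod z = r" using \<zeta> r by (simp add: z_def norm_mult)
      then have z1: "cmod z < 1" using r by simp
      define k where "k = (\<lambda>\<xi>. \<xi> / (\<xi> - z)\<^sup>2 - (cnj \<zeta>)\<^sup>2 * (\<xi> / (1 - cnj z * \<xi>)\<^sup>2))"
      have nz: "1 - cnj z * \<xi> \<noteq> 0" if "cmod \<xi> \<le> 1" for \<xi>
      proof -
        have "cmod (cnj z * \<xi>) \<le> cmod z * 1"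
          unfolding norm_mult complex_mod_cnj using that by (intro mult_left_mono) auto
        then have "cmod (cnj z * \<xi>) < 1" using z1 by simp
        then show ?thesis by auto
      qed
      have "deriv F z - L = (LINT \<xi>|circle_measure. R \<xi> * \<xi> / (\<xi> - z)\<^sup>2)"
        using circle_integral_Cauchy_deriv[OF R z1] dR[OF z1] by simp
      also have "\<dots> = (LINT \<xi>|circle_measure. R \<xi> * \<xi> / (\<xi> - z)\<^sup>2) -
          (LINT \<xi>|circle_measure. R \<xi> * ((cnj \<zeta>)\<^sup>2 * (\<xi> / (1 - cnj z * \<xi>)\<^sup>2)))"
      proof -
        have "(LINT \<xi>|circle_measure. R \<xi> * ((cnj \<zeta>)\<^sup>2 * (\<xi> / (1 - cnj z * \<xi>)\<^sup>2))) =
            R 0 * ((cnj \<zeta>)\<^sup>2 * (0 / (1 - cnj z * 0)\<^sup>2))"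
          using nz by (intro circle_integral_mean continuous_intros holomorphic_intros R) auto
        then show ?thesis by simp
      qed
      also have "\<dots> = (LINT \<xi>|circle_measure. R \<xi> * \<xi> / (\<xi> - z)\<^sup>2 - R \<xi> * ((cnj \<zeta>)\<^sup>2 * (\<xi> / (1 - cnj z * \<xi>)\<^sup>2)))"
        using z1 nz by (intro Bochner_Integration.integral_diff[symmetric] circle_integrable_continuous continuous_intros Rc) auto
      also have "\<dots> = (LINT \<xi>|circle_measure. R \<xi> * k \<xi>)"
        by (intro Bochner_Integration.integral_cong) (auto simp: k_def algebra_simps)
      finally have "cmod (deriv F z - L) = cmod (LINT \<xi>|circle_measure. R \<xi> * k \<xi>)" by simp
      also have "\<dots> \<le> (LINT \<xi>|circle_measure. cmod (R \<xi> * k \<xi>))" by (rule integral_norm_bound)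
      also have "\<dots> \<le> (LINT \<xi>|circle_measure. 8 * e * Poisson_kernel z \<xi> + (1 - r\<^sup>2) * B)"
      proof (rule integral_mono)
        show "integrable circle_measure (\<lambda>\<xi>. cmod (R \<xi> * k \<xi>))"
          unfolding k_def using z1 nz by (intro circle_integrable_continuous continuous_intros Rc) auto
        show "integrable circle_measure (\<lambda>\<xi>. 8 * e * Poisson_kernel z \<xi> + (1 - r\<^sup>2) * B)"
          using z1 by (intro circle_integrable_continuous continuous_intros continuous_on_Poisson_kernel)
      next
        fix \<xi> assume "\<xi> \<in> space circle_measure"
        then have \<xi>: "cmod \<xi> = 1" by simp
        define p where "p = cmod (\<xi> - z)"
        have r2: "0 \<le> 1 - r\<^sup>2" using r by (simp add: abs_square_le_1)
        have p0: "p > 0" unfolding p_def using \<xi> z1 by auto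
        have q0: "cmod (\<xi> - \<zeta>) \<le> 2 * p"
        proof -
          have "cmod (\<xi> - \<zeta>) \<le> cmod (\<xi> - z) + cmod (z - \<zeta>)" by (metis diff_add_cancel add_diff_eq norm_triangle_ineq)
          also have "cmod (z - \<zeta>) = cmod (of_real (r - 1) * \<zeta>)" by (simp add: z_def algebra_simps)
          also have "\<dots> = 1 - r" using r \<zeta> by (simp add: norm_mult del: of_real_diff)
          also have "1 - r \<le> p" unfolding p_def using norm_triangle_ineq2[of \<xi> z] \<xi> z by simp
          finally show ?thesis by (simp add: p_def)
        qed
        have s0: "cmod (\<xi> + \<zeta>) \<le> 2" using norm_triangle_ineq[of \<xi> \<zeta>] \<xi> \<zeta> by simp
        have kn: "cmod (k \<xi>) = (1 - r\<^sup>2) * cmod (\<xi> - \<zeta>) * cmod (\<xi> + \<zeta>) / p ^ 4"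
          unfolding k_def p_def z_def by (rule Fatou_kernel_norm[OF \<zeta> \<xi> r])
        show "cmod (R \<xi> * k \<xi>) \<le> 8 * e * Poisson_kernel z \<xi> + (1 - r\<^sup>2) * B"
        proof (cases "cmod (\<xi> - \<zeta>) < d")
          case True
          have "cmod (R \<xi> * k \<xi>) \<le> (e * cmod (\<xi> - \<zeta>)) * ((1 - r\<^sup>2) * cmod (\<xi> - \<zeta>) * 2 / p ^ 4)"
            unfolding norm_mult kn using d(2)[OF \<xi> True] s0 r2 p0 e
            by (intro mult_mono divide_right_mono mult_left_mono) auto
          also have "\<dots> = (2 * e * (1 - r\<^sup>2) / p ^ 4) * (cmod (\<xi> - \<zeta>))\<^sup>2" by (simp add: power2_eq_square)
          also have "\<dots> \<le> (2 * e * (1 - r\<^sup>2) / p ^ 4) * (2 * p)\<^sup>2"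
            using q0 r2 e p0 by (intro mult_left_mono power_mono) auto
          also have "\<dots> = 8 * e * Poisson_kernel z \<xi>"
            using p0 by (simp add: Poisson_kernel_def z p_def[symmetric] power2_eq_square numeral_eq_Suc)
          finally show ?thesis using r2 B by (simp add: add_increasing2)
        next
          case False
          then have pd: "d / 2 \<le> p" using q0 by simp
          have n2: "cmod (\<xi> - \<zeta>) \<le> 2" using norm_triangle_ineq4[of \<xi> \<zeta>] \<xi> \<zeta> by simp
          have "cmod (R \<xi> * k \<xi>) \<le> C * ((1 - r\<^sup>2) * 2 * 2 / (d / 2) ^ 4)"
            unfolding norm_mult kn using C[OF \<xi>] s0 r2 p0 n2 pd d(1)
            by (intro mult_mono frac_le power_mono) auto
          also have "\<dots> = (1 - r\<^sup>2) * B" by (simp add: B_def)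
          finally show ?thesis using Poisson_kernel_nonneg[OF z1, of \<xi>] e by (simp add: add_increasing)
        qed
      qed
      also have "\<dots> = 8 * e * (LINT \<xi>|circle_measure. Poisson_kernel z \<xi>) + (1 - r\<^sup>2) * B"
        using circle_integrable_continuous[OF continuous_on_Poisson_kernel[OF z1]]
        using circle.prob_space by (subst Bochner_Integration.integral_add) auto
      finally have "cmod (deriv F z - L) \<le> 8 * e * (LINT \<xi>|circle_measure. Poisson_kernel z \<xi>) + (1 - r\<^sup>2) * B" .
      then show ?thesis unfolding Poisson_kernel_integral[OF z1] unfolding z_def by simp
    qed
    have "((\<lambda>r::real. 8 * e + (1 - r\<^sup>2) * B) \<longlongrightarrow> 8 * e + (1 - 1\<^sup>2) * B) (at_left 1)"
      by (intro tendsto_intros)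
    then have "\<forall>\<^sub>F r in at_left 1. 8 * e + (1 - r\<^sup>2) * B < e0"
      by (rule order_tendstoD) (use e0 in \<open>simp add: e_def\<close>)
    moreover have "\<forall>\<^sub>F r in at_left (1::real). r \<in> {0<..<1}"
      by (intro eventually_at_leftI[of 0]) auto
    ultimately show "\<forall>\<^sub>F r in at_left 1. dist (deriv F (of_real r * \<zeta>)) L < e0"
    proof eventually_elim
      case (elim r)
      then show ?case using key[of r] by (simp add: dist_norm)
    qed
  qed
qed

text \<open>Differentiability in the angle, as the Lipschitz theorem provides it, becomes the
  estimate in terms of the chord that is wanted for the radial limit. The factor
  \<open>\<i> * cis t0\<close> is the derivative of \<open>cis\<close>.\<close>

lemma vector_derivative_cis_chord_bound:
  assumes D: "((\<lambda>t. F (cis t)) has_vector_derivative D) (at t0)" and e: "e > 0"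
  shows "\<exists>d>0. \<forall>\<xi>. cmod \<xi> = 1 \<and> cmod (\<xi> - cis t0) < d \<longrightarrow>
    cmod (F \<xi> - F (cis t0) - (D / (\<i> * cis t0)) * (\<xi> - cis t0)) \<le> e * cmod (\<xi> - cis t0)"
proof -
  define L where "L = D / (\<i> * cis t0)"
  have dc: "(cis has_vector_derivative \<i> * cis t0) (at t0)"
    using has_derivative_cis[of "\<lambda>x. x" "\<lambda>x. x" t0 UNIV]
    by (simp add: has_vector_derivative_def)
  have "((\<lambda>t. F (cis t) - F (cis t0) - L * (cis t - cis t0)) has_vector_derivative D - 0 - L * (\<i> * cis t0 - 0)) (at t0)"
    by (intro has_vector_derivative_diff has_vector_derivative_mult_right has_vector_derivative_const D dc)
  then have "((\<lambda>t. F (cis t) - F (cis t0) - L * (cis t - cis t0)) has_vector_derivative 0) (at t0)"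
    by (simp add: L_def)
  then have "((\<lambda>t. F (cis t) - F (cis t0) - L * (cis t - cis t0)) has_derivative (\<lambda>h. 0)) (at t0)"
    by (simp add: has_vector_derivative_def)
  then obtain \<delta> where \<delta>: "\<delta> > 0" "\<And>t. \<bar>t - t0\<bar> < \<delta> \<Longrightarrow>
      cmod (F (cis t) - F (cis t0) - L * (cis t - cis t0)) \<le> (e / 2) * \<bar>t - t0\<bar>"
    using e unfolding has_derivative_at_alt
    by (elim conjE allE[of _ "e / 2"]) (auto simp only: real_norm_def diff_zero diff_self mult_zero_right cis_zero half_gt_zero_iff simp_thms)
  \<comment> \<open>Near \<open>t0\<close> the angle, read off from \<open>Ln\<close>, is at most twice the chord.\<close>
  have dLn: "(Ln has_field_derivative inverse 1) (at 1)" by (rule has_field_derivative_Ln) auto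
  then have "(Ln has_derivative (*) 1) (at 1)" by (simp add: has_field_derivative_def)
  then obtain \<eta> where \<eta>: "\<eta> > 0" "\<And>w. cmod (w - 1) < \<eta> \<Longrightarrow> cmod (Ln w - Ln 1 - 1 * (w - 1)) \<le> 1 * cmod (w - 1)"
    unfolding has_derivative_at_alt by (metis zero_less_one)
  define d where "d = min \<eta> (\<delta> / 2)"
  have "cmod (F \<xi> - F (cis t0) - L * (\<xi> - cis t0)) \<le> e * cmod (\<xi> - cis t0)"
    if \<xi>: "cmod \<xi> = 1" "cmod (\<xi> - cis t0) < d" for \<xi>
  proof -
    define w where "w = \<xi> / cis t0"
    have w1: "cmod w = 1" using \<xi> by (simp add: w_def norm_divide)
    have weq: "\<xi> = cis t0 * w" by (simp add: w_def)
    have cw: "cmod (\<xi> - cis t0) = cmod (w - 1)"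
    proof -
      have "\<xi> - cis t0 = cis t0 * (w - 1)" by (simp add: weq algebra_simps)
      then show ?thesis by (simp add: norm_mult)
    qed
    have wn: "w \<noteq> 0" using w1 by auto
    have "cmod (Ln w) \<le> cmod (Ln w - (w - 1)) + cmod (w - 1)"
      using norm_triangle_ineq[of "Ln w - (w - 1)" "w - 1"] by simp
    also have "\<dots> \<le> 2 * cmod (w - 1)"
      using \<eta>(2)[of w] \<xi>(2) cw by (simp add: d_def)
    finally have Lw: "cmod (Ln w) \<le> 2 * cmod (w - 1)" .
    define t where "t = t0 + Im (Ln w)"
    have "Re (Ln w) = 0" using wn w1 by simp
    then have "exp (Ln w) = cis (Im (Ln w))" by (simp add: exp_eq_polar)
    then have ct: "cis t = \<xi>" using wn by (simp add: t_def weq cis_mult[symmetric])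
    have tt: "\<bar>t - t0\<bar> \<le> 2 * cmod (\<xi> - cis t0)"
      using Lw abs_Im_le_cmod[of "Ln w"] unfolding cw t_def by simp
    then have "\<bar>t - t0\<bar> < \<delta>" using \<xi>(2) by (simp add: d_def)
    from \<delta>(2)[OF this] show ?thesis using tt e unfolding ct
      by (smt (verit) mult_left_mono divide_nonneg_nonneg field_sum_of_halves mult.assoc mult.commute times_divide_eq_right)
  qed
  then show ?thesis using \<eta>(1) \<delta>(1) unfolding L_def by (intro exI[of _ d]) (auto simp: d_def)
qed

text \<open>By continuity rational radii suffice. All quantifiers on the right range over countable
  types, which makes the existence of a radial limit a measurable condition on the
  direction.\<close>

lemma tendsto_at_left_iff_rational:
  fixes u :: "real \<Rightarrow> 'a::metric_space"
  assumes u: "continuous_on {0..<1} u"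
  shows "(u \<longlongrightarrow> l) (at_left 1) \<longleftrightarrow>
    (\<forall>k::nat. \<exists>N::nat. \<forall>q::rat. 0 \<le> real_of_rat q \<and> 1 - 1 / real (Suc N) < of_rat q \<and> of_rat q < (1::real) \<longrightarrow>
       dist (u (of_rat q)) l \<le> 1 / real (Suc k))" (is "_ \<longleftrightarrow> ?R")
proof
  assume lim: "(u \<longlongrightarrow> l) (at_left 1)"
  show ?R
  proof
    fix k
    have "\<forall>\<^sub>F r in at_left 1. dist (u r) l < 1 / real (Suc k)" by (rule tendstoD[OF lim]) simp
    then obtain b where b: "b < 1" "\<And>r. b < r \<Longrightarrow> r < 1 \<Longrightarrow> dist (u r) l < 1 / real (Suc k)"
      by (auto simp: eventually_at_left[of "0::real" 1])
    obtain N where N: "1 / real (Suc N) < 1 - b" using nat_approx_posE[of "1 - b"] b by auto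
    show "\<exists>N::nat. \<forall>q::rat. 0 \<le> real_of_rat q \<and> 1 - 1 / real (Suc N) < of_rat q \<and> of_rat q < (1::real) \<longrightarrow>
       dist (u (of_rat q)) l \<le> 1 / real (Suc k)"
      using b N by (intro exI[of _ N]) (force intro!: less_imp_le)
  qed
next
  assume R: ?R
  show "(u \<longlongrightarrow> l) (at_left 1)"
  proof (rule tendstoI)
    fix e :: real assume "e > 0"
    then obtain k where k: "1 / real (Suc k) < e" using nat_approx_posE by blast
    obtain N where N: "\<And>q::rat. 0 \<le> real_of_rat q \<Longrightarrow> 1 - 1 / real (Suc N) < real_of_rat q \<Longrightarrow> real_of_rat q < 1 \<Longrightarrow>
       dist (u (of_rat q)) l \<le> 1 / real (Suc k)" using R by blast
    have N0: "1 - 1 / real (Suc N) \<ge> 0" by simp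
    have "dist (u r) l < e" if r: "1 - 1 / real (Suc N) < r" "r < 1" for r
    proof -
      have r0: "0 < r" using r N0 by linarith
      have "((\<lambda>s. dist (u s) l) \<longlongrightarrow> dist (u r) l) (at r within {0..<1})"
        using u r r0 by (intro tendsto_intros) (auto simp: continuous_on_def)
      then have lim: "((\<lambda>s. dist (u s) l) \<longlongrightarrow> dist (u r) l) (at r)"
        using r r0 at_within_interior[of r "{0..<1}"] by (simp add: interior_atLeastLessThan)
      have "dist (u r) l \<le> 1 / real (Suc k)"
      proof (rule ccontr)
        assume "\<not> dist (u r) l \<le> 1 / real (Suc k)"
        then have gt: "1 / real (Suc k) < dist (u r) l" by simp
        have "\<forall>\<^sub>F s in at r. 1 / real (Suc k) < dist (u s) l" by (rule order_tendstoD(1)[OF lim gt])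
        then obtain d where d: "d > 0" "\<And>s. s \<noteq> r \<Longrightarrow> dist s r < d \<Longrightarrow> 1 / real (Suc k) < dist (u s) l"
          by (auto simp: eventually_at)
        obtain q :: rat where q: "r < of_rat q" "of_rat q < min 1 (r + d)"
          using of_rat_dense[of r "min 1 (r + d)"] r d by auto
        have "0 \<le> real_of_rat q" "1 - 1 / real (Suc N) < real_of_rat q" "real_of_rat q < 1"
          using q r r0 by linarith+
        from N[OF this] d(2)[of "of_rat q"] q show False by (auto simp: dist_real_def)
      qed
      then show ?thesis using k by linarith
    qed
    then show "\<forall>\<^sub>F r in at_left 1. dist (u r) l < e"
      by (intro eventually_at_leftI[of "1 - 1 / real (Suc N)"]) auto
  qed
qed

lemma sets_radial_limit_exists:
  assumes h: "continuous_on unit_disc h"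
  shows "{\<zeta> \<in> unit_circle. ((\<lambda>r. h (of_real r * \<zeta>)) \<longlongrightarrow> radial_limit h \<zeta>) (at_left 1)} \<in> sets circle_measure"
proof -
  have cont: "continuous_on {0..<1} (\<lambda>r. h (of_real r * \<zeta>))" if "\<zeta> \<in> unit_circle" for \<zeta>
    by (intro continuous_on_compose2[OF h] continuous_intros) (use that in \<open>auto simp: norm_mult\<close>)
  have [measurable]: "radial_limit h \<in> borel_measurable circle_measure"
    by (rule measurable_radial_limit[OF h])
  have [measurable]: "(\<lambda>\<zeta>. h (of_real r * \<zeta>)) \<in> borel_measurable circle_measure" if "0 \<le> r" "r < 1" for r
    by (intro borel_measurable_circle_continuous continuous_on_compose2[OF h] continuous_intros)
       (use that in \<open>auto simp: norm_mult\<close>)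
  have "Measurable.pred circle_measure (\<lambda>\<zeta>. \<forall>k::nat. \<exists>N::nat. \<forall>q::rat.
      0 \<le> real_of_rat q \<and> 1 - 1 / real (Suc N) < of_rat q \<and> of_rat q < (1::real) \<longrightarrow>
       dist (h (of_real (of_rat q) * \<zeta>)) (radial_limit h \<zeta>) \<le> 1 / real (Suc k))" (is "Measurable.pred _ ?P")
  proof (intro pred_intros_countable)
    fix k N :: nat and q :: rat
    show "Measurable.pred circle_measure (\<lambda>\<zeta>. 0 \<le> real_of_rat q \<and> 1 - 1 / real (Suc N) < of_rat q \<and> of_rat q < (1::real) \<longrightarrow>
       dist (h (of_real (of_rat q) * \<zeta>)) (radial_limit h \<zeta>) \<le> 1 / real (Suc k))"
    proof (cases "0 \<le> real_of_rat q \<and> 1 - 1 / real (Suc N) < of_rat q \<and> of_rat q < (1::real)")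
      case True
      then have [measurable]: "(\<lambda>\<zeta>. h (of_real (of_rat q) * \<zeta>)) \<in> borel_measurable circle_measure" by auto
      show ?thesis by measurable
    next
      case False
      then show ?thesis by (simp only: if_False simp_thms) simp
    qed
  qed
  then have "{\<zeta> \<in> space circle_measure. ?P \<zeta>} \<in> sets circle_measure" by measurable
  moreover have "{\<zeta> \<in> space circle_measure. ?P \<zeta>} =
      {\<zeta> \<in> unit_circle. ((\<lambda>r. h (of_real r * \<zeta>)) \<longlongrightarrow> radial_limit h \<zeta>) (at_left 1)}"
    unfolding space_circle_measure
    by (rule Collect_cong, rule conj_cong[OF refl]) (rule tendsto_at_left_iff_rational[OF cont, symmetric])
  ultimately show ?thesis by simp
qed

lemma radial_limitI: "((\<lambda>r. h (of_real r * \<zeta>)) \<longlongrightarrow> l) (at_left 1) \<Longrightarrow> radial_limit h \<zeta> = l"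
  unfolding radial_limit_def by (rule tendsto_Lim) auto

text \<open>A primitive of a bounded function is Lipschitz and extends to the closed disc. Its
  boundary values are Lipschitz in the angle, hence differentiable almost everywhere, and at such
  points its derivative, which is \<open>h\<close>, has a radial limit.\<close>

theorem Fatou_radial_limits:
  assumes h: "h holomorphic_on unit_disc" and M: "\<And>z. cmod z < 1 \<Longrightarrow> cmod (h z) \<le> M"
  shows "AE \<zeta> in circle_measure. ((\<lambda>r. h (of_real r * \<zeta>)) \<longlongrightarrow> radial_limit h \<zeta>) (at_left 1)"
proof (rule AE_circle_measureI)
  show "{\<zeta> \<in> unit_circle. ((\<lambda>r. h (of_real r * \<zeta>)) \<longlongrightarrow> radial_limit h \<zeta>) (at_left 1)} \<in> sets circle_measure"
    by (intro sets_radial_limit_exists holomorphic_on_imp_continuous_on h)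
  have M0: "M \<ge> 0" using M[of 0] norm_ge_zero[of "h 0"] by (simp del: norm_ge_zero)
  obtain F0 where F0: "\<And>x. x \<in> unit_disc \<Longrightarrow> (F0 has_field_derivative h x) (at x within unit_disc)"
    using holomorphic_convex_primitive'[OF convex_ball open_ball h] by blast
  have lip: "M-lipschitz_on unit_disc F0"
    using M0 field_differentiable_bound[OF convex_ball F0, of M] M
    by (auto simp: lipschitz_on_def dist_norm)
  obtain F where F: "M-lipschitz_on (closure unit_disc) F" "\<And>x. x \<in> unit_disc \<Longrightarrow> F x = F0 x"
    using lipschitz_extend_closure[OF lip] by blast
  have Fl: "M-lipschitz_on (cball 0 1) F" using F(1) by simp
  have Fc: "continuous_on (cball 0 1) F" using Fl by (rule lipschitz_on_continuous_on)
  have dF: "(F has_field_derivative h x) (at x)" if "x \<in> unit_disc" for x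
  proof -
    have "(F0 has_field_derivative h x) (at x)"
      using F0[OF that] that by (simp add: at_within_open[of _ unit_disc])
    then show ?thesis
      by (rule has_field_derivative_transform_within_open[of _ _ _ unit_disc]) (use that F(2) in auto)
  qed
  have Fh: "F holomorphic_on unit_disc"
    unfolding holomorphic_on_open[OF open_ball] using dF by blast
  have "M-lipschitz_on UNIV (\<lambda>t. F (cis t))"
  proof (rule lipschitz_onI)
    fix s t :: real
    have "dist (F (cis s)) (F (cis t)) \<le> M * dist (cis s) (cis t)"
      using Fl by (auto simp: lipschitz_on_def)
    also have "dist (cis s) (cis t) \<le> dist s t"
    proof -
      have "dist (cis s) (cis t) = cmod (cis t * (cis (s - t) - 1))"
        by (simp add: dist_norm algebra_simps cis_mult)
      also have "\<dots> = cmod (exp (\<i> * of_real (s - t)) - 1)" by (simp add: norm_mult cis_conv_exp)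
      also have "\<dots> \<le> \<bar>s - t\<bar>" using iexp_approx1[of "s - t" 0] by simp
      finally show ?thesis by (simp add: dist_real_def)
    qed
    finally show "dist (F (cis s)) (F (cis t)) \<le> M * dist s t" using M0 by (simp add: mult_left_mono)
  qed (rule M0)
  from Lipschitz_complex_differentiable_AE[OF this]
  show "AE t in lborel. ((\<lambda>r. h (of_real r * cis t)) \<longlongrightarrow> radial_limit h (cis t)) (at_left 1)"
  proof eventually_elim
    case (elim t)
    then obtain D where D: "((\<lambda>t. F (cis t)) has_vector_derivative D) (at t)" by blast
    have "((\<lambda>r. deriv F (of_real r * cis t)) \<longlongrightarrow> D / (\<i> * cis t)) (at_left 1)"
      by (rule deriv_radial_limit[OF Fc Fh _ vector_derivative_cis_chord_bound[OF D]]) simp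
    moreover have "\<forall>\<^sub>F r in at_left (1::real). deriv F (of_real r * cis t) = h (of_real r * cis t)"
    proof (rule eventually_at_leftI[of 0])
      fix r :: real assume "r \<in> {0<..<1}"
      then show "deriv F (of_real r * cis t) = h (of_real r * cis t)"
        by (intro DERIV_imp_deriv dF) (auto simp: norm_mult)
    qed simp
    ultimately have "((\<lambda>r. h (of_real r * cis t)) \<longlongrightarrow> D / (\<i> * cis t)) (at_left 1)"
      using tendsto_cong by force
    from radial_limitI[OF this] this show ?case by simp
  qed
qed

lemma radial_limit_norm_le:
  assumes "((\<lambda>r. h (of_real r * \<zeta>)) \<longlongrightarrow> l) (at_left 1)" "cmod \<zeta> = 1"
    and M: "\<And>z. cmod z < 1 \<Longrightarrow> cmod (h z) \<le> M"
  shows "cmod l \<le> M"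
proof (rule tendsto_upperbound)
  show "((\<lambda>r. cmod (h (of_real r * \<zeta>))) \<longlongrightarrow> cmod l) (at_left 1)" by (intro tendsto_norm assms)
  show "\<forall>\<^sub>F r in at_left (1::real). cmod (h (of_real r * \<zeta>)) \<le> M"
    by (intro eventually_at_leftI[of 0] M) (use assms(2) in \<open>auto simp: norm_mult\<close>)
qed simp

lemma filterlim_at_left_sequence: "filterlim (\<lambda>n. 1 - 1 / real (Suc (Suc n))) (at_left 1) sequentially"
  by real_asymp

text \<open>The kernel is left open so that the result serves both the Poisson and the Cauchy
  kernel. The dilates \<open>h (r \<xi>)\<close> are continuous up to the circle, where
  \<open>rep\<close> applies; dominated convergence then lets \<open>r\<close> tend to 1.\<close>

lemma reproducing_kernel_radial_limit:
  fixes k :: "complex \<Rightarrow> complex"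
  assumes h: "h holomorphic_on unit_disc" and M: "\<And>z. cmod z < 1 \<Longrightarrow> cmod (h z) \<le> M" and z: "cmod z < 1"
    and k: "continuous_on unit_circle k"
    and rep: "\<And>F. continuous_on (cball 0 1) F \<Longrightarrow> F holomorphic_on unit_disc \<Longrightarrow>
      (LINT \<xi>|circle_measure. F \<xi> * k \<xi>) = F z"
  shows "(LINT \<xi>|circle_measure. radial_limit h \<xi> * k \<xi>) = h z"
proof -
  \<comment> \<open>The second successor makes the first radius \<open>1/2\<close> instead of
    0.\<close>
  define r where "r n = 1 - 1 / real (Suc (Suc n))" for n
  have r: "0 < r n" "r n < 1" for n by (auto simp: r_def)
  have hc: "continuous_on unit_disc h" by (intro holomorphic_on_imp_continuous_on h)
  have m: "cmod (of_real (r n) * \<xi>) < 1" if "cmod \<xi> \<le> 1" for n \<xi>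
  proof -
    have "cmod (of_real (r n) * \<xi>) \<le> r n * 1"
      unfolding norm_mult using r[of n] that by (intro mult_mono) auto
    then show ?thesis using r[of n] by simp
  qed
  have P: "(LINT \<xi>|circle_measure. h (of_real (r n) * \<xi>) * k \<xi>) = h (of_real (r n) * z)" for n
  proof (rule rep)
    show "continuous_on (cball 0 1) (\<lambda>\<xi>. h (of_real (r n) * \<xi>))"
      by (intro continuous_on_compose2[OF hc] continuous_intros) (use m in \<open>auto simp del: norm_mult\<close>)
    have "(h \<circ> (\<lambda>\<xi>. of_real (r n) * \<xi>)) holomorphic_on unit_disc"
      by (intro holomorphic_on_compose_gen[OF _ h] holomorphic_intros) (use m less_imp_le in \<open>auto simp del: norm_mult\<close>)
    then show "(\<lambda>\<xi>. h (of_real (r n) * \<xi>)) holomorphic_on unit_disc" by (simp add: o_def)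
  qed
  have "(\<lambda>n. LINT \<xi>|circle_measure. h (of_real (r n) * \<xi>) * k \<xi>) \<longlonglongrightarrow>
      (LINT \<xi>|circle_measure. radial_limit h \<xi> * k \<xi>)"
  proof (rule integral_dominated_convergence[where w = "\<lambda>\<xi>. M * cmod (k \<xi>)"])
    note [measurable] = borel_measurable_circle_continuous[OF k] measurable_radial_limit[OF hc]
    show "(\<lambda>\<xi>. radial_limit h \<xi> * k \<xi>) \<in> borel_measurable circle_measure" by measurable
    show "(\<lambda>\<xi>. h (of_real (r n) * \<xi>) * k \<xi>) \<in> borel_measurable circle_measure" for n
      by (intro borel_measurable_circle_continuous continuous_intros k continuous_on_compose2[OF hc])
         (use m in \<open>auto simp del: norm_mult\<close>)
    show "integrable circle_measure (\<lambda>\<xi>. M * cmod (k \<xi>))"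
      by (intro circle_integrable_continuous continuous_intros k)
    show "AE \<xi> in circle_measure. norm (h (of_real (r n) * \<xi>) * k \<xi>) \<le> M * cmod (k \<xi>)" for n
    proof (rule AE_I2)
      fix \<xi> assume "\<xi> \<in> space circle_measure"
      then show "norm (h (of_real (r n) * \<xi>) * k \<xi>) \<le> M * cmod (k \<xi>)"
        unfolding norm_mult[of "h _"] using m[of \<xi> n] by (intro mult_right_mono M) auto
    qed
    have "AE \<xi> in circle_measure. ((\<lambda>r. h (of_real r * \<xi>)) \<longlongrightarrow> radial_limit h \<xi>) (at_left 1)"
      by (rule Fatou_radial_limits[OF h]) (rule M)
    then show "AE \<xi> in circle_measure. (\<lambda>n. h (of_real (r n) * \<xi>) * k \<xi>) \<longlonglongrightarrow> radial_limit h \<xi> * k \<xi>"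
    proof eventually_elim
      case (elim \<xi>)
      from filterlim_compose[OF elim filterlim_at_left_sequence]
      show ?case by (intro tendsto_mult tendsto_const) (simp add: r_def)
    qed
  qed
  moreover have "(\<lambda>n. h (of_real (r n) * z)) \<longlonglongrightarrow> h (1 * z)"
  proof -
    have "(\<lambda>n. of_real (r n) * z) \<longlonglongrightarrow> of_real 1 * z"
      unfolding r_def by (intro tendsto_intros) real_asymp
    moreover have "isCont h z" using hc z by (simp add: continuous_on_eq_continuous_at)
    ultimately show ?thesis using isCont_tendsto_compose[of z h] by simp
  qed
  ultimately show ?thesis unfolding P using LIMSEQ_unique by fastforce
qed

lemma bounded_holomorphic_Poisson:
  assumes h: "h holomorphic_on unit_disc" and M: "\<And>z. cmod z < 1 \<Longrightarrow> cmod (h z) \<le> M" and z: "cmod z < 1"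
  shows "(LINT \<xi>|circle_measure. Poisson_kernel z \<xi> *\<^sub>R radial_limit h \<xi>) = h z"
proof -
  have "(LINT \<xi>|circle_measure. radial_limit h \<xi> * of_real (Poisson_kernel z \<xi>)) = h z"
  proof (rule reproducing_kernel_radial_limit[OF h M z])
    show "continuous_on unit_circle (\<lambda>\<xi>. complex_of_real (Poisson_kernel z \<xi>))"
      by (intro continuous_intros continuous_on_Poisson_kernel z)
    fix F :: "complex \<Rightarrow> complex" assume "continuous_on (cball 0 1) F" "F holomorphic_on unit_disc"
    from Poisson_formula[OF this z] show "(LINT \<xi>|circle_measure. F \<xi> * of_real (Poisson_kernel z \<xi>)) = F z"
      by (simp add: scaleR_conv_of_real mult.commute)
  qed
  then show ?thesis by (simp add: scaleR_conv_of_real mult.commute)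
qed

section \<open>Measures on the circle\<close>

text \<open>The powers of \<open>\<xi>\<close> and of its conjugate are kept apart because functions
  are compared on the whole plane, while \<open>\<xi> * cnj \<xi> = 1\<close> holds on the circle
  only. Real polynomial functions of the plane then belong to the class.\<close>

inductive trig_poly :: "(complex \<Rightarrow> complex) \<Rightarrow> bool" where
  monom: "trig_poly (\<lambda>\<xi>. c * \<xi> ^ j * cnj \<xi> ^ k)"
| add: "trig_poly f \<Longrightarrow> trig_poly g \<Longrightarrow> trig_poly (\<lambda>\<xi>. f \<xi> + g \<xi>)"

lemma trig_poly_mult:
  assumes "trig_poly f" "trig_poly g"
  shows "trig_poly (\<lambda>\<xi>. f \<xi> * g \<xi>)"
  using assms
proof (induction rule: trig_poly.induct)
  case (monom c j k)
  from monom show ?case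
  proof (induction rule: trig_poly.induct)
    case (monom d l m)
    have "(\<lambda>\<xi>. c * \<xi> ^ j * cnj \<xi> ^ k * (d * \<xi> ^ l * cnj \<xi> ^ m)) = (\<lambda>\<xi>. (c * d) * \<xi> ^ (j + l) * cnj \<xi> ^ (k + m))"
      by (simp add: power_add mult_ac)
    then show ?case by (simp only: trig_poly.monom)
  next
    case (add f g)
    then show ?case by (simp only: distrib_left trig_poly.add)
  qed
next
  case (add f1 f2)
  then show ?case by (simp only: distrib_right trig_poly.add)
qed

lemma trig_poly_real_polynomial:
  fixes f :: "complex \<Rightarrow> real"
  assumes "real_polynomial_function f"
  shows "trig_poly (\<lambda>\<xi>. of_real (f \<xi>))"
  using assms
proof (induction rule: real_polynomial_function.induct)
  case (linear f)
  interpret bounded_linear f by (rule linear)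
  have f: "f \<xi> = Re \<xi> * f 1 + Im \<xi> * f \<i>" for \<xi>
  proof -
    have "f \<xi> = f (Re \<xi> *\<^sub>R 1 + Im \<xi> *\<^sub>R \<i>)" by (rule arg_cong[of _ _ f]) (simp add: complex_eq_iff)
    then show ?thesis by (simp only: add scaleR real_scaleR_def)
  qed
  have "(\<lambda>\<xi>. complex_of_real (f \<xi>)) = (\<lambda>\<xi>. ((of_real (f 1) - \<i> * of_real (f \<i>)) / 2) * \<xi> ^ 1 * cnj \<xi> ^ 0 +
      ((of_real (f 1) + \<i> * of_real (f \<i>)) / 2) * \<xi> ^ 0 * cnj \<xi> ^ 1)"
    by (rule ext, subst f) (auto simp: complex_eq_iff algebra_simps add_divide_distrib diff_divide_distrib)
  then show ?case by (simp only: trig_poly.intros)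
next
  case (const c)
  show ?case using trig_poly.monom[of "of_real c" 0 0] by simp
next
  case (add f g)
  then show ?case by (simp only: of_real_add trig_poly.add)
next
  case (mult f g)
  then show ?case by (simp only: of_real_mult trig_poly_mult)
qed

lemma continuous_on_trig_poly: "trig_poly f \<Longrightarrow> continuous_on S f"
  by (induction rule: trig_poly.induct) (auto intro!: continuous_intros)

lemma integrable_continuous_on_circle:
  fixes f :: "complex \<Rightarrow> 'b::{banach, second_countable_topology}"
  assumes M: "finite_measure M" "sets M = sets circle_measure" and f: "continuous_on unit_circle f"
  shows "integrable M f"
proof -
  have "bounded (f ` unit_circle)" using f by (intro compact_imp_bounded compact_continuous_image) auto
  then obtain K where "\<forall>x\<in>unit_circle. norm (f x) \<le> K" unfolding bounded_iff by blast
  moreover have "space M = unit_circle" using sets_eq_imp_space_eq[OF M(2)] by simp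
  moreover have "f \<in> borel_measurable M"
    using borel_measurable_circle_continuous[OF f] by (simp cong: measurable_cong_sets add: M(2))
  ultimately show ?thesis
    by (intro finite_measure.integrable_const_bound[OF M(1), of _ K]) auto
qed

text \<open>On the circle negative powers are conjugates of positive ones, so the moments determine
  the integrals of all trigonometric polynomials. Stone--Weierstrass passes to continuous functions,
  and these approximate the indicators of closed sets from above.\<close>

lemma circle_measures_eq_by_moments:
  assumes M: "finite_measure M" "sets M = sets circle_measure"
    and N: "finite_measure N" "sets N = sets circle_measure"
    and eq: "\<And>k::nat. (LINT \<xi>|M. \<xi> ^ k) = (LINT \<xi>|N. \<xi> ^ k)"
  shows "M = N"
proof -
  have space: "space M = unit_circle" "space N = unit_circle"
    using sets_eq_imp_space_eq[OF M(2)] sets_eq_imp_space_eq[OF N(2)] by simp_all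
  note intM = integrable_continuous_on_circle[OF M] and intN = integrable_continuous_on_circle[OF N]
  have unit: "\<xi> * cnj \<xi> = 1" if "\<xi> \<in> unit_circle" for \<xi>
    using that by (simp add: complex_norm_square[symmetric])
  have mixed: "(LINT \<xi>|M. \<xi> ^ j * cnj \<xi> ^ k) = (LINT \<xi>|N. \<xi> ^ j * cnj \<xi> ^ k)" for j k
  proof (cases "k \<le> j")
    case True
    have e: "\<xi> ^ j * cnj \<xi> ^ k = \<xi> ^ (j - k)" if "\<xi> \<in> unit_circle" for \<xi>
    proof -
      have "\<xi> ^ j = \<xi> ^ (j - k) * \<xi> ^ k" using True by (simp add: power_add[symmetric])
      then have "\<xi> ^ j * cnj \<xi> ^ k = \<xi> ^ (j - k) * (\<xi> * cnj \<xi>) ^ k" by (simp add: power_mult_distrib)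
      then show ?thesis by (simp only: unit[OF that] power_one mult_1_right)
    qed
    have "(LINT \<xi>|M. \<xi> ^ j * cnj \<xi> ^ k) = (LINT \<xi>|M. \<xi> ^ (j - k))"
      by (intro Bochner_Integration.integral_cong) (simp_all only: space e)
    also have "\<dots> = (LINT \<xi>|N. \<xi> ^ j * cnj \<xi> ^ k)" unfolding eq
      by (intro Bochner_Integration.integral_cong) (simp_all only: space e)
    finally show ?thesis .
  next
    case False
    have e: "\<xi> ^ j * cnj \<xi> ^ k = cnj (\<xi> ^ (k - j))" if "\<xi> \<in> unit_circle" for \<xi>
    proof -
      have "cnj \<xi> ^ k = cnj \<xi> ^ (k - j) * cnj \<xi> ^ j" using False by (simp add: power_add[symmetric])
      then have "\<xi> ^ j * cnj \<xi> ^ k = cnj \<xi> ^ (k - j) * (\<xi> * cnj \<xi>) ^ j" by (simp add: power_mult_distrib)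
      then show ?thesis by (simp only: unit[OF that] power_one mult_1_right complex_cnj_power)
    qed
    have "(LINT \<xi>|M. \<xi> ^ j * cnj \<xi> ^ k) = (LINT \<xi>|M. cnj (\<xi> ^ (k - j)))"
      by (intro Bochner_Integration.integral_cong) (simp_all only: space e)
    also have "\<dots> = cnj (LINT \<xi>|M. \<xi> ^ (k - j))" by (rule Bochner_Integration.integral_cnj)
    also have "\<dots> = cnj (LINT \<xi>|N. \<xi> ^ (k - j))" by (simp only: eq)
    also have "\<dots> = (LINT \<xi>|N. cnj (\<xi> ^ (k - j)))" by (rule Bochner_Integration.integral_cnj[symmetric])
    also have "\<dots> = (LINT \<xi>|N. \<xi> ^ j * cnj \<xi> ^ k)"
      by (intro Bochner_Integration.integral_cong) (simp_all only: space e)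
    finally show ?thesis .
  qed
  have trig: "(LINT \<xi>|M. f \<xi>) = (LINT \<xi>|N. f \<xi>)" if "trig_poly f" for f
    using that
  proof (induction rule: trig_poly.induct)
    case (monom c j k)
    then show ?case by (simp add: mult.assoc mixed)
  next
    case (add f g)
    then show ?case by (simp add: intM intN continuous_on_trig_poly)
  qed
  have poly: "(LINT \<xi>|M. f \<xi>) = (LINT \<xi>|N. f \<xi>)" if f: "real_polynomial_function f" for f :: "complex \<Rightarrow> real"
  proof -
    have "complex_of_real (LINT \<xi>|M. f \<xi>) = complex_of_real (LINT \<xi>|N. f \<xi>)"
      using trig[OF trig_poly_real_polynomial[OF f]] by (simp only: integral_complex_of_real)
    then show ?thesis by (simp only: of_real_eq_iff)
  qed
  have cont: "(LINT \<xi>|M. f \<xi>) = (LINT \<xi>|N. f \<xi>)" if f: "continuous_on unit_circle f" for f :: "complex \<Rightarrow> real"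
  proof -
    define C where "C = measure M unit_circle + measure N unit_circle"
    have le: "\<bar>(LINT \<xi>|M. f \<xi>) - (LINT \<xi>|N. f \<xi>)\<bar> \<le> e" if e: "e > 0" for e
    proof -
      define d where "d = e / (C + 1)"
      have C0: "C \<ge> 0" by (simp add: C_def)
      then have d: "d > 0" using e by (simp add: d_def)
      obtain g where g: "real_polynomial_function g" "\<And>x. x \<in> unit_circle \<Longrightarrow> \<bar>f x - g x\<bar> < d"
        using Stone_Weierstrass_real_polynomial_function[OF compact_sphere f d] by blast
      have gc: "continuous_on unit_circle g"
        using g(1) by (intro continuous_on_polymonial_function) (simp add: real_polynomial_function_eq)
      have b: "\<bar>(LINT \<xi>|L. f \<xi>) - (LINT \<xi>|L. g \<xi>)\<bar> \<le> d * measure L unit_circle"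
        if L: "finite_measure L" "sets L = sets circle_measure" for L
      proof -
        interpret L: finite_measure L by (rule L)
        have sp: "space L = unit_circle" using sets_eq_imp_space_eq[OF L(2)] by simp
        note int = integrable_continuous_on_circle[OF L]
        have "\<bar>(LINT \<xi>|L. f \<xi>) - (LINT \<xi>|L. g \<xi>)\<bar> = \<bar>LINT \<xi>|L. f \<xi> - g \<xi>\<bar>"
          by (simp add: int f gc)
        also have "\<dots> \<le> (LINT \<xi>|L. \<bar>f \<xi> - g \<xi>\<bar>)" by (rule integral_abs_bound)
        also have "\<dots> \<le> (LINT \<xi>|L. d)"
          using g(2) by (intro integral_mono int continuous_intros f gc) (auto simp: sp less_imp_le)
        finally show ?thesis by (simp add: sp mult.commute)
      qed
      have "\<bar>(LINT \<xi>|M. f \<xi>) - (LINT \<xi>|N. f \<xi>)\<bar> \<le> d * C"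
        using b[OF M] b[OF N] poly[OF g(1)] unfolding C_def distrib_left by linarith
      also have "\<dots> \<le> e" using C0 e by (simp add: d_def field_simps)
      finally show ?thesis .
    qed
    have "\<bar>(LINT \<xi>|M. f \<xi>) - (LINT \<xi>|N. f \<xi>)\<bar> \<le> 0"
      by (rule field_le_epsilon) (simp only: add_0 le)
    then show ?thesis by simp
  qed
  have closed_eq: "measure M (C \<inter> unit_circle) = measure N (C \<inter> unit_circle)" if C: "closed C" for C
  proof (cases "C = {}")
    case False
    \<comment> \<open>These functions decrease to the indicator of \<open>C\<close>. The empty set
      is split off because \<open>infdist\<close> to it is 0 by convention.\<close>
    define u where "u n \<xi> = max 0 (1 - real n * infdist \<xi> C)" for n \<xi>
    have uc: "continuous_on unit_circle (u n)" for n
      unfolding u_def by (intro continuous_intros continuous_on_infdist)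
    have "(\<lambda>n. LINT \<xi>|L. u n \<xi>) \<longlonglongrightarrow> measure L (C \<inter> unit_circle)"
      if L: "finite_measure L" "sets L = sets circle_measure" for L
    proof -
      interpret L: finite_measure L by (rule L)
      have sp: "space L = unit_circle" using sets_eq_imp_space_eq[OF L(2)] by simp
      have sC: "C \<inter> unit_circle \<in> sets L"
        using C by (auto simp: L(2) sets_circle_measure sets_restrict_space image_iff)
      have "(\<lambda>n. LINT \<xi>|L. u n \<xi>) \<longlonglongrightarrow> (LINT \<xi>|L. indicator (C \<inter> unit_circle) \<xi>)"
      proof (rule integral_dominated_convergence[where w = "\<lambda>_. 1"])
        show "AE \<xi> in L. (\<lambda>n. u n \<xi>) \<longlonglongrightarrow> indicator (C \<inter> unit_circle) \<xi>"
        proof (rule AE_I2)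
          fix \<xi> assume "\<xi> \<in> space L"
          then have x: "\<xi> \<in> unit_circle" by (simp add: sp)
          show "(\<lambda>n. u n \<xi>) \<longlonglongrightarrow> indicator (C \<inter> unit_circle) \<xi>"
          proof (cases "\<xi> \<in> C")
            case True
            then show ?thesis using x by (simp add: u_def)
          next
            case nC: False
            then have p: "infdist \<xi> C > 0" using C False by (simp add: infdist_pos_not_in_closed)
            then obtain n0 where n0: "1 / infdist \<xi> C \<le> real n0" using real_arch_simple by blast
            have "u n \<xi> = 0" if "n \<ge> n0" for n
            proof -
              have "1 / infdist \<xi> C \<le> real n" using n0 that by linarith
              then show ?thesis using p by (simp add: u_def field_simps)
            qed
            then have "\<forall>\<^sub>F n in sequentially. u n \<xi> = 0" by (auto simp: eventually_sequentially)
            then show ?thesis using nC by (simp add: tendsto_eventually)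
          qed
        qed
      next
        fix n
        show "AE \<xi> in L. norm (u n \<xi>) \<le> 1" by (rule AE_I2) (auto simp: u_def infdist_nonneg)
        show "u n \<in> borel_measurable L"
          using integrable_continuous_on_circle[OF L uc] by (rule borel_measurable_integrable)
      qed (use sC in auto)
      then show ?thesis using sC by simp
    qed
    from this[OF M] this[OF N] show ?thesis unfolding cont[OF uc] by (rule LIMSEQ_unique)
  qed simp
  interpret M: finite_measure M by (rule M)
  interpret N: finite_measure N by (rule N)
  have id: "(\<lambda>x. x) \<in> borel_measurable circle_measure"
    by (intro borel_measurable_circle_continuous continuous_intros)
  have idM: "(\<lambda>x. x) \<in> M \<rightarrow>\<^sub>M borel" and idN: "(\<lambda>x. x) \<in> N \<rightarrow>\<^sub>M borel"
    using id by (simp_all cong: measurable_cong_sets add: M(2) N(2))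
  \<comment> \<open>The measures are moved to the whole plane, where the closed sets form a
    generator stable under intersection, and are restricted to the circle again at the end.\<close>
  have "distr M borel (\<lambda>x. x) = distr N borel (\<lambda>x. x)"
  proof (rule measure_eqI_generator_eq[where E = "Collect closed" and \<Omega> = UNIV and A = "\<lambda>_. UNIV"])
    show "Int_stable (Collect closed :: complex set set)" by (auto simp: Int_stable_def)
    show "emeasure (distr M borel (\<lambda>x. x)) X = emeasure (distr N borel (\<lambda>x. x)) X" if "X \<in> Collect closed" for X
      using that closed_eq[of X]
      by (simp add: emeasure_distr idM idN space M.emeasure_eq_measure N.emeasure_eq_measure)
    show "emeasure (distr M borel (\<lambda>x. x)) UNIV \<noteq> \<infinity>"
      by (simp add: emeasure_distr idM space)
    have "sets borel = sigma_sets UNIV (Collect closed :: complex set set)"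
      by (subst borel_eq_closed) (rule sets_measure_of, simp)
    then show "sets (distr M borel (\<lambda>x. x)) = sigma_sets UNIV (Collect closed)"
      "sets (distr N borel (\<lambda>x. x)) = sigma_sets UNIV (Collect closed)" by simp_all
  qed auto
  then have eqb: "emeasure (distr M borel (\<lambda>x. x)) A = emeasure (distr N borel (\<lambda>x. x)) A" for A
    by (simp only:)
  show "M = N"
  proof (rule measure_eqI)
    show "sets M = sets N" by (simp only: M(2) N(2))
    fix A assume "A \<in> sets M"
    then have "A \<in> sets (restrict_space borel unit_circle)" by (simp only: M(2) sets_circle_measure)
    then obtain B where B: "B \<in> sets borel" "A = unit_circle \<inter> B"
      unfolding sets_restrict_space by blast
    then show "emeasure M A = emeasure N A"
      using eqb[of B] by (simp add: emeasure_distr idM idN space Int_commute)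
  qed
qed

section \<open>Poisson measures, the harmonic measures of the disc\<close>

lemma Poisson_kernel_pos: "cmod z < 1 \<Longrightarrow> cmod \<xi> = 1 \<Longrightarrow> 0 < Poisson_kernel z \<xi>"
  using Poisson_kernel_bounds(2)[of z \<xi>]
  by (smt (verit) divide_pos_pos norm_ge_zero)

definition Poisson_measure :: "complex \<Rightarrow> complex measure" where
  "Poisson_measure z = density circle_measure (\<lambda>\<xi>. ennreal (Poisson_kernel z \<xi>))"

lemma sets_Poisson_measure [simp, measurable_cong]: "sets (Poisson_measure z) = sets circle_measure"
  by (simp add: Poisson_measure_def)

lemma space_Poisson_measure [simp]: "space (Poisson_measure z) = unit_circle"
  by (simp add: Poisson_measure_def)

lemma Poisson_measure_0: "Poisson_measure 0 = circle_measure"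
proof -
  have "Poisson_measure 0 = density circle_measure (\<lambda>_. 1)"
    unfolding Poisson_measure_def
  proof (rule density_cong)
    show "AE \<xi> in circle_measure. ennreal (Poisson_kernel 0 \<xi>) = 1"
      by (rule AE_I2) (simp add: Poisson_kernel_def)
  qed (use measurable_Poisson_kernel[of 0] in auto)
  then show ?thesis by (simp add: density_1)
qed

lemma integral_Poisson_measure:
  fixes f :: "complex \<Rightarrow> 'b::{banach, second_countable_topology}"
  assumes "cmod z < 1" "f \<in> borel_measurable circle_measure"
  shows "(LINT \<xi>|Poisson_measure z. f \<xi>) = (LINT \<xi>|circle_measure. Poisson_kernel z \<xi> *\<^sub>R f \<xi>)"
  unfolding Poisson_measure_def
  by (intro integral_density assms measurable_Poisson_kernel AE_I2 Poisson_kernel_nonneg)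

lemma prob_space_Poisson_measure:
  assumes z: "cmod z < 1"
  shows "prob_space (Poisson_measure z)"
proof
  have "emeasure (Poisson_measure z) (space (Poisson_measure z)) = (\<integral>\<^sup>+\<xi>. ennreal (Poisson_kernel z \<xi>) * indicator unit_circle \<xi> \<partial>circle_measure)"
    unfolding Poisson_measure_def using measurable_Poisson_kernel[OF z] sets.top[of circle_measure]
    by (subst emeasure_density) auto
  also have "\<dots> = (\<integral>\<^sup>+\<xi>. ennreal (Poisson_kernel z \<xi>) \<partial>circle_measure)"
    by (intro nn_integral_cong) auto
  also have "\<dots> = ennreal (LINT \<xi>|circle_measure. Poisson_kernel z \<xi>)"
    by (intro nn_integral_eq_integral circle_integrable_continuous continuous_on_Poisson_kernel z AE_I2 Poisson_kernel_nonneg)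
  finally show "emeasure (Poisson_measure z) (space (Poisson_measure z)) = 1"
    by (simp add: Poisson_kernel_integral z)
qed

lemma AE_Poisson_measure_iff:
  assumes z: "cmod z < 1"
  shows "(AE \<xi> in Poisson_measure z. P \<xi>) \<longleftrightarrow> (AE \<xi> in circle_measure. P \<xi>)"
proof -
  have "(AE \<xi> in circle_measure. 0 < ennreal (Poisson_kernel z \<xi>) \<longrightarrow> P \<xi>) \<longleftrightarrow> (AE \<xi> in circle_measure. P \<xi>)"
    by (rule AE_cong) (simp add: Poisson_kernel_pos z)
  then show ?thesis
    unfolding Poisson_measure_def using measurable_Poisson_kernel[OF z] by (subst AE_density) auto
qed

lemma moments_Poisson_measure:
  assumes z: "cmod z < 1"
  shows "(LINT \<xi>|Poisson_measure z. \<xi> ^ k) = z ^ k"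
proof -
  have "(\<lambda>\<xi>. \<xi> ^ k) \<in> borel_measurable circle_measure"
    by (intro borel_measurable_circle_continuous continuous_intros)
  then have "(LINT \<xi>|Poisson_measure z. \<xi> ^ k) = (LINT \<xi>|circle_measure. Poisson_kernel z \<xi> *\<^sub>R \<xi> ^ k)"
    by (rule integral_Poisson_measure[OF z])
  also have "\<dots> = z ^ k" by (intro Poisson_formula z continuous_intros holomorphic_intros)
  finally show ?thesis .
qed

text \<open>This symmetry lets Fubini's theorem exchange the point that determines the kernel with
  the variable of integration.\<close>

lemma Poisson_kernel_dilate_commute:
  assumes "cmod \<xi> = 1" "cmod \<eta> = 1"
  shows "Poisson_kernel (of_real r * \<xi>) \<eta> = Poisson_kernel (of_real r * \<eta>) \<xi>"
proof -
  have x: "\<xi> * cnj \<xi> = 1" "\<eta> * cnj \<eta> = 1" using assms by (simp_all add: complex_norm_square[symmetric])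
  have "cmod (\<eta> - of_real r * \<xi>) = cmod (\<xi> * cnj (\<eta> - of_real r * \<xi>))"
    by (simp add: norm_mult assms del: complex_cnj_diff)
  also have "\<xi> * cnj (\<eta> - of_real r * \<xi>) = cnj \<eta> * (\<xi> - of_real r * \<eta>)"
  proof -
    have "\<xi> * cnj (\<eta> - of_real r * \<xi>) = \<xi> * cnj \<eta> - of_real r * (\<xi> * cnj \<xi>)" by (simp add: algebra_simps)
    also have "\<dots> = \<xi> * cnj \<eta> - of_real r * (\<eta> * cnj \<eta>)" by (simp only: x)
    finally show ?thesis by (simp add: algebra_simps)
  qed
  also have "cmod \<dots> = cmod (\<xi> - of_real r * \<eta>)" by (simp only: norm_mult complex_mod_cnj assms mult_1_left)
  finally show ?thesis by (simp add: Poisson_kernel_def norm_mult assms)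
qed

text \<open>Integrating the Poisson integral of \<open>v\<close> over a circle of smaller radius
  against \<open>\<eta> ^ k\<close> gives, by Fubini, a multiple of the \<open>k\<close>-th moment
  of \<open>v\<close>, so all moments vanish. Adding the constant \<open>K\<close> turns
  \<open>v\<close> into a density, and the uniqueness of measures with given moments
  applies.\<close>

lemma Poisson_integral_real_eq_0_AE:
  fixes v :: "complex \<Rightarrow> real"
  assumes v: "v \<in> borel_measurable circle_measure" and K: "\<And>\<xi>. cmod \<xi> = 1 \<Longrightarrow> \<bar>v \<xi>\<bar> \<le> K"
    and zero: "\<And>z. cmod z < 1 \<Longrightarrow> (LINT \<xi>|circle_measure. Poisson_kernel z \<xi> * v \<xi>) = 0"
  shows "AE \<xi> in circle_measure. v \<xi> = 0"
proof -
  note [measurable] = v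
  have K0: "K \<ge> 0" using K[of 1] by simp
  have id [measurable]: "(\<lambda>\<xi>. \<xi>) \<in> borel_measurable circle_measure"
    by (intro borel_measurable_circle_continuous continuous_intros)
  interpret P: pair_prob_space circle_measure circle_measure ..
  have mom: "(LINT \<xi>|circle_measure. of_real (v \<xi>) * \<xi> ^ k) = 0" for k
  proof -
    \<comment> \<open>Any fixed radius between 0 and 1 will do: the \<open>k\<close>-th moment
      appears with the nonzero factor \<open>r ^ k\<close>. For \<open>1/2\<close> the kernel is
      bounded by \<open>(1 + r) / (1 - r) = 3\<close>.\<close>
    define r :: real where "r = 1 / 2"
    have r: "cmod (of_real r * \<xi>) < 1" if "cmod \<xi> = 1" for \<xi> using that by (simp add: r_def norm_mult)
    have kb: "Poisson_kernel (of_real r * \<xi>) \<eta> \<le> 3" "0 \<le> Poisson_kernel (of_real r * \<xi>) \<eta>"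
      if "cmod \<xi> = 1" "cmod \<eta> = 1" for \<xi> \<eta>
      using Poisson_kernel_bounds(1)[OF r[OF that(1)] that(2)] Poisson_kernel_nonneg[OF r[OF that(1)], of \<eta>] that
      by (simp_all add: r_def norm_mult)
    define f where "f = (\<lambda>\<xi> \<eta>. complex_of_real (v \<xi>) * (complex_of_real (Poisson_kernel (of_real r * \<xi>) \<eta>) * \<eta> ^ k))"
    have fm: "case_prod f \<in> borel_measurable (circle_measure \<Otimes>\<^sub>M circle_measure)"
      unfolding f_def Poisson_kernel_def by measurable
    have "finite_measure (circle_measure \<Otimes>\<^sub>M circle_measure)"
      by unfold_locales
    then have "integrable (circle_measure \<Otimes>\<^sub>M circle_measure) (case_prod f)"
    proof (rule finite_measure.integrable_const_bound[where B = "K * 3"])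
      show "AE x in circle_measure \<Otimes>\<^sub>M circle_measure. norm (case_prod f x) \<le> K * 3"
      proof (rule AE_I2)
        fix x assume "x \<in> space (circle_measure \<Otimes>\<^sub>M circle_measure)"
        then obtain \<xi> \<eta> where x: "x = (\<xi>, \<eta>)" "cmod \<xi> = 1" "cmod \<eta> = 1" by (auto simp: space_pair_measure)
        have "\<bar>v \<xi>\<bar> * Poisson_kernel (of_real r * \<xi>) \<eta> \<le> K * 3"
          using kb[OF x(2,3)] K[OF x(2)] K0 by (intro mult_mono) auto
        then show "norm (case_prod f x) \<le> K * 3"
          using kb[OF x(2,3)] by (simp add: x(1) f_def norm_mult norm_power x(2,3))
      qed
    qed (rule fm)
    from P.Fubini_integral[OF this]
    have "(LINT \<eta>|circle_measure. LINT \<xi>|circle_measure. f \<xi> \<eta>) = (LINT \<xi>|circle_measure. LINT \<eta>|circle_measure. f \<xi> \<eta>)" .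
    moreover have "(LINT \<eta>|circle_measure. f \<xi> \<eta>) = of_real r ^ k * (of_real (v \<xi>) * \<xi> ^ k)" if \<xi>: "cmod \<xi> = 1" for \<xi>
    proof -
      have "(LINT \<eta>|circle_measure. f \<xi> \<eta>) = of_real (v \<xi>) * (LINT \<eta>|circle_measure. Poisson_kernel (of_real r * \<xi>) \<eta> *\<^sub>R \<eta> ^ k)"
        unfolding f_def by (simp add: scaleR_conv_of_real)
      also have "(LINT \<eta>|circle_measure. Poisson_kernel (of_real r * \<xi>) \<eta> *\<^sub>R \<eta> ^ k) = (of_real r * \<xi>) ^ k"
        by (intro Poisson_formula r \<xi> continuous_intros holomorphic_intros)
      finally show ?thesis by (simp add: power_mult_distrib mult_ac)
    qed
    then have "(LINT \<xi>|circle_measure. LINT \<eta>|circle_measure. f \<xi> \<eta>) = (LINT \<xi>|circle_measure. of_real r ^ k * (of_real (v \<xi>) * \<xi> ^ k))"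
      by (intro Bochner_Integration.integral_cong) auto
    moreover have "(LINT \<xi>|circle_measure. f \<xi> \<eta>) = 0" if \<eta>: "cmod \<eta> = 1" for \<eta>
    proof -
      have "(LINT \<xi>|circle_measure. f \<xi> \<eta>) = (LINT \<xi>|circle_measure. of_real (Poisson_kernel (of_real r * \<eta>) \<xi> * v \<xi>) * \<eta> ^ k)"
        unfolding f_def
      proof (rule Bochner_Integration.integral_cong[OF refl])
        fix \<xi> assume "\<xi> \<in> space circle_measure"
        then have "Poisson_kernel (of_real r * \<xi>) \<eta> = Poisson_kernel (of_real r * \<eta>) \<xi>"
          using \<eta> by (intro Poisson_kernel_dilate_commute) auto
        then show "of_real (v \<xi>) * (of_real (Poisson_kernel (of_real r * \<xi>) \<eta>) * \<eta> ^ k) =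
            of_real (Poisson_kernel (of_real r * \<eta>) \<xi> * v \<xi>) * \<eta> ^ k"
          by (simp only: of_real_mult mult_ac)
      qed
      also have "\<dots> = of_real (LINT \<xi>|circle_measure. Poisson_kernel (of_real r * \<eta>) \<xi> * v \<xi>) * \<eta> ^ k"
        by (simp del: of_real_mult)
      finally show ?thesis by (simp add: zero r \<eta>)
    qed
    then have "(LINT \<eta>|circle_measure. LINT \<xi>|circle_measure. f \<xi> \<eta>) = (LINT \<eta>|circle_measure. 0)"
      by (intro Bochner_Integration.integral_cong) auto
    ultimately show ?thesis by (simp add: r_def)
  qed
  let ?M = "density circle_measure (\<lambda>\<xi>. ennreal (v \<xi> + K))" and ?N = "density circle_measure (\<lambda>\<xi>. ennreal K)"
  have pos: "0 \<le> v \<xi> + K" if "cmod \<xi> = 1" for \<xi> using K[OF that] by linarith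
  have intv: "integrable circle_measure v" using v K by (intro circle_integrable_bounded[of _ K]) auto
  have intvk: "integrable circle_measure (\<lambda>\<xi>. of_real (v \<xi>) * \<xi> ^ k)" for k
  proof (rule circle_integrable_bounded[of _ K])
    fix \<xi> :: complex assume "cmod \<xi> = 1"
    then show "norm (of_real (v \<xi>) * \<xi> ^ k) \<le> K" using K[of \<xi>] by (simp add: norm_mult norm_power)
  qed measurable
  have "?M = ?N"
  proof (rule circle_measures_eq_by_moments)
    have "(\<integral>\<^sup>+\<xi>. ennreal (v \<xi> + K) \<partial>circle_measure) < \<infinity>"
    proof -
      have "(\<integral>\<^sup>+\<xi>. ennreal (v \<xi> + K) \<partial>circle_measure) = ennreal (LINT \<xi>|circle_measure. v \<xi> + K)"
        by (intro nn_integral_eq_integral Bochner_Integration.integrable_add intv AE_I2) (auto intro: pos)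
      then show ?thesis by simp
    qed
    moreover have "emeasure ?M (space ?M) = (\<integral>\<^sup>+\<xi>. ennreal (v \<xi> + K) * indicator (space circle_measure) \<xi> \<partial>circle_measure)"
      by (simp only: space_density) (intro emeasure_density sets.top, measurable)
    moreover have "\<dots> = (\<integral>\<^sup>+\<xi>. ennreal (v \<xi> + K) \<partial>circle_measure)"
      by (intro nn_integral_cong) auto
    ultimately show "finite_measure ?M"
      by (intro finite_measureI) auto
    have "emeasure ?N (space ?N) = ennreal K * emeasure circle_measure (space circle_measure)"
      by (simp only: space_density) (intro emeasure_density_const sets.top)
    also have "\<dots> = ennreal K" by (simp only: circle.emeasure_space_1 mult_1_right)
    finally show "finite_measure ?N"
      by (intro finite_measureI) auto
    fix k
    have km: "(\<lambda>\<xi>. \<xi> ^ k) \<in> borel_measurable circle_measure" by measurable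
    have kK: "integrable circle_measure (\<lambda>\<xi>. of_real K * \<xi> ^ k :: complex)"
      by (intro circle_integrable_continuous continuous_intros)
    have "(LINT \<xi>|?M. \<xi> ^ k) = (LINT \<xi>|circle_measure. (v \<xi> + K) *\<^sub>R \<xi> ^ k)"
      by (intro integral_density km AE_I2) (auto intro: pos)
    also have "\<dots> = (LINT \<xi>|circle_measure. of_real (v \<xi>) * \<xi> ^ k + of_real K * \<xi> ^ k)"
      by (intro Bochner_Integration.integral_cong) (auto simp: scaleR_conv_of_real algebra_simps)
    also have "\<dots> = (LINT \<xi>|circle_measure. of_real K * \<xi> ^ k)"
      by (subst Bochner_Integration.integral_add[OF intvk kK]) (simp add: mom)
    also have "\<dots> = (LINT \<xi>|?N. \<xi> ^ k)"
      by (subst integral_density) (use K0 in \<open>auto simp: scaleR_conv_of_real\<close>)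
    finally show "(LINT \<xi>|?M. \<xi> ^ k) = (LINT \<xi>|?N. \<xi> ^ k)" .
  qed auto
  then have "AE \<xi> in circle_measure. ennreal (v \<xi> + K) = ennreal K"
    by (intro circle.density_unique) auto
  then have "AE \<xi> in circle_measure. \<xi> \<in> unit_circle \<longrightarrow> v \<xi> = 0"
    by eventually_elim (use K0 pos in auto)
  then show ?thesis by (auto simp: AE_space eventually_mono elim!: AE_mp)
qed

lemma Poisson_integral_eq_AE:
  fixes u v :: "complex \<Rightarrow> complex"
  assumes [measurable]: "u \<in> borel_measurable circle_measure" "v \<in> borel_measurable circle_measure"
    and K: "AE \<xi> in circle_measure. cmod (u \<xi>) \<le> K \<and> cmod (v \<xi>) \<le> K"
    and eq: "\<And>z. cmod z < 1 \<Longrightarrow>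
      (LINT \<xi>|circle_measure. Poisson_kernel z \<xi> *\<^sub>R u \<xi>) = (LINT \<xi>|circle_measure. Poisson_kernel z \<xi> *\<^sub>R v \<xi>)"
  shows "AE \<xi> in circle_measure. u \<xi> = v \<xi>"
proof -
  \<comment> \<open>Setting the difference to 0 on the exceptional null set makes it bounded
    everywhere on the circle, as the real-valued version requires.\<close>
  define w where "w \<xi> = (if cmod (u \<xi>) \<le> K \<and> cmod (v \<xi>) \<le> K then u \<xi> - v \<xi> else 0)" for \<xi>
  have wm [measurable]: "w \<in> borel_measurable circle_measure" unfolding w_def by measurable
  have ww: "AE \<xi> in circle_measure. w \<xi> = u \<xi> - v \<xi>" using K by eventually_elim (simp add: w_def)
  have wK: "cmod (w \<xi>) \<le> 2 * \<bar>K\<bar>" for \<xi>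
    unfolding w_def using norm_triangle_ineq4[of "u \<xi>" "v \<xi>"] by auto
  have zero: "(LINT \<xi>|circle_measure. Poisson_kernel z \<xi> *\<^sub>R w \<xi>) = 0" if z: "cmod z < 1" for z
  proof -
    note [measurable] = measurable_Poisson_kernel[OF z]
    have int: "integrable circle_measure (\<lambda>\<xi>. Poisson_kernel z \<xi> *\<^sub>R f \<xi>)"
      if [measurable]: "f \<in> borel_measurable circle_measure" and "AE \<xi> in circle_measure. cmod (f \<xi>) \<le> K" for f :: "complex \<Rightarrow> complex"
    proof (rule circle.integrable_const_bound[where B = "(1 + cmod z) / (1 - cmod z) * K"])
      have "AE \<xi> in circle_measure. \<xi> \<in> unit_circle" using AE_space[of circle_measure] by simp
      then show "AE \<xi> in circle_measure. norm (Poisson_kernel z \<xi> *\<^sub>R f \<xi>) \<le> (1 + cmod z) / (1 - cmod z) * K"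
        using that(2)
      proof eventually_elim
        case (elim \<xi>)
        then have "Poisson_kernel z \<xi> * cmod (f \<xi>) \<le> (1 + cmod z) / (1 - cmod z) * K"
          using Poisson_kernel_bounds(1)[OF z, of \<xi>] z by (intro mult_mono) auto
        then show ?case using Poisson_kernel_nonneg[OF z, of \<xi>] by simp
      qed
    qed measurable
    have "(LINT \<xi>|circle_measure. Poisson_kernel z \<xi> *\<^sub>R w \<xi>) = (LINT \<xi>|circle_measure. Poisson_kernel z \<xi> *\<^sub>R u \<xi> - Poisson_kernel z \<xi> *\<^sub>R v \<xi>)"
      using ww by (intro integral_cong_AE) (auto simp: scaleR_diff_right elim!: eventually_mono)
    also have "\<dots> = 0"
      using K by (subst Bochner_Integration.integral_diff) (auto intro!: int simp: eq[OF z] elim!: eventually_mono)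
    finally show ?thesis .
  qed
  have wint: "integrable circle_measure (\<lambda>\<xi>. Poisson_kernel z \<xi> *\<^sub>R w \<xi>)" if z: "cmod z < 1" for z
  proof (rule circle_integrable_bounded[of _ "(1 + cmod z) / (1 - cmod z) * (2 * \<bar>K\<bar>)"])
    show "(\<lambda>\<xi>. Poisson_kernel z \<xi> *\<^sub>R w \<xi>) \<in> borel_measurable circle_measure"
      using measurable_Poisson_kernel[OF z] by measurable
    show "norm (Poisson_kernel z \<xi> *\<^sub>R w \<xi>) \<le> (1 + cmod z) / (1 - cmod z) * (2 * \<bar>K\<bar>)" if "cmod \<xi> = 1" for \<xi>
    proof -
      have "Poisson_kernel z \<xi> * cmod (w \<xi>) \<le> (1 + cmod z) / (1 - cmod z) * (2 * \<bar>K\<bar>)"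
        using Poisson_kernel_bounds(1)[OF z that] z wK[of \<xi>] by (intro mult_mono) auto
      then show ?thesis using Poisson_kernel_nonneg[OF z, of \<xi>] by simp
    qed
  qed
  have "AE \<xi> in circle_measure. Re (w \<xi>) = 0"
  proof (rule Poisson_integral_real_eq_0_AE)
    show "\<bar>Re (w \<xi>)\<bar> \<le> 2 * \<bar>K\<bar>" for \<xi> using wK[of \<xi>] abs_Re_le_cmod[of "w \<xi>"] by linarith
    show "(LINT \<xi>|circle_measure. Poisson_kernel z \<xi> * Re (w \<xi>)) = 0" if z: "cmod z < 1" for z
      using integral_Re[OF wint[OF z]] zero[OF z] by simp
  qed measurable
  moreover have "AE \<xi> in circle_measure. Im (w \<xi>) = 0"
  proof (rule Poisson_integral_real_eq_0_AE)
    show "\<bar>Im (w \<xi>)\<bar> \<le> 2 * \<bar>K\<bar>" for \<xi> using wK[of \<xi>] abs_Im_le_cmod[of "w \<xi>"] by linarith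
    show "(LINT \<xi>|circle_measure. Poisson_kernel z \<xi> * Im (w \<xi>)) = 0" if z: "cmod z < 1" for z
      using integral_Im[OF wint[OF z]] zero[OF z] by simp
  qed measurable
  ultimately show ?thesis using ww by eventually_elim (simp add: complex_eq_iff)
qed

section \<open>Pseudohyperbolic distance, tanh of half the hyperbolic distance, and Harnack's
  inequality\<close>

definition pseudohyperbolic :: "complex \<Rightarrow> complex \<Rightarrow> real" where
  "pseudohyperbolic z w = cmod ((z - w) / (1 - cnj w * z))"

lemma disc_denominator_nonzero: "cmod w < 1 \<Longrightarrow> cmod z \<le> 1 \<Longrightarrow> 1 - cnj w * z \<noteq> 0"
proof
  assume a: "cmod w < 1" "cmod z \<le> 1" "1 - cnj w * z = 0"
  then have "cmod (cnj w * z) = 1" by (metis eq_iff_diff_eq_0 norm_one)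
  moreover have "cmod (cnj w * z) \<le> cmod w * 1"
    unfolding norm_mult complex_mod_cnj using a by (intro mult_left_mono) auto
  ultimately show False using a by simp
qed

lemma disc_norm_identity:
  "(cmod (1 - cnj w * z))\<^sup>2 - (cmod (z - w))\<^sup>2 = (1 - (cmod z)\<^sup>2) * (1 - (cmod w)\<^sup>2)"
proof -
  have "complex_of_real ((cmod (1 - cnj w * z))\<^sup>2 - (cmod (z - w))\<^sup>2) =
      complex_of_real ((1 - (cmod z)\<^sup>2) * (1 - (cmod w)\<^sup>2))"
    by (simp only: of_real_diff of_real_mult of_real_1 complex_norm_square)
       (simp add: algebra_simps)
  then show ?thesis by (simp only: of_real_eq_iff)
qed

lemma one_minus_pseudohyperbolic_sq:
  assumes "cmod w < 1" "cmod z \<le> 1"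
  shows "1 - (pseudohyperbolic z w)\<^sup>2 = (1 - (cmod z)\<^sup>2) * (1 - (cmod w)\<^sup>2) / (cmod (1 - cnj w * z))\<^sup>2"
  unfolding disc_norm_identity[symmetric] pseudohyperbolic_def
  using disc_denominator_nonzero[OF assms] by (simp only: norm_divide power_divide) (simp add: diff_divide_distrib)

lemma pseudohyperbolic_lt_1:
  assumes "cmod w < 1" "cmod z < 1"
  shows "pseudohyperbolic z w < 1"
proof -
  have "0 < (1 - (cmod z)\<^sup>2) * (1 - (cmod w)\<^sup>2) / (cmod (1 - cnj w * z))\<^sup>2"
    using assms disc_denominator_nonzero[of w z]
    by (intro divide_pos_pos mult_pos_pos) (auto simp: abs_square_less_1)
  then have "(pseudohyperbolic z w)\<^sup>2 < 1"
    using one_minus_pseudohyperbolic_sq[of w z] assms by simp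
  then show ?thesis by (simp add: abs_square_less_1 pseudohyperbolic_def)
qed

lemma pseudohyperbolic_nonneg: "0 \<le> pseudohyperbolic z w"
  by (simp add: pseudohyperbolic_def)

text \<open>The disc automorphism that sends \<open>w\<close> to 0 sends \<open>z\<close> to
  \<open>a\<close> and \<open>\<xi>\<close> to \<open>\<eta>\<close>, and the kernel at
  \<open>z\<close> is the product of the kernels at \<open>a\<close> and at \<open>w\<close>. The
  elementary bound applies to the first factor, where \<open>|a|\<close> is the pseudohyperbolic
  distance. The constant tends to 1 as the distance tends to 0.\<close>

lemma Poisson_kernel_Harnack:
  assumes z: "cmod z < 1" and w: "cmod w < 1" and \<xi>: "cmod \<xi> = 1"
  shows "Poisson_kernel z \<xi> \<le> (1 + pseudohyperbolic z w) / (1 - pseudohyperbolic z w) * Poisson_kernel w \<xi>"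
proof -
  define a where "a = (z - w) / (1 - cnj w * z)"
  define \<eta> where "\<eta> = (\<xi> - w) / (1 - cnj w * \<xi>)"
  have n: "1 - cnj w * z \<noteq> 0" "1 - cnj w * \<xi> \<noteq> 0"
    using disc_denominator_nonzero w z \<xi> by auto
  have a: "cmod a = pseudohyperbolic z w" by (simp add: a_def pseudohyperbolic_def)
  have a1: "cmod a < 1" using pseudohyperbolic_lt_1[OF w z] a by simp
  have "1 - (cmod \<eta>)\<^sup>2 = 0"
    using one_minus_pseudohyperbolic_sq[of w \<xi>] w \<xi> by (simp add: \<eta>_def pseudohyperbolic_def)
  then have \<eta>: "cmod \<eta> = 1" by (simp add: power2_eq_1_iff) (use norm_ge_zero[of \<eta>] in linarith)
  have nx: "cmod (1 - cnj w * \<xi>) = cmod (\<xi> - w)"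
    using \<eta> n by (simp add: \<eta>_def norm_divide field_simps)
  have "\<eta> - a = (\<xi> - z) * (1 - w * cnj w) / ((1 - cnj w * \<xi>) * (1 - cnj w * z))"
    unfolding \<eta>_def a_def using n by (simp add: divide_simps) (simp add: algebra_simps)
  also have "1 - w * cnj w = of_real (1 - (cmod w)\<^sup>2)" by (simp add: complex_norm_square[symmetric])
  finally have "cmod (\<eta> - a) = cmod (\<xi> - z) * cmod (of_real (1 - (cmod w)\<^sup>2)) / (cmod (1 - cnj w * \<xi>) * cmod (1 - cnj w * z))"
    by (simp only: norm_mult norm_divide)
  then have ea: "(cmod (\<eta> - a))\<^sup>2 = (cmod (\<xi> - z))\<^sup>2 * (1 - (cmod w)\<^sup>2)\<^sup>2 / ((cmod (\<xi> - w))\<^sup>2 * (cmod (1 - cnj w * z))\<^sup>2)"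
    unfolding nx norm_of_real by (simp only: power_mult_distrib power_divide power2_abs)
  have w2: "0 < 1 - (cmod w)\<^sup>2" using w by (simp add: abs_square_less_1)
  have xn: "cmod (\<xi> - z) \<noteq> 0" "cmod (\<xi> - w) \<noteq> 0" using z w \<xi> by auto
  have "Poisson_kernel a \<eta> * Poisson_kernel w \<xi> =
    ((1 - (cmod z)\<^sup>2) * (1 - (cmod w)\<^sup>2) / (cmod (1 - cnj w * z))\<^sup>2) / (cmod (\<eta> - a))\<^sup>2 * ((1 - (cmod w)\<^sup>2) / (cmod (\<xi> - w))\<^sup>2)"
    unfolding Poisson_kernel_def a by (subst one_minus_pseudohyperbolic_sq) (use w z in auto)
  also have "\<dots> = Poisson_kernel z \<xi>"
    unfolding ea Poisson_kernel_def using w2 xn n by (simp add: divide_simps power2_eq_square)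
  finally have "Poisson_kernel z \<xi> = Poisson_kernel a \<eta> * Poisson_kernel w \<xi>" by simp
  also have "\<dots> \<le> (1 + cmod a) / (1 - cmod a) * Poisson_kernel w \<xi>"
    by (intro mult_right_mono Poisson_kernel_bounds a1 \<eta> Poisson_kernel_nonneg w)
  finally show ?thesis by (simp add: a)
qed

lemma Poisson_measure_emeasure:
  assumes z: "cmod z < 1" and B: "B \<in> sets circle_measure"
  shows "measure (Poisson_measure z) B = (LINT \<xi>|circle_measure. Poisson_kernel z \<xi> * indicator B \<xi>)"
proof -
  interpret Pz: prob_space "Poisson_measure z" by (rule prob_space_Poisson_measure[OF z])
  have "B \<subseteq> unit_circle" using sets.sets_into_space[OF B] by simp
  then have "measure (Poisson_measure z) B = (LINT \<xi>|Poisson_measure z. indicator B \<xi>)"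
    using B by (simp add: Int_absorb2)
  also have "\<dots> = (LINT \<xi>|circle_measure. Poisson_kernel z \<xi> *\<^sub>R indicator B \<xi>)"
    by (rule integral_Poisson_measure[OF z]) (use B in measurable)
  finally show ?thesis by simp
qed

lemma Poisson_integrable_indicator:
  assumes z: "cmod z < 1" and B: "B \<in> sets circle_measure"
  shows "integrable circle_measure (\<lambda>\<xi>. Poisson_kernel z \<xi> * indicator B \<xi>)"
  using circle_integrable_continuous[OF continuous_on_Poisson_kernel[OF z]] B
  by (rule integrable_real_mult_indicator[rotated])

lemma Poisson_measure_Harnack:
  assumes z: "cmod z < 1" and w: "cmod w < 1" and B: "B \<in> sets circle_measure"
  shows "measure (Poisson_measure z) B \<le>
    (1 + pseudohyperbolic z w) / (1 - pseudohyperbolic z w) * measure (Poisson_measure w) B"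
proof -
  have "measure (Poisson_measure z) B \<le> (LINT \<xi>|circle_measure.
      (1 + pseudohyperbolic z w) / (1 - pseudohyperbolic z w) * (Poisson_kernel w \<xi> * indicator B \<xi>))"
    unfolding Poisson_measure_emeasure[OF z B]
  proof (intro integral_mono Poisson_integrable_indicator z B)
    show "integrable circle_measure (\<lambda>\<xi>. (1 + pseudohyperbolic z w) / (1 - pseudohyperbolic z w) * (Poisson_kernel w \<xi> * indicator B \<xi>))"
      by (intro integrable_mult_right Poisson_integrable_indicator w B)
  qed (use Poisson_kernel_Harnack[OF z w] in \<open>auto simp: indicator_def\<close>)
  also have "\<dots> = (1 + pseudohyperbolic z w) / (1 - pseudohyperbolic z w) * measure (Poisson_measure w) B"
    unfolding Poisson_measure_emeasure[OF w B] by (rule integral_mult_right_zero)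
  finally show ?thesis .
qed

text \<open>The lower bound for the kernel with \<open>1 + |z|\<close> replaced by 2. Through it the
  measures of preimages under iterates of the boundary map dominate the terms
  \<open>1 - |g^n 0|\<close>.\<close>

lemma Poisson_measure_lower:
  assumes z: "cmod z < 1" and B: "B \<in> sets circle_measure"
  shows "(1 - cmod z) / 2 * measure circle_measure B \<le> measure (Poisson_measure z) B"
proof -
  have "B \<subseteq> unit_circle" using sets.sets_into_space[OF B] by simp
  then have "(1 - cmod z) / 2 * measure circle_measure B = (LINT \<xi>|circle_measure. (1 - cmod z) / 2 * indicator B \<xi>)"
    using B by (simp add: Int_absorb2)
  also have "\<dots> \<le> measure (Poisson_measure z) B"
    unfolding Poisson_measure_emeasure[OF z B]
  proof (intro integral_mono Poisson_integrable_indicator z B)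
    show "integrable circle_measure (\<lambda>\<xi>. (1 - cmod z) / 2 * indicator B \<xi>)"
      using B by (intro integrable_mult_right integrable_real_indicator) (simp_all add: circle.emeasure_eq_measure)
  next
    fix \<xi> assume "\<xi> \<in> space circle_measure"
    then have "(1 - cmod z) / (1 + cmod z) \<le> Poisson_kernel z \<xi>"
      using Poisson_kernel_bounds(2)[OF z] by simp
    moreover have "(1 - cmod z) / 2 \<le> (1 - cmod z) / (1 + cmod z)"
      using z by (intro divide_left_mono) (auto simp: add_pos_nonneg)
    ultimately have "(1 - cmod z) / 2 \<le> Poisson_kernel z \<xi>" by (rule order_trans[rotated])
    then show "(1 - cmod z) / 2 * indicator B \<xi> \<le> Poisson_kernel z \<xi> * indicator B \<xi>"
      by (rule mult_right_mono) auto
  qed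
  finally show ?thesis .
qed

section \<open>Boundary maps of inner functions\<close>

text \<open>\<open>G\<close> maps all of the circle to itself, so that its iterates are defined at
  every point; it agrees with the radial limits of \<open>g\<close> up to a null set. This makes
  \<open>g\<close> inner.\<close>

locale inner_boundary_map =
  fixes g :: "complex \<Rightarrow> complex" and G :: "complex \<Rightarrow> complex"
  assumes holo: "g holomorphic_on unit_disc"
    and disc: "\<And>z. cmod z < 1 \<Longrightarrow> cmod (g z) < 1"
    and G_measurable [measurable]: "G \<in> circle_measure \<rightarrow>\<^sub>M circle_measure"
    and G_limit: "AE \<zeta> in circle_measure. ((\<lambda>r. g (of_real r * \<zeta>)) \<longlongrightarrow> G \<zeta>) (at_left 1)"
begin

lemma G_unit: "cmod \<zeta> = 1 \<Longrightarrow> cmod (G \<zeta>) = 1"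
  using measurable_space[OF G_measurable, of \<zeta>] by simp

lemma funpow_disc: "cmod z < 1 \<Longrightarrow> cmod ((g ^^ n) z) < 1"
  by (induction n) (simp_all add: disc)

lemma G_borel: "G \<in> borel_measurable circle_measure"
proof -
  have "(\<lambda>\<xi>. \<xi>) \<in> borel_measurable circle_measure"
    by (intro borel_measurable_circle_continuous continuous_intros)
  from measurable_compose[OF G_measurable this] show ?thesis .
qed

lemma funpow_G_measurable [measurable]: "(G ^^ n) \<in> circle_measure \<rightarrow>\<^sub>M circle_measure"
  by (induction n) (simp_all add: measurable_comp[OF _ G_measurable])

text \<open>The \<open>k\<close>-th moment of the image measure is the Poisson integral at
  \<open>z\<close> of the boundary values of the \<open>k\<close>-th power of \<open>g\<close>, that
  is \<open>g z ^ k\<close>, and this is also the \<open>k\<close>-th moment of the Poisson measure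
  at \<open>g z\<close>.\<close>

lemma distr_Poisson_measure:
  assumes z: "cmod z < 1"
  shows "distr (Poisson_measure z) circle_measure G = Poisson_measure (g z)"
proof (rule circle_measures_eq_by_moments)
  interpret Pz: prob_space "Poisson_measure z" by (rule prob_space_Poisson_measure[OF z])
  interpret Pgz: prob_space "Poisson_measure (g z)" by (rule prob_space_Poisson_measure[OF disc[OF z]])
  have Gm: "G \<in> Poisson_measure z \<rightarrow>\<^sub>M circle_measure"
    using G_measurable by (simp cong: measurable_cong_sets)
  have "prob_space (distr (Poisson_measure z) circle_measure G)" by (rule Pz.prob_space_distr[OF Gm])
  then show "finite_measure (distr (Poisson_measure z) circle_measure G)" by (rule prob_space.finite_measure)
  show "finite_measure (Poisson_measure (g z))" by (rule Pgz.finite_measure)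
  fix k
  have km: "(\<lambda>\<xi>. \<xi> ^ k) \<in> borel_measurable circle_measure"
    by (intro borel_measurable_circle_continuous continuous_intros)
  have gk: "(\<lambda>z. g z ^ k) holomorphic_on unit_disc" by (intro holomorphic_intros holo)
  have lk: "cmod (g w ^ k) \<le> 1" if "cmod w < 1" for w
    using disc[OF that] by (simp add: norm_power power_le_one)
  note [measurable] = measurable_Poisson_kernel[OF z] G_borel
    measurable_radial_limit[OF holomorphic_on_imp_continuous_on[OF gk]]
  have Gk: "(\<lambda>\<xi>. G \<xi> ^ k) \<in> borel_measurable circle_measure" by measurable
  have "(LINT \<xi>|distr (Poisson_measure z) circle_measure G. \<xi> ^ k) = (LINT \<xi>|Poisson_measure z. G \<xi> ^ k)"
    by (rule integral_distr[OF Gm km])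
  also have "\<dots> = (LINT \<xi>|circle_measure. Poisson_kernel z \<xi> *\<^sub>R G \<xi> ^ k)"
    by (rule integral_Poisson_measure[OF z Gk])
  also have "\<dots> = (LINT \<xi>|circle_measure. Poisson_kernel z \<xi> *\<^sub>R radial_limit (\<lambda>z. g z ^ k) \<xi>)"
  proof (rule integral_cong_AE)
    show "AE \<xi> in circle_measure. Poisson_kernel z \<xi> *\<^sub>R G \<xi> ^ k = Poisson_kernel z \<xi> *\<^sub>R radial_limit (\<lambda>z. g z ^ k) \<xi>"
      using G_limit
    proof eventually_elim
      case (elim \<xi>)
      have "((\<lambda>r. g (of_real r * \<xi>) ^ k) \<longlongrightarrow> G \<xi> ^ k) (at_left 1)" by (intro tendsto_intros elim)
      from radial_limitI[of "\<lambda>z. g z ^ k", OF this] show ?case by simp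
    qed
  qed measurable
  also have "\<dots> = g z ^ k" by (rule bounded_holomorphic_Poisson[OF gk lk z])
  also have "\<dots> = (LINT \<xi>|Poisson_measure (g z). \<xi> ^ k)" by (rule moments_Poisson_measure[symmetric, OF disc[OF z]])
  finally show "(LINT \<xi>|distr (Poisson_measure z) circle_measure G. \<xi> ^ k) = (LINT \<xi>|Poisson_measure (g z). \<xi> ^ k)" .
qed simp_all

lemma Poisson_measure_vimage:
  assumes z: "cmod z < 1" and B: "B \<in> sets circle_measure"
  shows "measure (Poisson_measure z) (G -` B \<inter> unit_circle) = measure (Poisson_measure (g z)) B"
proof -
  have "measure (distr (Poisson_measure z) circle_measure G) B = measure (Poisson_measure z) (G -` B \<inter> unit_circle)"
    using measure_distr[of G "Poisson_measure z" circle_measure B] G_measurable B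
    by (simp cong: measurable_cong_sets)
  then show ?thesis by (simp add: distr_Poisson_measure[OF z])
qed

lemma Poisson_measure_vimage_funpow:
  assumes z: "cmod z < 1" and B: "B \<in> sets circle_measure"
  shows "measure (Poisson_measure z) ((G ^^ n) -` B \<inter> unit_circle) = measure (Poisson_measure ((g ^^ n) z)) B"
  using z
proof (induction n arbitrary: z)
  case 0
  have "B \<subseteq> unit_circle" using sets.sets_into_space[OF B] by simp
  then show ?case by (simp add: Int_absorb2)
next
  case (Suc n)
  have m: "(G ^^ n) -` B \<inter> unit_circle \<in> sets circle_measure"
    using measurable_sets[OF funpow_G_measurable B] by simp
  have e: "(G ^^ Suc n) -` B \<inter> unit_circle = G -` ((G ^^ n) -` B \<inter> unit_circle) \<inter> unit_circle"
    by (auto simp: funpow_swap1 G_unit)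
  show ?case
    unfolding e Poisson_measure_vimage[OF Suc.prems m] Suc.IH[OF disc[OF Suc.prems]]
    by (simp add: funpow_swap1)
qed

text \<open>The image of normalized Lebesgue measure under \<open>G\<close> is the Poisson measure
  at \<open>g 0\<close>, which has the same null sets. So statements valid almost everywhere may be
  pulled back along the boundary map.\<close>

lemma AE_compose_G:
  assumes "AE \<xi> in circle_measure. P \<xi>"
  shows "AE \<xi> in circle_measure. P (G \<xi>)"
proof -
  have "AE \<xi> in distr (Poisson_measure 0) circle_measure G. P \<xi>"
    unfolding distr_Poisson_measure[of 0, simplified] using assms
    by (subst AE_Poisson_measure_iff) (simp_all add: disc)
  then have "AE \<xi> in Poisson_measure 0. P (G \<xi>)"
    by (rule AE_distrD[rotated]) (use G_measurable in \<open>simp cong: measurable_cong_sets\<close>)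
  then show ?thesis by (simp only: Poisson_measure_0)
qed

lemma AE_funpow_G:
  assumes "AE \<xi> in circle_measure. P \<xi>"
  shows "AE \<xi> in circle_measure. \<forall>n. P ((G ^^ n) \<xi>)"
proof -
  have "AE \<xi> in circle_measure. P ((G ^^ n) \<xi>)" for n
  proof (induction n)
    case (Suc n)
    from AE_compose_G[OF this] show ?case by (simp add: funpow_Suc_right del: funpow.simps)
  qed (simp add: assms)
  then show ?thesis by (simp add: AE_all_countable)
qed

text \<open>On the left the limit of \<open>m\<close> is taken along the image of a radius, on the
  right along the radius to \<open>G \<xi>\<close>. Instead of comparing the two paths, the proof
  shows that both boundary functions have the Poisson integral \<open>m (g z)\<close>.\<close>

lemma radial_limit_compose:
  assumes m: "m holomorphic_on unit_disc" and M: "\<And>z. cmod z < 1 \<Longrightarrow> cmod (m z) \<le> M"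
  shows "AE \<xi> in circle_measure. radial_limit (\<lambda>z. m (g z)) \<xi> = radial_limit m (G \<xi>)"
proof (rule Poisson_integral_eq_AE)
  have mg: "(\<lambda>z. m (g z)) holomorphic_on unit_disc"
  proof -
    have "g ` unit_disc \<subseteq> unit_disc" using disc by auto
    from holomorphic_on_compose_gen[OF holo m this] show ?thesis by (simp add: o_def)
  qed
  have Mg: "cmod (m (g z)) \<le> M" if "cmod z < 1" for z by (intro M disc that)
  have rm: "radial_limit m \<in> borel_measurable circle_measure"
    by (intro measurable_radial_limit holomorphic_on_imp_continuous_on m)
  show "radial_limit (\<lambda>z. m (g z)) \<in> borel_measurable circle_measure"
    by (intro measurable_radial_limit holomorphic_on_imp_continuous_on mg)
  show Gm: "(\<lambda>\<xi>. radial_limit m (G \<xi>)) \<in> borel_measurable circle_measure"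
    using measurable_compose[OF G_measurable rm] .
  have lim: "AE \<xi> in circle_measure. ((\<lambda>r. m (of_real r * \<xi>)) \<longlongrightarrow> radial_limit m \<xi>) (at_left 1)"
    by (rule Fatou_radial_limits[OF m]) (rule M)
  have lim2: "AE \<xi> in circle_measure. ((\<lambda>r. m (g (of_real r * \<xi>))) \<longlongrightarrow> radial_limit (\<lambda>z. m (g z)) \<xi>) (at_left 1)"
    by (rule Fatou_radial_limits[OF mg]) (rule Mg)
  have sp: "AE \<xi> in circle_measure. cmod \<xi> = 1" using AE_space[of circle_measure] by simp
  show "AE \<xi> in circle_measure. cmod (radial_limit (\<lambda>z. m (g z)) \<xi>) \<le> M \<and> cmod (radial_limit m (G \<xi>)) \<le> M"
    using AE_compose_G[OF lim] lim2 sp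
  proof eventually_elim
    case (elim \<xi>)
    have "cmod (radial_limit (\<lambda>z. m (g z)) \<xi>) \<le> M"
      by (rule radial_limit_norm_le[of "\<lambda>z. m (g z)", OF elim(2,3)]) (rule Mg)
    moreover have "cmod (radial_limit m (G \<xi>)) \<le> M"
      by (rule radial_limit_norm_le[OF elim(1) G_unit[OF elim(3)]]) (rule M)
    ultimately show ?case ..
  qed
  fix z :: complex assume z: "cmod z < 1"
  have "(LINT \<xi>|circle_measure. Poisson_kernel z \<xi> *\<^sub>R radial_limit m (G \<xi>)) = (LINT \<xi>|Poisson_measure z. radial_limit m (G \<xi>))"
    by (rule integral_Poisson_measure[symmetric, OF z Gm])
  also have "\<dots> = (LINT \<xi>|distr (Poisson_measure z) circle_measure G. radial_limit m \<xi>)"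
    using G_measurable by (intro integral_distr[symmetric] rm) (simp cong: measurable_cong_sets)
  also have "\<dots> = (LINT \<xi>|circle_measure. Poisson_kernel (g z) \<xi> *\<^sub>R radial_limit m \<xi>)"
    by (simp only: distr_Poisson_measure[OF z] integral_Poisson_measure[OF disc[OF z] rm])
  also have "\<dots> = m (g z)" by (rule bounded_holomorphic_Poisson[OF m M disc[OF z]])
  also have "\<dots> = (LINT \<xi>|circle_measure. Poisson_kernel z \<xi> *\<^sub>R radial_limit (\<lambda>z. m (g z)) \<xi>)"
    by (rule bounded_holomorphic_Poisson[symmetric, OF mg Mg z])
  finally show "(LINT \<xi>|circle_measure. Poisson_kernel z \<xi> *\<^sub>R radial_limit (\<lambda>z. m (g z)) \<xi>) =
      (LINT \<xi>|circle_measure. Poisson_kernel z \<xi> *\<^sub>R radial_limit m (G \<xi>))" by simp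
qed

text \<open>
  The set \<open>B\<close> of points that never visit \<open>E\<close> is forward invariant. Divergence of
  \<open>\<Sum> 1 - \<bar>g\<^sup>n 0\<bar>\<close> rules out that it is wandering, so that its Poisson integral is invariant under
  \<open>g\<close>; as \<open>g\<close> contracts the hyperbolic distance to zero, Harnack's inequality makes it constant.
\<close>

theorem AE_orbit_visits:
  assumes div: "\<not> summable (\<lambda>n. 1 - cmod ((g ^^ n) 0))"
    and contr: "\<And>z w. cmod z < 1 \<Longrightarrow> cmod w < 1 \<Longrightarrow>
      (\<lambda>n. pseudohyperbolic ((g ^^ n) z) ((g ^^ n) w)) \<longlonglongrightarrow> 0"
    and E: "E \<in> sets circle_measure" "measure circle_measure E > 0"
  shows "AE \<xi> in circle_measure. \<exists>n. (G ^^ n) \<xi> \<in> E"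
proof -
  define B where "B = {\<xi> \<in> unit_circle. \<forall>n. (G ^^ n) \<xi> \<notin> E}"
  have Bsub: "B \<subseteq> unit_circle" by (auto simp: B_def)
  have "B = unit_circle - (\<Union>n. (G ^^ n) -` E \<inter> unit_circle)" by (auto simp: B_def)
  moreover have "(G ^^ n) -` E \<inter> unit_circle \<in> sets circle_measure" for n
    using measurable_sets[OF funpow_G_measurable E(1)] by simp
  then have "unit_circle - (\<Union>n. (G ^^ n) -` E \<inter> unit_circle) \<in> sets circle_measure"
    using sets.top[of circle_measure] by (intro sets.Diff sets.countable_UN) auto
  ultimately have B: "B \<in> sets circle_measure" by simp
  have GB: "G \<xi> \<in> B" if "\<xi> \<in> B" for \<xi>
  proof -
    have "(G ^^ n) (G \<xi>) \<notin> E" for n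
    proof -
      have "(G ^^ Suc n) \<xi> \<notin> E" using that unfolding B_def by blast
      then show ?thesis by (simp add: funpow_Suc_right del: funpow.simps)
    qed
    then show ?thesis using that G_unit by (auto simp: B_def)
  qed
  define GB' where "GB' = G -` B \<inter> unit_circle"
  have GB': "GB' \<in> sets circle_measure" using measurable_sets[OF G_measurable B] by (simp add: GB'_def)
  have sub: "B \<subseteq> GB'" using GB Bsub by (auto simp: GB'_def)
  \<comment> \<open>A point of \<open>W\<close> is mapped into the forward invariant set
    \<open>B\<close>, which is disjoint from \<open>W\<close>. So an orbit meets \<open>W\<close> at
    most once, and the preimages \<open>D n\<close> are disjoint.\<close>
  define W where "W = GB' - B"
  have W: "W \<in> sets circle_measure" unfolding W_def by (intro sets.Diff GB' B)
  define D where "D n = (G ^^ n) -` W \<inter> unit_circle" for n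
  have Ds: "D n \<in> sets circle_measure" for n
    using measurable_sets[OF funpow_G_measurable W] by (simp add: D_def)
  have inB: "(G ^^ m) \<xi> \<in> B" if "(G ^^ n) \<xi> \<in> W" "n < m" for n m \<xi>
    using that(2)
  proof (induction m)
    case (Suc m)
    show ?case
    proof (cases "m = n")
      case True
      then show ?thesis using that(1) by (simp add: W_def GB'_def)
    next
      case False
      then show ?thesis using Suc GB by simp
    qed
  qed simp
  have "disjoint_family D"
    unfolding disjoint_family_on_def
  proof (intro ballI impI)
    fix m n :: nat assume "m \<noteq> n"
    have "False" if "(G ^^ n) \<xi> \<in> W" "(G ^^ m) \<xi> \<in> W" for \<xi>
      using inB[OF that(1), of m] inB[OF that(2), of n] that \<open>m \<noteq> n\<close>
      by (cases "n < m") (auto simp: W_def)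
    then show "D m \<inter> D n = {}" by (auto simp: D_def)
  qed
  then have "(\<lambda>n. measure circle_measure (D n)) sums measure circle_measure (\<Union>n. D n)"
    using Ds by (intro circle.finite_measure_UNION) auto
  then have sD: "summable (\<lambda>n. measure circle_measure (D n))" by (rule sums_summable)
  have Dn: "(1 - cmod ((g ^^ n) 0)) / 2 * measure circle_measure W \<le> measure circle_measure (D n)" for n
    using Poisson_measure_lower[OF funpow_disc[of 0 n] W] Poisson_measure_vimage_funpow[of 0 W n] W
    by (simp add: D_def Poisson_measure_0)
  have W0: "measure circle_measure W = 0"
  proof (rule ccontr)
    assume "measure circle_measure W \<noteq> 0"
    then have p: "measure circle_measure W > 0" by (simp add: zero_less_measure_iff)
    have "summable (\<lambda>n. (1 - cmod ((g ^^ n) 0)) / 2 * measure circle_measure W)"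
    proof (rule summable_comparison_test[OF _ sD], intro exI allI impI)
      fix n
      have "0 \<le> 1 - cmod ((g ^^ n) 0)" using funpow_disc[of 0 n] by simp
      then show "norm ((1 - cmod ((g ^^ n) 0)) / 2 * measure circle_measure W) \<le> measure circle_measure (D n)"
        using Dn[of n] by simp
    qed
    then have "summable (\<lambda>n. ((1 - cmod ((g ^^ n) 0)) / 2 * measure circle_measure W) * (2 / measure circle_measure W))"
      by (rule summable_mult2)
    then show False using div p by simp
  qed
  define u where "u z = measure (Poisson_measure z) B" for z
  have ug: "u (g z) = u z" if z: "cmod z < 1" for z
  proof -
    interpret Pz: prob_space "Poisson_measure z" by (rule prob_space_Poisson_measure[OF z])
    have "AE \<xi> in circle_measure. \<xi> \<notin> W"
      using W W0 by (intro AE_not_in) (auto simp: null_sets_def circle.emeasure_eq_measure)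
    then have "AE \<xi> in Poisson_measure z. \<xi> \<notin> W" by (simp add: AE_Poisson_measure_iff z)
    then have "AE \<xi> in Poisson_measure z. \<xi> \<in> GB' \<longleftrightarrow> \<xi> \<in> B"
      by eventually_elim (use sub in \<open>auto simp: W_def\<close>)
    then have "measure (Poisson_measure z) GB' = measure (Poisson_measure z) B"
      using GB' B by (intro Pz.finite_measure_eq_AE) auto
    then show ?thesis using Poisson_measure_vimage[OF z B] by (simp add: u_def GB'_def)
  qed
  have un: "u ((g ^^ n) z) = u z" if "cmod z < 1" for z n
    by (induction n) (simp_all add: ug funpow_disc that)
  have ule: "u z \<le> u w" if z: "cmod z < 1" and w: "cmod w < 1" for z w
  proof (rule tendsto_lowerbound)
    let ?\<rho> = "\<lambda>n. pseudohyperbolic ((g ^^ n) z) ((g ^^ n) w)"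
    have "(\<lambda>n. (1 + ?\<rho> n) / (1 - ?\<rho> n) * u w) \<longlonglongrightarrow> (1 + 0) / (1 - 0) * u w"
      by (intro tendsto_intros contr z w) simp
    then show "(\<lambda>n. (1 + ?\<rho> n) / (1 - ?\<rho> n) * u w) \<longlonglongrightarrow> u w" by simp
    show "\<forall>\<^sub>F n in sequentially. u z \<le> (1 + ?\<rho> n) / (1 - ?\<rho> n) * u w"
    proof (rule always_eventually, rule allI)
      fix n
      show "u z \<le> (1 + ?\<rho> n) / (1 - ?\<rho> n) * u w"
        using Poisson_measure_Harnack[OF funpow_disc[OF z, of n] funpow_disc[OF w, of n] B]
        by (simp only: u_def[symmetric] un[OF z] un[OF w])
    qed
  qed simp
  define c where "c = u 0"
  have uc: "u z = c" if "cmod z < 1" for z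
    using ule[OF that, of 0] ule[of 0, OF _ that] by (simp add: c_def)
  have c: "0 \<le> c" "c \<le> 1" by (simp_all add: c_def u_def Poisson_measure_0 circle.prob_le_1)
  \<comment> \<open>The constant Poisson integral makes the indicator of \<open>B\<close> constant
    almost everywhere, so \<open>B\<close> is null or has full measure. The latter is impossible
    because \<open>B\<close> is disjoint from \<open>E\<close>, which has positive measure.\<close>
  have "AE \<xi> in circle_measure. indicator B \<xi> - c = 0"
  proof (rule Poisson_integral_real_eq_0_AE)
    show "(\<lambda>\<xi>. indicator B \<xi> - c) \<in> borel_measurable circle_measure" using B by measurable
    show "\<bar>indicator B \<xi> - c\<bar> \<le> 1" for \<xi> using c by (auto simp: indicator_def)
    fix z :: complex assume z: "cmod z < 1"
    have "(LINT \<xi>|circle_measure. Poisson_kernel z \<xi> * (indicator B \<xi> - c)) =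
      (LINT \<xi>|circle_measure. Poisson_kernel z \<xi> * indicator B \<xi> - c * Poisson_kernel z \<xi>)"
      by (intro Bochner_Integration.integral_cong) (auto simp: algebra_simps)
    also have "\<dots> = (LINT \<xi>|circle_measure. Poisson_kernel z \<xi> * indicator B \<xi>) - (LINT \<xi>|circle_measure. c * Poisson_kernel z \<xi>)"
      by (intro Bochner_Integration.integral_diff Poisson_integrable_indicator z B integrable_mult_right
        circle_integrable_continuous continuous_on_Poisson_kernel)
    also have "\<dots> = 0"
      using uc[OF z] by (simp add: Poisson_measure_emeasure[OF z B, symmetric] Poisson_kernel_integral[OF z] u_def)
    finally show "(LINT \<xi>|circle_measure. Poisson_kernel z \<xi> * (indicator B \<xi> - c)) = 0" .
  qed
  then have Bc: "AE \<xi> in circle_measure. indicator B \<xi> = c" by eventually_elim simp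
  have "AE \<xi> in circle_measure. \<xi> \<notin> B"
  proof (cases "c = 1")
    case True
    have "AE \<xi> in circle_measure. \<xi> \<notin> E"
      using Bc
    proof eventually_elim
      case (elim \<xi>)
      then have "\<xi> \<in> B" using True by (auto simp: indicator_def split: if_splits)
      then have "(G ^^ 0) \<xi> \<notin> E" unfolding B_def by blast
      then show ?case by simp
    qed
    then have "measure circle_measure E = 0"
      using E(1) by (subst circle.prob_eq_0) auto
    then show ?thesis using E(2) by simp
  next
    case False
    show ?thesis using Bc by eventually_elim (use False in \<open>auto simp: indicator_def split: if_splits\<close>)
  qed
  moreover have "AE \<xi> in circle_measure. \<xi> \<in> unit_circle" using AE_space[of circle_measure] by simp
  ultimately show ?thesis by eventually_elim (auto simp: B_def)
qed

end

section \<open>Contraction of the hyperbolic distance\<close>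

lemma Schwarz_Pick:
  assumes F: "F holomorphic_on unit_disc" and disc: "\<And>z. cmod z < 1 \<Longrightarrow> cmod (F z) < 1"
    and z: "cmod z < 1" and w: "cmod w < 1"
  shows "pseudohyperbolic (F z) (F w) \<le> pseudohyperbolic z w"
proof -
  define h where "h = Moebius_function 0 (F w) \<circ> F \<circ> Moebius_function 0 (-w)"
  have Mn: "cmod (Moebius_function 0 a x) < 1" if "cmod a < 1" "cmod x < 1" for a x
    by (rule Moebius_function_norm_lt_1[OF that])
  have h: "h holomorphic_on unit_disc"
    unfolding h_def
    by (intro holomorphic_on_compose_gen[where t = unit_disc] Moebius_function_holomorphic F)
       (use Mn disc w in auto)
  have h0: "h 0 = 0"
    by (simp add: h_def Moebius_function_simple)
  have h1: "cmod (h x) < 1" if "cmod x < 1" for x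
    using that w unfolding h_def o_def by (intro Mn disc) auto
  define \<zeta> where "\<zeta> = Moebius_function 0 w z"
  have \<zeta>: "cmod \<zeta> < 1" unfolding \<zeta>_def by (rule Mn[OF w z])
  have inv: "Moebius_function 0 (-w) \<zeta> = z"
    unfolding \<zeta>_def by (rule Moebius_function_compose) (use w z in auto)
  have "cmod (h \<zeta>) \<le> cmod \<zeta>"
    by (rule Schwarz_Lemma(1)[OF h h0 _ \<zeta>]) (rule h1)
  moreover have "h \<zeta> = Moebius_function 0 (F w) (F z)" by (simp add: h_def inv)
  ultimately show ?thesis
    by (simp add: \<zeta>_def Moebius_function_simple pseudohyperbolic_def)
qed

lemma funpow_add_one: "((\<lambda>\<omega>::complex. \<omega> + 1) ^^ n) \<omega> = \<omega> + of_nat n"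
  by (induction n) (simp_all add: algebra_simps)

lemma Cowen_model_funpow:
  assumes m: "\<forall>z\<in>unit_disc. \<psi> (h z) = \<psi> z + 1" and disc: "\<And>z. cmod z < 1 \<Longrightarrow> cmod (h z) < 1" and z: "cmod z < 1"
  shows "\<psi> ((h ^^ n) z) = \<psi> z + of_nat n" "cmod ((h ^^ n) z) < 1"
proof -
  show d: "cmod ((h ^^ n) z) < 1" for n by (induction n) (simp_all add: disc z)
  show "\<psi> ((h ^^ n) z) = \<psi> z + of_nat n"
    by (induction n) (simp_all add: m d add.commute add.left_commute)
qed

lemma absorbing_eventually:
  assumes a: "absorbing T V W" and K: "compact K" "K \<subseteq> W"
  shows "\<exists>n0. \<forall>n\<ge>n0. (T ^^ n) ` K \<subseteq> V"
proof -
  obtain n0 where n0: "(T ^^ n0) ` K \<subseteq> V" using a K unfolding absorbing_def by blast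
  have "(T ^^ n) ` K \<subseteq> V" if "n \<ge> n0" for n
    using that
  proof (induction n rule: dec_induct)
    case (step n)
    then have "T ` ((T ^^ n) ` K) \<subseteq> V" using a unfolding absorbing_def by blast
    then show ?case by (simp add: image_comp)
  qed (rule n0)
  then show ?thesis by blast
qed

text \<open>
  In the model, the points \<open>\<psi> z + n\<close> and \<open>\<psi> w + n\<close> eventually lie near the centre of arbitrarily
  large discs on which \<open>\<psi>\<close> can be inverted, so the Schwarz--Pick lemma applies to the inverse.
\<close>

theorem doubly_parabolic_contracts:
  assumes dp: "doubly_parabolic_type h" and h: "\<And>z. cmod z < 1 \<Longrightarrow> cmod (h z) < 1"
    and z: "cmod z < 1" and w: "cmod w < 1"
  shows "(\<lambda>n. pseudohyperbolic ((h ^^ n) z) ((h ^^ n) w)) \<longlonglongrightarrow> 0"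
proof -
  obtain V \<psi> where "Cowen_model h V UNIV \<psi> (\<lambda>\<omega>. \<omega> + 1)"
    using dp by (auto simp: doubly_parabolic_type_def)
  then have V: "open V" "absorbing h V unit_disc" "\<psi> holomorphic_on unit_disc"
      "absorbing (\<lambda>\<omega>. \<omega> + 1) (\<psi> ` V) UNIV" "\<forall>z\<in>unit_disc. \<psi> (h z) = \<psi> z + 1" "inj_on \<psi> V"
    by (auto simp: Cowen_model_def)
  have Vd: "V \<subseteq> unit_disc" using V(2) by (simp add: absorbing_def)
  have hV: "\<psi> holomorphic_on V" using V(3) Vd by (rule holomorphic_on_subset)
  obtain S where S: "S holomorphic_on (\<psi> ` V)" "\<And>z. z \<in> V \<Longrightarrow> S (\<psi> z) = z"
    using holomorphic_has_inverse[OF hV V(1,6)] by metis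
  have it: "\<psi> ((h ^^ n) z) = \<psi> z + of_nat n" if "cmod z < 1" for z n
    by (rule Cowen_model_funpow(1)[OF V(5) _ that]) (rule h)
  obtain n1 where n1: "\<And>n. n \<ge> n1 \<Longrightarrow> (h ^^ n) ` {z, w} \<subseteq> V"
    using absorbing_eventually[OF V(2), of "{z, w}"] z w by auto
  show ?thesis
  proof (rule LIMSEQ_I)
    fix e :: real assume e: "e > 0"
    define d where "d = cmod (\<psi> z - \<psi> w)"
    \<comment> \<open>Chosen so that \<open>d / R\<close> is at most half of \<open>e\<close>, for
      the final estimate, and at most half of 1, so that \<open>c\<close> lies in the disc. The
      summand 1 keeps \<open>R\<close> positive when \<open>d = 0\<close>.\<close>
    define R where "R = (d + 1) / min e 1 * 2"
    have d0: "d \<ge> 0" by (simp add: d_def)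
    have m0: "min e 1 > 0" "min e 1 \<le> 1" "min e 1 \<le> e" using e by auto
    have R0: "R > 0" using d0 m0 by (simp add: R_def)
    have "d / R = d / (d + 1) * (min e 1 / 2)" using d0 m0 by (simp add: R_def field_simps)
    also have "\<dots> \<le> 1 * (min e 1 / 2)" using d0 m0 by (intro mult_right_mono) auto
    finally have dR: "d / R \<le> min e 1 / 2" by simp
    obtain n2 where n2: "\<And>n. n \<ge> n2 \<Longrightarrow> ((\<lambda>\<omega>. \<omega> + 1) ^^ n) ` cball (\<psi> w) R \<subseteq> \<psi> ` V"
      using absorbing_eventually[OF V(4), of "cball (\<psi> w) R"] by auto
    have "norm (pseudohyperbolic ((h ^^ n) z) ((h ^^ n) w) - 0) < e" if n: "n \<ge> max n1 n2" for n
    proof -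
      \<comment> \<open>The inverse branch \<open>S\<close> on the disc of radius \<open>R\<close>
        about \<open>\<psi> w + n\<close>, rescaled to the unit disc. Its centre goes to the
        \<open>n\<close>-th iterate of \<open>w\<close>, and \<open>c\<close> goes to that of
        \<open>z\<close>.\<close>
      define H where "H = (\<lambda>\<zeta>. S (\<psi> w + of_nat n + of_real R * \<zeta>))"
      have inV: "\<psi> w + of_nat n + of_real R * \<zeta> \<in> \<psi> ` V" if "cmod \<zeta> < 1" for \<zeta>
      proof -
        have "\<psi> w + of_real R * \<zeta> \<in> cball (\<psi> w) R"
          using that R0 by (simp add: dist_norm norm_mult)
        then have "((\<lambda>\<omega>. \<omega> + 1) ^^ n) (\<psi> w + of_real R * \<zeta>) \<in> \<psi> ` V" using n2[of n] n by auto
        then show ?thesis by (simp add: funpow_add_one algebra_simps)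
      qed
      have SV: "S x \<in> V" if "x \<in> \<psi> ` V" for x using that S(2) by auto
      have H: "H holomorphic_on unit_disc"
      proof -
        have "(S \<circ> (\<lambda>\<zeta>. \<psi> w + of_nat n + of_real R * \<zeta>)) holomorphic_on unit_disc"
          by (intro holomorphic_on_compose_gen[OF _ S(1)] holomorphic_intros) (use inV in auto)
        then show ?thesis by (simp add: H_def o_def)
      qed
      have H1: "cmod (H \<zeta>) < 1" if "cmod \<zeta> < 1" for \<zeta>
        using SV[OF inV[OF that]] Vd by (auto simp: H_def)
      define c where "c = (\<psi> z - \<psi> w) / of_real R"
      have cn: "cmod c = d / R" using R0 by (simp add: c_def d_def norm_divide)
      then have c1: "cmod c < 1" using dR m0 by linarith
      have inVn: "(h ^^ n) z \<in> V" "(h ^^ n) w \<in> V" using n1[of n] n by auto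
      have H0: "H 0 = (h ^^ n) w" using S(2)[OF inVn(2)] it[OF w, of n] by (simp add: H_def)
      have "of_real R * c = \<psi> z - \<psi> w" using R0 by (simp add: c_def)
      then have Hc: "H c = (h ^^ n) z" using S(2)[OF inVn(1)] it[OF z, of n]
        by (simp add: H_def algebra_simps)
      have "pseudohyperbolic (H c) (H 0) \<le> pseudohyperbolic c 0"
        by (rule Schwarz_Pick[OF H H1 c1]) auto
      also have "\<dots> = d / R" by (simp add: pseudohyperbolic_def cn)
      also have "\<dots> < e" using dR m0 by linarith
      finally show ?thesis by (simp add: H0 Hc pseudohyperbolic_def)
    qed
    then show "\<exists>no. \<forall>n\<ge>no. norm (pseudohyperbolic ((h ^^ n) z) ((h ^^ n) w) - 0) < e" by blast
  qed
qed

section \<open>Non-singular Denjoy--Wolff points\<close>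

lemma sum_inverse_affine_not_summable:
  fixes A C \<beta> :: real
  assumes "\<beta> > 0" "A > 0" "C \<ge> 0"
  shows "\<not> summable (\<lambda>n. \<beta> / (A + C * real n))"
proof
  assume s: "summable (\<lambda>n. \<beta> / (A + C * real n))"
  define B where "B = A + C"
  have B: "B > 0" using assms by (simp add: B_def)
  have "summable (\<lambda>n. inverse (real (Suc n)) * (\<beta> / B))"
  proof (rule summable_comparison_test[OF _ s], intro exI allI impI)
    fix n :: nat
    have "A + C * real n \<le> B * real (Suc n)" using assms by (simp add: B_def algebra_simps)
    moreover have "0 < A + C * real n" using assms by (simp add: add_pos_nonneg)
    ultimately have "\<beta> / (B * real (Suc n)) \<le> \<beta> / (A + C * real n)"
      using assms B by (intro divide_left_mono) (auto intro!: mult_pos_pos)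
    then show "norm (inverse (real (Suc n)) * (\<beta> / B)) \<le> \<beta> / (A + C * real n)"
      using assms B by (simp add: divide_simps mult_ac)
  qed
  then have "summable (\<lambda>n. inverse (real (Suc n)) * (\<beta> / B) * (B / \<beta>))" by (rule summable_mult2)
  then have "summable (\<lambda>n. inverse (real (Suc n)))" using B assms by simp
  then show False using not_summable_harmonic[where 'a = real] summable_Suc_iff[of "\<lambda>n. inverse (real n)"] by simp
qed

text \<open>Here \<open>t\<close> is a right half-plane coordinate centred at the boundary fixed point.\<close>

lemma parabolic_germ_not_summable:
  fixes K :: "complex \<Rightarrow> complex" and t :: "nat \<Rightarrow> complex"
  assumes d: "d > 0" and K: "K holomorphic_on ball 0 d" and K0: "K 0 = 0"
    and im: "\<And>s. cmod s < d \<Longrightarrow> Re s = 0 \<Longrightarrow> Re (K s) = 0"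
    and t: "t \<longlonglongrightarrow> 0" "\<And>n. Re (t n) > 0" and tK: "\<And>n. cmod (t n) < d \<Longrightarrow> t (Suc n) = K (t n)"
    and rho: "(\<lambda>n. cmod (t (Suc n) - t n) / cmod (t (Suc n) + cnj (t n))) \<longlonglongrightarrow> 0"
    and beta: "deriv K 0 = 1 \<Longrightarrow> \<exists>\<beta>>0. \<forall>n. \<beta> \<le> Re (1 / t n)"
  shows "\<not> summable (\<lambda>n. Re (t n))"
proof -
  have tn0: "t n \<noteq> 0" for n using t(2)[of n] by auto
  \<comment> \<open>Difference quotients with the singularity removed. They give the expansion
    \<open>K z = z (K1 0 + z K2 z)\<close> with a holomorphic \<open>K2\<close>.\<close>
  define K1 where "K1 = (\<lambda>z. if z = 0 then deriv K 0 else (K z - K 0) / (z - 0))"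
  have K1h: "K1 holomorphic_on ball 0 d" unfolding K1_def by (rule pole_lemma_open[OF K open_ball])
  define K2 where "K2 = (\<lambda>z. if z = 0 then deriv K1 0 else (K1 z - K1 0) / (z - 0))"
  have K2h: "K2 holomorphic_on ball 0 d" unfolding K2_def by (rule pole_lemma_open[OF K1h open_ball])
  have Kf: "K z = z * K1 z" for z by (simp add: K1_def K0)
  have K1f: "K1 z = K1 0 + z * K2 z" for z by (simp add: K2_def)
  have K10: "K1 0 = deriv K 0" by (simp add: K1_def)
  have ev: "\<forall>\<^sub>F n in sequentially. cmod (t n) < d"
    using order_tendstoD(2)[OF tendsto_norm[OF t(1)]] d by simp
  have cont0: "(\<lambda>n. F (t n)) \<longlonglongrightarrow> F 0" if "F holomorphic_on ball 0 d'" "d' > 0" for F :: "complex \<Rightarrow> complex" and d'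
  proof -
    have "isCont F 0" using holomorphic_on_imp_continuous_on[OF that(1)] that(2)
      by (simp add: continuous_on_eq_continuous_at)
    then show ?thesis by (rule isCont_tendsto_compose[OF _ t(1)])
  qed
  \<comment> \<open>With a multiplier other than 1, as in the hyperbolic type, the pseudohyperbolic
    length of a step could not fall below \<open>|K1 0 - 1| / (|K1 0| + 1)\<close> in the
    limit.\<close>
  have kappa: "deriv K 0 = 1"
  proof (rule ccontr)
    assume ne: "deriv K 0 \<noteq> 1"
    have lim: "(\<lambda>n. cmod (K1 (t n) - 1) / (cmod (K1 (t n)) + 1)) \<longlonglongrightarrow> cmod (K1 0 - 1) / (cmod (K1 0) + 1)"
      by (intro tendsto_intros cont0[OF K1h d]) (use norm_ge_zero[of "K1 0"] in linarith)
    have "cmod (K1 0 - 1) / (cmod (K1 0) + 1) \<le> 0"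
    proof (rule tendsto_le[OF _ rho lim])
      show "\<forall>\<^sub>F n in sequentially. cmod (K1 (t n) - 1) / (cmod (K1 (t n)) + 1) \<le> cmod (t (Suc n) - t n) / cmod (t (Suc n) + cnj (t n))"
        using ev
      proof eventually_elim
        case (elim n)
        have e: "t (Suc n) = t n * K1 (t n)" using tK[OF elim] Kf by simp
        have "t (Suc n) - t n = t n * (K1 (t n) - 1)" by (simp add: e algebra_simps)
        then have n1: "cmod (t (Suc n) - t n) = cmod (t n) * cmod (K1 (t n) - 1)" by (simp add: norm_mult)
        have n2: "cmod (t (Suc n) + cnj (t n)) \<le> cmod (t n) * (cmod (K1 (t n)) + 1)"
          using norm_triangle_ineq[of "t (Suc n)" "cnj (t n)"] by (simp add: e norm_mult algebra_simps)
        have "Re (t (Suc n) + cnj (t n)) > 0" using t(2)[of n] t(2)[of "Suc n"] by simp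
        then have n3: "cmod (t (Suc n) + cnj (t n)) > 0" by (metis less_irrefl zero_complex.simps(1) zero_less_norm_iff)
        have "cmod (K1 (t n) - 1) / (cmod (K1 (t n)) + 1) = (cmod (t n) * cmod (K1 (t n) - 1)) / (cmod (t n) * (cmod (K1 (t n)) + 1))"
          using tn0[of n] by simp
        also have "\<dots> \<le> (cmod (t n) * cmod (K1 (t n) - 1)) / cmod (t (Suc n) + cnj (t n))"
          using n2 n3 tn0[of n] by (intro divide_left_mono mult_nonneg_nonneg mult_pos_pos) (auto simp: add_nonneg_pos)
        finally show ?case by (simp add: n1)
      qed
    qed simp
    moreover have "cmod (K1 0 - 1) / (cmod (K1 0) + 1) > 0"
      using ne by (intro divide_pos_pos) (auto simp: K10 add_nonneg_pos)
    ultimately show False by linarith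
  qed
  obtain \<beta> where \<beta>: "\<beta> > 0" "\<And>n. \<beta> \<le> Re (1 / t n)" using beta[OF kappa] by blast
  have K1one: "K1 0 = 1" using kappa K10 by simp
  obtain e where e: "e > 0" "e \<le> d" "\<And>z. cmod z < e \<Longrightarrow> K1 z \<noteq> 0"
  proof -
    have c: "continuous_on (ball 0 d) K1" by (rule holomorphic_on_imp_continuous_on[OF K1h])
    have "isCont K1 0" using c d by (simp add: continuous_on_eq_continuous_at)
    then have "\<forall>\<^sub>F z in at 0. K1 z \<noteq> 0" unfolding isCont_def
      by (rule tendsto_imp_eventually_ne) (simp add: K1one)
    then obtain e0 where e0: "e0 > 0" "\<And>z. z \<noteq> 0 \<Longrightarrow> dist z 0 < e0 \<Longrightarrow> K1 z \<noteq> 0"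
      by (auto simp: eventually_at)
    show ?thesis
    proof (rule that[of "min e0 d"])
      show "K1 z \<noteq> 0" if "cmod z < min e0 d" for z
        using e0(2)[of z] K1one that by (cases "z = 0") auto
    qed (use d e0(1) in auto)
  qed
  \<comment> \<open>In the coordinate \<open>y = 1 / t\<close>, which puts the fixed point at
    infinity, the map reads \<open>y + m (1 / y)\<close>.\<close>
  define m where "m = (\<lambda>z. - K2 z / K1 z)"
  have mh: "m holomorphic_on ball 0 e"
    unfolding m_def using e by (intro holomorphic_intros holomorphic_on_subset[OF K2h] holomorphic_on_subset[OF K1h]) auto
  have mf: "1 / K z - 1 / z = m z" if "z \<noteq> 0" "cmod z < e" for z
  proof -
    have "1 / K z - 1 / z = (1 - K1 z) / (z * K1 z)"
      using that e(3)[OF that(2)] by (simp add: Kf field_simps)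
    also have "1 - K1 z = - z * K2 z" using K1f[of z] K1one by simp
    finally show ?thesis using that by (simp add: m_def)
  qed
  \<comment> \<open>The imaginary axis is preserved by \<open>K\<close> and by inversion, so the
    displacement is imaginary there. The real part of \<open>m\<close> is then controlled by the
    distance to the axis.\<close>
  have mim: "Re (m (\<i> * of_real y)) = 0" if "\<bar>y\<bar> < e" for y
  proof -
    have nz: "Re (m (\<i> * of_real y)) = 0" if "\<bar>y\<bar> < e" "y \<noteq> 0" for y
    proof -
      have "Re (K (\<i> * of_real y)) = 0" using that e(2) by (intro im) (auto simp: norm_mult)
      then have "Re (1 / K (\<i> * of_real y)) = 0" by (simp add: Re_divide)
      moreover have "Re (1 / (\<i> * of_real y)) = 0" by (simp add: Re_divide)
      ultimately show ?thesis using mf[of "\<i> * of_real y"] that by (simp add: norm_mult flip: mf)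
    qed
    show ?thesis
    proof (cases "y = 0")
      case True
      have "isCont m 0" using holomorphic_on_imp_continuous_on[OF mh] e(1)
        by (simp add: continuous_on_eq_continuous_at)
      then have "(\<lambda>n. m (\<i> * of_real (e / real (Suc (Suc n))))) \<longlonglongrightarrow> m 0"
      proof (rule isCont_tendsto_compose)
        have "(\<lambda>n. \<i> * of_real (e / real (Suc (Suc n)))) \<longlonglongrightarrow> \<i> * of_real 0"
          by (intro tendsto_intros) real_asymp
        then show "(\<lambda>n. \<i> * of_real (e / real (Suc (Suc n)))) \<longlonglongrightarrow> (0::complex)" by simp
      qed
      then have "(\<lambda>n. Re (m (\<i> * of_real (e / real (Suc (Suc n)))))) \<longlonglongrightarrow> Re (m 0)" by (rule tendsto_Re)
      moreover have "Re (m (\<i> * of_real (e / real (Suc (Suc n))))) = 0" for n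
      proof (rule nz)
        show "\<bar>e / real (Suc (Suc n))\<bar> < e" using e(1) by (simp add: field_simps add_pos_nonneg)
        show "e / real (Suc (Suc n)) \<noteq> 0" using e(1) by simp
      qed
      ultimately have "Re (m 0) = 0" using LIMSEQ_unique[of "\<lambda>n. 0::real"] by fastforce
      then show ?thesis using True by simp
    qed (use nz that in blast)
  qed
  obtain L where L: "L \<ge> 0" "\<And>z w. cmod z \<le> e / 2 \<Longrightarrow> cmod w \<le> e / 2 \<Longrightarrow> cmod (m z - m w) \<le> L * cmod (z - w)"
  proof -
    have dm: "continuous_on (ball 0 e) (deriv m)"
      by (intro holomorphic_on_imp_continuous_on holomorphic_deriv mh open_ball)
    have "compact (deriv m ` cball 0 (e/2))"
      by (intro compact_continuous_image continuous_on_subset[OF dm]) (use e(1) in auto)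
    then obtain B where B: "\<forall>x\<in>deriv m ` cball 0 (e/2). cmod x \<le> B" using compact_imp_bounded bounded_iff by metis
    have "cmod (m z - m w) \<le> max B 0 * cmod (z - w)" if "cmod z \<le> e / 2" "cmod w \<le> e / 2" for z w
    proof (rule field_differentiable_bound[of "cball 0 (e/2)" m "deriv m"])
      show "(m has_field_derivative deriv m x) (at x within cball 0 (e/2))" if "x \<in> cball 0 (e/2)" for x
        using holomorphic_derivI[OF mh open_ball, of x] that e(1) by (auto intro: has_field_derivative_at_within)
      show "cmod (deriv m x) \<le> max B 0" if "x \<in> cball 0 (e/2)" for x using B that by (auto simp: le_max_iff_disj)
    qed (use that in auto)
    then show ?thesis by (intro that[of "max B 0"]) auto
  qed
  define y where "y n = 1 / t n" for n
  have ty: "t n = 1 / y n" "y n \<noteq> 0" for n using tn0[of n] by (auto simp: y_def)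
  have Rey: "Re (y n) > 0" for n using \<beta>(1) \<beta>(2)[of n] by (simp add: y_def)
  have ynorm: "cmod (t n) = 1 / cmod (y n)" for n by (simp add: y_def norm_divide)
  have Ret: "Re (t n) = Re (y n) / (cmod (y n))\<^sup>2" for n
    using ty[of n] by (simp add: Re_divide cmod_power2)
  obtain N where N: "\<And>n. n \<ge> N \<Longrightarrow> cmod (t n) < min (e / 2) 1"
    using order_tendstoD(2)[OF tendsto_norm[OF t(1)], of "min (e/2) 1"] e(1) by (auto simp: eventually_sequentially)
  have ym: "y (Suc n) = y n + m (t n)" if "n \<ge> N" for n
  proof -
    have "cmod (t n) < e" using N[OF that] e(1) by simp
    then show ?thesis using mf[of "t n"] tK[of n] tn0[of n] e(2) by (simp add: y_def algebra_simps)
  qed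
  have y1: "cmod (y n) \<ge> 1" if "n \<ge> N" for n
    using N[OF that] ty(2)[of n] by (simp add: ynorm divide_simps split: if_splits)
  show ?thesis
  proof (cases "m 0 = 0")
    case True
    \<comment> \<open>The displacement is at most \<open>L / |y|\<close>, and squaring
      \<open>|y| + L / |y|\<close> gives \<open>|y|^2 + 2 L + (L / |y|)^2\<close>, where
      \<open>|y| \<ge> 1\<close>.\<close>
    define C where "C = 2 * L + L\<^sup>2"
    have C: "C \<ge> 0" using L(1) by (simp add: C_def)
    have step: "(cmod (y (Suc n)))\<^sup>2 \<le> (cmod (y n))\<^sup>2 + C" if "n \<ge> N" for n
    proof -
      have "cmod (m (t n) - m 0) \<le> L * cmod (t n - 0)"
        using N[OF that] e(1) by (intro L(2)) auto
      then have "cmod (m (t n)) \<le> L / cmod (y n)" by (simp add: True ynorm)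
      then have "cmod (y (Suc n)) \<le> cmod (y n) + L / cmod (y n)"
        using norm_triangle_ineq[of "y n" "m (t n)"] ym[OF that] by simp
      then have "(cmod (y (Suc n)))\<^sup>2 \<le> (cmod (y n) + L / cmod (y n))\<^sup>2" by (intro power_mono) auto
      also have "\<dots> = (cmod (y n))\<^sup>2 + 2 * L + (L / cmod (y n))\<^sup>2"
        using ty(2)[of n] by (simp add: power2_sum)
      also have "(L / cmod (y n))\<^sup>2 \<le> L\<^sup>2"
      proof (rule power_mono)
        have "L / cmod (y n) \<le> L / 1" using y1[OF that] L(1) by (intro divide_left_mono) auto
        then show "L / cmod (y n) \<le> L" by simp
      qed (use L(1) in simp)
      finally show ?thesis by (simp add: C_def)
    qed
    have bound: "(cmod (y (N + n)))\<^sup>2 \<le> (cmod (y N))\<^sup>2 + C * real n" for n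
    proof (induction n)
      case (Suc n)
      then show ?case using step[of "N + n"] by (simp add: algebra_simps)
    qed simp
    have "\<not> summable (\<lambda>n. Re (t (n + N)))"
    proof
      assume s: "summable (\<lambda>n. Re (t (n + N)))"
      have "summable (\<lambda>n. \<beta> / ((cmod (y N))\<^sup>2 + C * real n))"
      proof (rule summable_comparison_test[OF _ s], intro exI allI impI)
        fix n :: nat
        have p: "0 < (cmod (y (N + n)))\<^sup>2" using ty(2) by simp
        have "\<beta> / ((cmod (y N))\<^sup>2 + C * real n) \<le> \<beta> / (cmod (y (N + n)))\<^sup>2"
          using bound[of n] p \<beta>(1) less_le_trans[OF p bound] by (intro divide_left_mono mult_pos_pos) auto
        also have "\<dots> \<le> Re (y (N + n)) / (cmod (y (N + n)))\<^sup>2"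
          using \<beta>(2)[of "N + n"] by (intro divide_right_mono) (auto simp: y_def)
        also have "\<dots> = Re (t (n + N))" by (simp add: Ret add.commute)
        finally show "norm (\<beta> / ((cmod (y N))\<^sup>2 + C * real n)) \<le> Re (t (n + N))"
          using \<beta>(1) C by (simp add: abs_of_nonneg)
      qed
      moreover have "\<not> summable (\<lambda>n. \<beta> / ((cmod (y N))\<^sup>2 + C * real n))"
        using ty(2) \<beta>(1) C by (intro sum_inverse_affine_not_summable) auto
      ultimately show False by simp
    qed
    then show ?thesis using summable_iff_shift[of "\<lambda>n. Re (t n)" N] by blast
  next
    case False
    \<comment> \<open>A nonzero \<open>m 0\<close> is the simply parabolic behaviour, a nearly
      constant translation along the boundary. Then \<open>|y|\<close> grows linearly, so the
      relative growth of the heights \<open>Re y\<close> is summable and they stay bounded. A step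
      of fixed size at bounded height does not become hyperbolically small, which contradicts
      \<open>rho\<close>.\<close>
    define \<alpha> where "\<alpha> = cmod (m 0)"
    have \<alpha>: "\<alpha> > 0" using False by (simp add: \<alpha>_def)
    have "(\<lambda>n. m (t n)) \<longlonglongrightarrow> m 0" by (rule cont0[OF mh e(1)])
    then have "\<forall>\<^sub>F n in sequentially. dist (m (t n)) (m 0) < \<alpha> / 2" using \<alpha> by (intro tendstoD) auto
    then obtain N1 where N1: "\<And>n. n \<ge> N1 \<Longrightarrow> cmod (m (t n) - m 0) < \<alpha> / 2"
      by (auto simp: eventually_sequentially dist_norm)
    define P where "P = max N N1"
    have PN: "n \<ge> N" "n \<ge> N1" if "n \<ge> P" for n using that by (auto simp: P_def)
    have lin: "cmod (y (P + n) - y P - of_nat n * m 0) \<le> real n * (\<alpha> / 2)" for n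
    proof (induction n)
      case (Suc n)
      have "y (P + Suc n) - y P - of_nat (Suc n) * m 0 = (y (P + n) - y P - of_nat n * m 0) + (m (t (P + n)) - m 0)"
        using ym[OF PN(1), of "P + n"] by (simp add: algebra_simps)
      then have "cmod (y (P + Suc n) - y P - of_nat (Suc n) * m 0) \<le>
          cmod (y (P + n) - y P - of_nat n * m 0) + cmod (m (t (P + n)) - m 0)"
        using norm_triangle_ineq by metis
      then show ?case using Suc N1[OF PN(2), of "P + n"] by (simp add: algebra_simps)
    qed simp
    have low: "real n * (\<alpha> / 2) - cmod (y P) \<le> cmod (y (P + n))" for n
    proof -
      have "cmod (of_nat n * m 0) \<le> cmod (y (P + n) - y P - of_nat n * m 0) + cmod (y (P + n)) + cmod (y P)"
        using norm_triangle_ineq4[of "y (P + n) - y P" "y (P + n) - y P - of_nat n * m 0"] norm_triangle_ineq4[of "y (P + n)" "y P"]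
        by simp
      then show ?thesis using lin[of n] by (simp add: norm_mult \<alpha>_def algebra_simps)
    qed
    \<comment> \<open>Comparison with the point of the imaginary axis at the same imaginary part
      gives \<open>Re (m t) \<le> L * Re t\<close>, and \<open>Re t = Re y / |y|^2\<close>. So
      \<open>1 + s n\<close> bounds the factor by which the height grows in one step.\<close>
    define s where "s n = L / (cmod (y (P + n)))\<^sup>2" for n
    have s0: "s n \<ge> 0" for n using L(1) by (simp add: s_def)
    have ssum: "summable s"
    proof -
      \<comment> \<open>Beyond \<open>n0\<close> the initial value \<open>|y P|\<close> is less than
        half of the linear term \<open>n \<alpha> / 2\<close>, which leaves
        \<open>n \<alpha> / 4\<close>. Squaring gives the factor 16.\<close>
      obtain n0 where n0: "real n0 > 4 * cmod (y P) / \<alpha>" using reals_Archimedean2 by blast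
      have "summable (\<lambda>n. 1 / (real n)\<^sup>2)" using inverse_power_summable[of 2] by (simp add: inverse_eq_divide)
      then have "summable (\<lambda>n. (16 * L / \<alpha>\<^sup>2) * (1 / (real n)\<^sup>2))" by (rule summable_mult)
      moreover have "norm (s n) \<le> (16 * L / \<alpha>\<^sup>2) * (1 / (real n)\<^sup>2)" if "n \<ge> Suc n0" for n
      proof -
        have "cmod (y P) < real n * (\<alpha> / 4)"
        proof -
          have "4 * cmod (y P) / \<alpha> < real n" using n0 that by (meson Suc_leD less_le_trans of_nat_le_iff)
          then show ?thesis using \<alpha> by (simp add: field_simps)
        qed
        then have "real n * (\<alpha> / 4) \<le> cmod (y (P + n))" using low[of n] by (simp add: field_simps)
        then have "(real n * (\<alpha> / 4))\<^sup>2 \<le> (cmod (y (P + n)))\<^sup>2" using \<alpha> by (intro power_mono) auto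
        then have "s n \<le> L / (real n * (\<alpha> / 4))\<^sup>2"
          unfolding s_def using L(1) \<alpha> that ty(2) by (intro divide_left_mono mult_pos_pos) auto
        also have "\<dots> = (16 * L / \<alpha>\<^sup>2) * (1 / (real n)\<^sup>2)" by (simp add: power_mult_distrib power_divide field_simps)
        finally show ?thesis using s0[of n] by simp
      qed
      then have "\<exists>N. \<forall>n\<ge>N. norm (s n) \<le> (16 * L / \<alpha>\<^sup>2) * (1 / (real n)\<^sup>2)"
        by (intro exI[of _ "Suc n0"] allI impI)
      ultimately show ?thesis by (rule summable_comparison_test[rotated])
    qed
    have growth: "Re (y (P + n)) \<le> Re (y P) * exp (\<Sum>i<n. s i)" for n
    proof (induction n)
      case (Suc n)
      have tl: "cmod (t (P + n)) \<le> e / 2" using N[OF PN(1), of "P + n"] by simp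
      have il: "\<bar>Im (t (P + n))\<bar> \<le> e / 2" using abs_Im_le_cmod[of "t (P + n)"] tl by linarith
      have "Re (m (t (P + n))) = Re (m (t (P + n)) - m (\<i> * of_real (Im (t (P + n)))))"
        using mim[of "Im (t (P + n))"] il e(1) by simp
      also have "\<dots> \<le> cmod (m (t (P + n)) - m (\<i> * of_real (Im (t (P + n)))))" by (rule complex_Re_le_cmod)
      also have "\<dots> \<le> L * cmod (t (P + n) - \<i> * of_real (Im (t (P + n))))"
        using tl il by (intro L(2)) (auto simp: norm_mult)
      also have "t (P + n) - \<i> * of_real (Im (t (P + n))) = of_real (Re (t (P + n)))" by (simp add: complex_eq_iff)
      also have "L * cmod (of_real (Re (t (P + n)))) = Re (y (P + n)) * s n"
      proof -
        have "cmod (of_real (Re (t (P + n)))) = Re (t (P + n))" using t(2)[of "P + n"] by (simp only: norm_of_real)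
        then show ?thesis by (simp only:) (simp add: Ret s_def)
      qed
      finally have "Re (y (P + Suc n)) \<le> Re (y (P + n)) * (1 + s n)"
        using ym[OF PN(1), of "P + n"] by (simp add: algebra_simps)
      also have "\<dots> \<le> Re (y (P + n)) * exp (s n)"
        using Rey[of "P + n"] by (intro mult_left_mono) auto
      also have "\<dots> \<le> (Re (y P) * exp (\<Sum>i<n. s i)) * exp (s n)"
        using Suc by (intro mult_right_mono) auto
      finally show ?case by (simp add: exp_add)
    qed simp
    define B where "B = Re (y P) * exp (suminf s)"
    have B: "Re (y (P + n)) \<le> B" for n
    proof -
      have "(\<Sum>i<n. s i) \<le> suminf s" using s0 by (intro sum_le_suminf ssum) auto
      then have "Re (y P) * exp (\<Sum>i<n. s i) \<le> B" unfolding B_def using Rey[of P] by (intro mult_left_mono) auto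
      then show ?thesis using growth[of n] by linarith
    qed
    have B0: "B > 0" using B[of 0] Rey[of P] by simp
    \<comment> \<open>In the coordinate \<open>y\<close> the ratio is at least
      \<open>\<Delta> / (\<Delta> + 2 B)\<close>, which increases with \<open>\<Delta>\<close>, and
      \<open>\<Delta>\<close> is at least \<open>\<alpha> / 2\<close>.\<close>
    have low2: "(\<alpha> / 2) / (\<alpha> / 2 + 2 * B) \<le> cmod (t (Suc n) - t n) / cmod (t (Suc n) + cnj (t n))" if n: "n \<ge> P" for n
    proof -
      define \<Delta> where "\<Delta> = cmod (y (Suc n) - y n)"
      have "cmod (m 0) - cmod (m (t n) - m 0) \<le> cmod (m (t n))"
        using norm_triangle_ineq2[of "m 0" "m 0 - m (t n)"] by (simp add: norm_minus_commute)
      then have D: "\<Delta> \<ge> \<alpha> / 2" using N1[OF PN(2)[OF n]] ym[OF PN(1)[OF n]] by (simp add: \<Delta>_def \<alpha>_def)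
      have a1: "cmod (t (Suc n) - t n) = \<Delta> / (cmod (y (Suc n)) * cmod (y n))"
      proof -
        have "t (Suc n) - t n = (y n - y (Suc n)) / (y (Suc n) * y n)"
          using ty(2)[of n] ty(2)[of "Suc n"] by (simp add: ty(1) field_simps)
        then show ?thesis by (simp add: \<Delta>_def norm_divide norm_mult norm_minus_commute)
      qed
      have a2: "cmod (t (Suc n) + cnj (t n)) = cmod (y (Suc n) + cnj (y n)) / (cmod (y (Suc n)) * cmod (y n))"
      proof -
        have "t (Suc n) + cnj (t n) = (y (Suc n) + cnj (y n)) / (y (Suc n) * cnj (y n))"
          using ty(2)[of n] ty(2)[of "Suc n"] by (simp add: ty(1) field_simps)
        then show ?thesis by (simp add: norm_divide norm_mult)
      qed
      have p: "cmod (y (Suc n)) * cmod (y n) > 0" using ty(2) by simp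
      have ratio: "cmod (t (Suc n) - t n) / cmod (t (Suc n) + cnj (t n)) = \<Delta> / cmod (y (Suc n) + cnj (y n))"
        unfolding a1 a2 using ty(2)[of n] ty(2)[of "Suc n"] by (simp add: field_simps)
      have "y (Suc n) + cnj (y n) = (y (Suc n) - y n) + of_real (2 * Re (y n))" by (simp add: complex_eq_iff)
      then have "cmod (y (Suc n) + cnj (y n)) \<le> \<Delta> + cmod (of_real (2 * Re (y n)))"
        unfolding \<Delta>_def using norm_triangle_ineq by metis
      also have "cmod (of_real (2 * Re (y n))) = 2 * Re (y n)" using Rey[of n] by (simp only: norm_of_real)
      also have "Re (y n) \<le> B" using B[of "n - P"] n by simp
      finally have up: "cmod (y (Suc n) + cnj (y n)) \<le> \<Delta> + 2 * B" by simp
      have "Re (y (Suc n) + cnj (y n)) > 0" using Rey[of n] Rey[of "Suc n"] by simp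
      then have pos: "cmod (y (Suc n) + cnj (y n)) > 0" by (metis less_irrefl zero_complex.simps(1) zero_less_norm_iff)
      have "(\<alpha> / 2) / (\<alpha> / 2 + 2 * B) \<le> \<Delta> / (\<Delta> + 2 * B)"
      proof -
        have "(\<alpha> / 2) * (\<Delta> + 2 * B) \<le> \<Delta> * (\<alpha> / 2 + 2 * B)"
          using mult_right_mono[OF D, of "2 * B"] B0 by (simp add: algebra_simps)
        moreover have "0 < \<alpha> / 2 + 2 * B" "0 < \<Delta> + 2 * B" using D \<alpha> B0 by auto
        ultimately show ?thesis by (simp add: pos_divide_le_eq pos_le_divide_eq algebra_simps)
      qed
      also have "\<dots> \<le> \<Delta> / cmod (y (Suc n) + cnj (y n))"
        using up pos D \<alpha> B0 by (intro divide_left_mono mult_pos_pos) auto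
      finally show ?thesis by (simp add: ratio)
    qed
    have "(\<alpha> / 2) / (\<alpha> / 2 + 2 * B) \<le> 0"
      by (rule tendsto_lowerbound[OF rho]) (use low2 in \<open>auto simp: eventually_sequentially\<close>)
    moreover have "(\<alpha> / 2) / (\<alpha> / 2 + 2 * B) > 0" using \<alpha> B0 by (intro divide_pos_pos) auto
    ultimately show ?thesis by linarith
  qed
qed

lemma circle_measure_open_pos:
  assumes A: "open A" "A \<inter> unit_circle \<noteq> {}"
  shows "measure circle_measure (A \<inter> unit_circle) > 0"
proof -
  obtain \<zeta> where \<zeta>: "\<zeta> \<in> A" "cmod \<zeta> = 1" using A by auto
  obtain s where s: "0 \<le> s" "s < 2 * pi" "\<zeta> = cis s"
    using complex_unit_circle[of \<zeta>] \<zeta>(2) by (metis Arg2pi cis_conv_exp Arg2pi_ge_0 Arg2pi_lt_2pi mult.left_neutral of_real_1 is_Arg_def)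
  define S where "S = cis -` A \<inter> {0<..<2 * pi}"
  have oS0: "open (cis -` A)" by (intro open_vimage A continuous_intros)
  then have oS: "open S" unfolding S_def by (intro open_Int) auto
  \<comment> \<open>The angle may be the endpoint 0. An open set that meets the closure of the
    interval also meets the interval.\<close>
  have "s \<in> closure {0<..<2 * pi}" using s by simp
  then have "cis -` A \<inter> closure {0<..<2 * pi} \<noteq> {}" using \<zeta>(1) s(3) by blast
  then have "S \<noteq> {}" unfolding S_def open_Int_closure_eq_empty[OF oS0] .
  then have "\<not> negligible S" using oS by (simp add: open_not_negligible)
  then have n0: "emeasure lborel S \<noteq> 0"
    using oS by (simp add: negligible_iff_null_sets null_sets_def)
  have AC: "A \<inter> unit_circle \<in> sets (restrict_space borel unit_circle)"
    using A by (auto simp: sets_restrict_space)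
  have "emeasure circle_measure (A \<inter> unit_circle) = emeasure (uniform_measure lborel {0..2 * pi}) (cis -` (A \<inter> unit_circle) \<inter> UNIV)"
    unfolding circle_measure_def using emeasure_distr[OF cis_measurable_circle AC] by simp
  also have "\<dots> \<ge> emeasure (uniform_measure lborel {0..2 * pi}) S"
  proof (rule emeasure_mono)
    have "cis -` (A \<inter> unit_circle) \<inter> UNIV = cis -` A" by auto
    then show "cis -` (A \<inter> unit_circle) \<inter> UNIV \<in> sets (uniform_measure lborel {0..2 * pi})" using oS0 by simp
  qed (auto simp: S_def)
  also have "emeasure (uniform_measure lborel {0..2 * pi}) S = emeasure lborel S / emeasure lborel {0..2 * pi}"
  proof -
    have "{0..2 * pi} \<inter> S = S" by (auto simp: S_def)
    then show ?thesis using oS by (subst emeasure_uniform_measure) auto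
  qed
  finally have "emeasure lborel S / ennreal (2 * pi) \<le> emeasure circle_measure (A \<inter> unit_circle)" by simp
  moreover have "emeasure lborel S / ennreal (2 * pi) \<noteq> 0" using n0 by (simp add: ennreal_divide_eq_0_iff)
  ultimately have "emeasure circle_measure (A \<inter> unit_circle) \<noteq> 0" by auto
  then show ?thesis by (simp add: circle.emeasure_eq_measure zero_less_measure_iff)
qed

section \<open>Cayley transform to the right half-plane, with the boundary point \<open>p\<close> at
  the origin\<close>

lemma Re_Cayley:
  assumes p: "cmod p = 1"
  shows "Re ((p - z) / (p + z)) = (1 - (cmod z)\<^sup>2) / (cmod (p + z))\<^sup>2"
proof -
  have pp: "p * cnj p = 1" using p by (simp add: complex_norm_square[symmetric])
  have "Re ((p - z) * cnj (p + z)) = 1 - (cmod z)\<^sup>2"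
  proof -
    have "(p - z) * cnj (p + z) = p * cnj p - z * cnj z + (p * cnj z - cnj (p * cnj z))"
      by (simp add: algebra_simps)
    also have "\<dots> = of_real (1 - (cmod z)\<^sup>2) + (p * cnj z - cnj (p * cnj z))"
      by (simp only: pp of_real_diff of_real_1 complex_norm_square)
    finally show ?thesis by simp
  qed
  moreover have "(p - z) / (p + z) = ((p - z) * cnj (p + z)) / of_real ((cmod (p + z))\<^sup>2)"
    by (rule complex_div_cnj)
  ultimately show ?thesis by (simp add: Re_divide_of_real)
qed

text \<open>The first formula carries the contraction of the orbit over to the half-plane. In the
  second the heights appear as factors, so it can be divided by a height that tends to zero; Julia's
  lemma is obtained from it in this way.\<close>

lemma Cayley_pseudohyperbolic:
  assumes p: "cmod p = 1" and z: "cmod z < 1" and w: "cmod w < 1"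
  defines "t \<equiv> (p - z) / (p + z)" and "s \<equiv> (p - w) / (p + w)"
  shows "pseudohyperbolic z w = cmod (t - s) / cmod (t + cnj s)"
    and "1 - (pseudohyperbolic z w)\<^sup>2 = 4 * Re t * Re s / (cmod (t + cnj s))\<^sup>2"
proof -
  have pp: "p * cnj p = 1" using p by (simp add: complex_norm_square[symmetric])
  have n: "p + z \<noteq> 0" "p + w \<noteq> 0" using p z w by (metis add_eq_0_iff less_irrefl norm_minus_cancel)+
  then have n2: "cnj p + cnj w \<noteq> 0" by (metis complex_cnj_add complex_cnj_zero_iff)
  have "t - s = (2 * p * (w - z)) / ((p + z) * (p + w))"
    unfolding t_def s_def using n by (simp add: divide_simps) (simp add: algebra_simps)
  then have ts: "cmod (t - s) = 2 * cmod (z - w) / (cmod (p + z) * cmod (p + w))"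
    using p by (simp add: norm_divide norm_mult norm_minus_commute)
  have "t + cnj s = ((p - z) * (cnj p + cnj w) + (cnj p - cnj w) * (p + z)) / ((p + z) * (cnj p + cnj w))"
    unfolding t_def s_def using n n2 by (simp add: add_frac_eq)
  also have "(p - z) * (cnj p + cnj w) + (cnj p - cnj w) * (p + z) = 2 * (p * cnj p) - 2 * (cnj w * z)"
    by (simp add: algebra_simps)
  also have "\<dots> = 2 * (1 - cnj w * z)" by (simp add: pp)
  finally have "cmod (t + cnj s) = cmod (2 * (1 - cnj w * z)) / (cmod (p + z) * cmod (cnj (p + w)))"
    by (simp only: norm_divide norm_mult complex_cnj_add)
  then have ts2: "cmod (t + cnj s) = 2 * cmod (1 - cnj w * z) / (cmod (p + z) * cmod (p + w))"
    by (simp only: norm_mult complex_mod_cnj norm_numeral)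
  have Re_t: "Re t = (1 - (cmod z)\<^sup>2) / (cmod (p + z))\<^sup>2" unfolding t_def by (rule Re_Cayley[OF p])
  have Re_s: "Re s = (1 - (cmod w)\<^sup>2) / (cmod (p + w))\<^sup>2" unfolding s_def by (rule Re_Cayley[OF p])
  have d: "1 - cnj w * z \<noteq> 0" using disc_denominator_nonzero w z by auto
  show "pseudohyperbolic z w = cmod (t - s) / cmod (t + cnj s)"
    unfolding ts ts2 pseudohyperbolic_def using n d by (simp add: norm_divide)
  have "1 - (pseudohyperbolic z w)\<^sup>2 = (1 - (cmod z)\<^sup>2) * (1 - (cmod w)\<^sup>2) / (cmod (1 - cnj w * z))\<^sup>2"
    using z w by (intro one_minus_pseudohyperbolic_sq) auto
  also have "\<dots> = 4 * Re t * Re s / (cmod (t + cnj s))\<^sup>2"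
    unfolding ts2 Re_t Re_s using n d by (simp add: field_simps power_mult_distrib power_divide)
  finally show "1 - (pseudohyperbolic z w)\<^sup>2 = 4 * Re t * Re s / (cmod (t + cnj s))\<^sup>2" .
qed

lemma Cayley_inverse:
  assumes p: "cmod p = 1" and s: "s \<noteq> -1"
  defines "z \<equiv> p * (1 - s) / (1 + s)"
  shows "(p - z) / (p + z) = s"
proof -
  have n: "1 + s \<noteq> 0" using s by (metis add.commute add_eq_0_iff)
  have pn: "p \<noteq> 0" using p by auto
  have "p - z = 2 * p * s / (1 + s)" "p + z = 2 * p / (1 + s)"
    unfolding z_def using n by (simp_all add: divide_simps) (simp_all add: algebra_simps)
  then show ?thesis using n pn by simp
qed

lemma Cayley_inverse':
  assumes p: "cmod p = 1" and z: "p + z \<noteq> 0"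
  defines "s \<equiv> (p - z) / (p + z)"
  shows "p * (1 - s) / (1 + s) = z" "s \<noteq> -1"
proof -
  have pn: "p \<noteq> 0" using p by auto
  have a: "1 - s = 2 * z / (p + z)" "1 + s = 2 * p / (p + z)"
    unfolding s_def using z by (simp_all add: divide_simps)
  then show "p * (1 - s) / (1 + s) = z" using pn z by simp
  show "s \<noteq> -1" using a(2) pn z by auto
qed

section \<open>Extension across a boundary fixed point and Julia's lemma\<close>

context inner_boundary_map
begin

text \<open>On the circle the extension takes the radial limits of \<open>g\<close>, which are
  unimodular almost everywhere. A point where its modulus is not 1 would have a relatively open set
  of such points around it, and this has positive measure.\<close>

lemma extension_unimodular:
  assumes N: "open N" "h holomorphic_on N" "\<And>z. z \<in> N \<Longrightarrow> cmod z < 1 \<Longrightarrow> h z = g z"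
    and \<zeta>: "\<zeta> \<in> N" "cmod \<zeta> = 1"
  shows "cmod (h \<zeta>) = 1"
proof (rule ccontr)
  assume ne: "cmod (h \<zeta>) \<noteq> 1"
  have hc: "continuous_on N h" using N(2) by (rule holomorphic_on_imp_continuous_on)
  define A where "A = {z \<in> N. cmod (h z) \<noteq> 1}"
  have "A = N \<inter> (\<lambda>z. cmod (h z)) -` (- {1})" by (auto simp: A_def)
  moreover have "open \<dots>" using N(1) by (intro continuous_open_preimage continuous_intros hc) auto
  ultimately have oA: "open A" by simp
  have AC: "A \<inter> unit_circle \<in> sets circle_measure"
    using oA by (auto simp: sets_circle_measure sets_restrict_space)
  have "measure circle_measure (A \<inter> unit_circle) > 0"
    using \<zeta> ne by (intro circle_measure_open_pos oA) (auto simp: A_def)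
  moreover have "AE x in circle_measure. x \<in> unit_circle" using AE_space[of circle_measure] by simp
  with G_limit have "AE x in circle_measure. x \<notin> A \<inter> unit_circle"
  proof eventually_elim
    case (elim x)
    have "cmod (h x) = 1" if "x \<in> N"
    proof -
      have "isCont h x" using hc N(1) that by (simp add: continuous_on_eq_continuous_at)
      moreover have lim: "((\<lambda>r::real. of_real r * x) \<longlongrightarrow> of_real 1 * x) (at_left 1)" by (intro tendsto_intros)
      ultimately have "((\<lambda>r. h (of_real r * x)) \<longlongrightarrow> h x) (at_left 1)"
        by (intro isCont_tendsto_compose[of x h]) simp_all
      moreover have "\<forall>\<^sub>F r in at_left (1::real). of_real r * x \<in> N"
        using topological_tendstoD[OF lim N(1)] that by simp
      moreover have "\<forall>\<^sub>F r in at_left (1::real). r \<in> {0<..<1}" by (intro eventually_at_leftI[of 0]) auto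
      ultimately have "((\<lambda>r. g (of_real r * x)) \<longlongrightarrow> h x) (at_left 1)"
      proof (elim Lim_transform_eventually)
        show "\<forall>\<^sub>F r in at_left 1. h (of_real r * x) = g (of_real r * x)"
          using \<open>\<forall>\<^sub>F r in at_left (1::real). of_real r * x \<in> N\<close> \<open>\<forall>\<^sub>F r in at_left (1::real). r \<in> {0<..<1}\<close>
          by eventually_elim (use elim N(3) in \<open>auto simp: norm_mult\<close>)
      qed
      then have "h x = G x" using elim(1) tendsto_unique[OF trivial_limit_at_left_real] by blast
      then show ?thesis using G_unit elim(2) by simp
    qed
    then show ?case by (auto simp: A_def)
  qed
  then have "measure circle_measure (A \<inter> unit_circle) = 0"
    using AC by (subst circle.prob_eq_0) auto
  ultimately show False by simp
qed

text \<open>In the coordinate \<open>t\<close> the extension of \<open>g\<close> at \<open>p\<close>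
  becomes a germ fixing 0 and preserving the imaginary axis. Near \<open>p\<close> the height
  \<open>Re t\<close> is at most \<open>2 (1 - |z|)\<close>, so divergence of the series of heights
  gives the claim.\<close>

theorem nonsingular_Denjoy_Wolff_diverges:
  assumes p: "\<not> singular_point g p" "cmod p = 1" and lim: "(\<lambda>n. (g ^^ n) 0) \<longlonglongrightarrow> p"
    and rho: "(\<lambda>n. pseudohyperbolic ((g ^^ Suc n) 0) ((g ^^ n) 0)) \<longlonglongrightarrow> 0"
  shows "\<not> summable (\<lambda>n. 1 - cmod ((g ^^ n) 0))"
proof -
  obtain N h where N: "open N" "p \<in> N" "h holomorphic_on N" "\<And>z. z \<in> N \<Longrightarrow> cmod z < 1 \<Longrightarrow> h z = g z"
    using p by (auto simp: singular_point_def)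
  define zn where "zn = (\<lambda>n. (g ^^ n) 0)"
  have zn1: "cmod (zn n) < 1" for n unfolding zn_def by (rule funpow_disc) simp
  have znS: "zn (Suc n) = g (zn n)" for n by (simp add: zn_def)
  have lim': "zn \<longlonglongrightarrow> p" using lim by (simp add: zn_def)
  have hc: "continuous_on N h" using N(3) by (rule holomorphic_on_imp_continuous_on)
  have hcp: "isCont h p" using hc N(1,2) by (simp add: continuous_on_eq_continuous_at)
  have hp: "h p = p"
  proof -
    have "(\<lambda>n. h (zn n)) \<longlonglongrightarrow> h p" by (rule isCont_tendsto_compose[OF hcp lim'])
    moreover have "\<forall>\<^sub>F n in sequentially. h (zn n) = zn (Suc n)"
      using topological_tendstoD[OF lim' N(1,2)] by eventually_elim (simp add: N(4) zn1 znS)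
    ultimately have "(\<lambda>n. zn (Suc n)) \<longlonglongrightarrow> h p" by (rule Lim_transform_eventually)
    then show ?thesis using LIMSEQ_Suc[OF lim'] LIMSEQ_unique by blast
  qed
  have pn: "p \<noteq> 0" "p + p \<noteq> 0" using p(2) by auto
  define N' where "N' = {z \<in> N. p + h z \<noteq> 0}"
  have "N' = N \<inter> (\<lambda>z. p + h z) -` (- {0})" by (auto simp: N'_def)
  moreover have "open \<dots>" using N(1) by (intro continuous_open_preimage continuous_intros hc) auto
  ultimately have N'o: "open N'" by simp
  have pN': "p \<in> N'" using N(2) pn by (simp add: N'_def hp)
  define c where "c = (\<lambda>s. p * (1 - s) / (1 + s))"
  have c0: "c 0 = p" by (simp add: c_def)
  have nm1: "1 + s \<noteq> 0" if "cmod s < 1" for s :: complex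
    using that by (metis add_eq_0_iff less_irrefl norm_minus_cancel norm_one)
  have ch: "c holomorphic_on ball 0 1" unfolding c_def by (intro holomorphic_intros) (use nm1 in auto)
  have "isCont c 0" using holomorphic_on_imp_continuous_on[OF ch] by (simp add: continuous_on_eq_continuous_at)
  then have "(c \<longlongrightarrow> p) (at 0)" by (simp add: isCont_def c0)
  then have "\<forall>\<^sub>F s in at 0. c s \<in> N'" by (rule topological_tendstoD[OF _ N'o pN'])
  then obtain d0 where d0: "d0 > 0" "\<And>s. s \<noteq> 0 \<Longrightarrow> dist s 0 < d0 \<Longrightarrow> c s \<in> N'" by (auto simp: eventually_at)
  define d where "d = min d0 1"
  have d: "d > 0" "d \<le> 1" using d0 by (auto simp: d_def)
  have cN': "c s \<in> N'" if "cmod s < d" for s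
    using d0(2)[of s] that pN' c0 by (cases "s = 0") (auto simp: d_def)
  define K where "K = (\<lambda>s. (p - h (c s)) / (p + h (c s)))"
  have hch: "(\<lambda>s. h (c s)) holomorphic_on ball 0 d"
  proof -
    have "(h \<circ> c) holomorphic_on ball 0 d"
      using d cN' by (intro holomorphic_on_compose_gen[OF holomorphic_on_subset[OF ch] N(3)]) (auto simp: N'_def)
    then show ?thesis by (simp add: o_def)
  qed
  have Kh: "K holomorphic_on ball 0 d"
    unfolding K_def by (intro holomorphic_intros hch) (use cN' in \<open>auto simp: N'_def\<close>)
  have K0: "K 0 = 0" by (simp add: K_def c0 hp)
  have cRe: "(1 - (cmod (c s))\<^sup>2) / (cmod (p + c s))\<^sup>2 = Re s" if "cmod s < 1" for s
  proof -
    have "s \<noteq> -1" using that by auto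
    then show ?thesis using Re_Cayley[OF p(2), of "c s"] Cayley_inverse[OF p(2), of s] by (simp add: c_def)
  qed
  have cne: "p + c s \<noteq> 0" if "cmod s < 1" for s
  proof -
    have "p + c s = 2 * p / (1 + s)" using nm1[OF that] by (simp add: c_def divide_simps) (simp add: algebra_simps)
    then show ?thesis using pn nm1[OF that] by simp
  qed
  define t where "t = (\<lambda>n. (p - zn n) / (p + zn n))"
  have teq: "t n = (p - zn n) / (p + zn n)" for n by (simp add: t_def)
  have pz: "p + z \<noteq> 0" if "cmod z < 1" for z using that p(2) by (metis add_eq_0_iff less_irrefl norm_minus_cancel)
  have Ret: "Re (t n) = (1 - (cmod (zn n))\<^sup>2) / (cmod (p + zn n))\<^sup>2" for n
    unfolding t_def by (rule Re_Cayley[OF p(2)])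
  have Retpos: "Re (t n) > 0" for n
    unfolding Ret using zn1[of n] pz[OF zn1[of n]] by (intro divide_pos_pos) (auto simp: abs_square_less_1)
  have tlim: "t \<longlonglongrightarrow> 0"
  proof -
    have "(\<lambda>n. (p - zn n) / (p + zn n)) \<longlonglongrightarrow> (p - p) / (p + p)"
      by (intro tendsto_intros lim' pn)
    then show ?thesis by (simp add: t_def)
  qed
  have tc: "c (t n) = zn n" for n
    unfolding c_def t_def by (rule Cayley_inverse'(1)[OF p(2) pz[OF zn1]])
  have tK: "t (Suc n) = K (t n)" if "cmod (t n) < d" for n
  proof -
    have "zn n \<in> N" using cN'[OF that] tc[of n] by (simp add: N'_def)
    then have hz: "h (zn n) = g (zn n)" using zn1 by (rule N(4))
    have "K (t n) = (p - g (zn n)) / (p + g (zn n))" unfolding K_def tc hz ..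
    then show ?thesis unfolding t_def znS by simp
  qed
  \<comment> \<open>The Schwarz--Pick lemma is applied to \<open>zn n\<close> and to a second point
    \<open>w j\<close> that tends to \<open>p\<close> along the radius and has the real coordinate
    \<open>a j\<close>. Divided by \<open>a j\<close>, the inequality has a limit because
    \<open>K s / s\<close> tends to 1, and the limit says that \<open>g\<close> preserves the
    horodiscs at \<open>p\<close> along the orbit.\<close>
  have Julia: "Re (1 / t (Suc n)) \<ge> Re (1 / t n)" if K1: "deriv K 0 = 1" for n
  proof -
    define a where "a j = d / real (j + 2)" for j :: nat
    have a: "a j > 0" "cmod (of_real (a j)) < d" "a j < 1" for j
    proof -
      show "a j > 0" using d by (simp add: a_def)
      have "a j < d / 1" unfolding a_def using d by (intro divide_strict_left_mono) auto
      then show "cmod (of_real (a j)) < d" "a j < 1" using \<open>a j > 0\<close> d by auto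
    qed
    define w where "w j = c (of_real (a j))" for j
    have w1: "cmod (w j) < 1" for j
    proof -
      have cs: "cmod (of_real (a j)) < 1" using a[of j] d by linarith
      have "0 < (1 - (cmod (w j))\<^sup>2) / (cmod (p + w j))\<^sup>2"
        using cRe[OF cs] a(1)[of j] by (simp add: w_def)
      then have "0 < 1 - (cmod (w j))\<^sup>2" by (simp add: zero_less_divide_iff)
      then show ?thesis by (simp add: abs_square_less_1)
    qed
    have wC: "(p - w j) / (p + w j) = of_real (a j)" for j
    proof -
      have "complex_of_real (a j) \<noteq> - 1" using a(1)[of j] by (metis of_real_1 of_real_eq_iff of_real_minus less_minus_one_simps(1) less_irrefl less_trans)
      then show ?thesis unfolding w_def c_def by (rule Cayley_inverse[OF p(2)])
    qed
    have gwC: "(p - g (w j)) / (p + g (w j)) = K (of_real (a j))" for j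
      using cN'[OF a(2)[of j]] N(4)[of "w j"] w1[of j] by (simp add: K_def w_def N'_def)
    have ineq: "4 * Re (t n) * a j / (cmod (t n + of_real (a j)))\<^sup>2 \<le>
        4 * Re (t (Suc n)) * Re (K (of_real (a j))) / (cmod (t (Suc n) + cnj (K (of_real (a j)))))\<^sup>2" for j
    proof -
      have "pseudohyperbolic (g (zn n)) (g (w j)) \<le> pseudohyperbolic (zn n) (w j)"
        by (rule Schwarz_Pick[OF holo disc zn1 w1])
      then have "1 - (pseudohyperbolic (zn n) (w j))\<^sup>2 \<le> 1 - (pseudohyperbolic (g (zn n)) (g (w j)))\<^sup>2"
        by (simp add: power_mono pseudohyperbolic_nonneg)
      then show ?thesis
        using Cayley_pseudohyperbolic(2)[OF p(2) zn1[of n] w1[of j]]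
          Cayley_pseudohyperbolic(2)[OF p(2) disc[OF zn1[of n]] disc[OF w1[of j]]]
        unfolding wC gwC znS[symmetric] teq by simp
    qed
    have alim: "(\<lambda>j. of_real (a j)) \<longlonglongrightarrow> (0::complex)"
    proof -
      have "(\<lambda>j. d / real (j + 2)) \<longlonglongrightarrow> 0" by real_asymp
      then have "(\<lambda>j. complex_of_real (a j)) \<longlonglongrightarrow> of_real 0" unfolding a_def by (intro tendsto_of_real)
      then show ?thesis by simp
    qed
    have dK: "(K has_field_derivative 1) (at 0)"
      using holomorphic_derivI[OF Kh open_ball, of 0] d K1 by simp
    then have "((\<lambda>s. K s / s) \<longlongrightarrow> 1) (at 0)" using K0 by (simp add: has_field_derivative_iff)
    moreover have "filterlim (\<lambda>j. complex_of_real (a j)) (at 0) sequentially"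
      using alim a(1) by (auto simp: filterlim_at intro!: always_eventually) (metis less_irrefl)
    ultimately have q: "(\<lambda>j. K (of_real (a j)) / of_real (a j)) \<longlonglongrightarrow> 1" by (rule filterlim_compose)
    have q2: "(\<lambda>j. Re (K (of_real (a j))) / a j) \<longlonglongrightarrow> 1"
      using tendsto_Re[OF q] by (simp add: Re_divide_of_real)
    have Klim: "(\<lambda>j. K (of_real (a j))) \<longlonglongrightarrow> 0"
    proof -
      have "isCont K 0" using dK by (rule DERIV_isCont)
      from isCont_tendsto_compose[OF this alim] show ?thesis by (simp add: K0)
    qed
    have tne: "t n \<noteq> 0" for n using Retpos[of n] by auto
    have l1: "(\<lambda>j. 4 * Re (t n) / (cmod (t n + of_real (a j)))\<^sup>2) \<longlonglongrightarrow> 4 * Re (t n) / (cmod (t n + 0))\<^sup>2"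
      by (intro tendsto_intros alim) (use tne[of n] in auto)
    have l2: "(\<lambda>j. 4 * Re (t (Suc n)) * (Re (K (of_real (a j))) / a j) / (cmod (t (Suc n) + cnj (K (of_real (a j)))))\<^sup>2)
        \<longlonglongrightarrow> 4 * Re (t (Suc n)) * 1 / (cmod (t (Suc n) + cnj 0))\<^sup>2"
      by (intro tendsto_intros q2 Klim) (use tne[of "Suc n"] in auto)
    have "4 * Re (t n) / (cmod (t n + 0))\<^sup>2 \<le> 4 * Re (t (Suc n)) * 1 / (cmod (t (Suc n) + cnj 0))\<^sup>2"
    proof (rule LIMSEQ_le[OF l1 l2], intro exI allI impI)
      fix j :: nat
      show "4 * Re (t n) / (cmod (t n + of_real (a j)))\<^sup>2 \<le> 4 * Re (t (Suc n)) * (Re (K (of_real (a j))) / a j) / (cmod (t (Suc n) + cnj (K (of_real (a j)))))\<^sup>2"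
        using divide_right_mono[OF ineq[of j], of "a j"] a(1)[of j] by (simp add: mult.commute)
    qed
    then show ?thesis by (simp add: Re_divide cmod_power2)
  qed
  have "\<not> summable (\<lambda>n. Re (t n))"
  proof (rule parabolic_germ_not_summable[OF d(1) Kh K0 _ tlim Retpos tK])
    show "Re (K s) = 0" if "cmod s < d" "Re s = 0" for s
    proof -
      have s1: "cmod s < 1" using that d by simp
      have "cmod (c s) = 1"
        using cRe[OF s1] cne[OF s1] that(2) by (simp add: power2_eq_1_iff) (use norm_ge_zero[of "c s"] in linarith)
      then have "cmod (h (c s)) = 1" using cN'[OF that(1)] by (intro extension_unimodular[OF N(1,3,4)]) (auto simp: N'_def)
      then show ?thesis unfolding K_def Re_Cayley[OF p(2)] by simp
    qed
    show "(\<lambda>n. cmod (t (Suc n) - t n) / cmod (t (Suc n) + cnj (t n))) \<longlonglongrightarrow> 0"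
    proof -
      have "cmod (t (Suc n) - t n) / cmod (t (Suc n) + cnj (t n)) = pseudohyperbolic (zn (Suc n)) (zn n)" for n
        unfolding teq by (rule Cayley_pseudohyperbolic(1)[OF p(2) zn1 zn1, symmetric])
      then show ?thesis using rho by (simp only: zn_def)
    qed
    show "\<exists>\<beta>>0. \<forall>n. \<beta> \<le> Re (1 / t n)" if "deriv K 0 = 1"
    proof (intro exI conjI allI)
      show "Re (1 / t 0) > 0" using Retpos[of 0] by (simp add: Re_divide)
        (metis Retpos cmod_power2 divide_pos_pos less_irrefl zero_complex.simps(1) zero_less_norm_iff zero_less_power)
      show "Re (1 / t 0) \<le> Re (1 / t n)" for n
        by (rule lift_Suc_mono_le[of "\<lambda>n. Re (1 / t n)"]) (use Julia[OF that] in auto)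
    qed
  qed
  moreover have "summable (\<lambda>n. Re (t n))" if s: "summable (\<lambda>n. 1 - cmod (zn n))"
  proof (rule summable_comparison_test_ev)
    have "(\<lambda>n. cmod (p + zn n)) \<longlonglongrightarrow> cmod (p + p)" by (intro tendsto_intros lim')
    moreover have "cmod (p + p) = 2" using p(2) by (metis mult_2 norm_mult norm_numeral mult.right_neutral)
    ultimately have "\<forall>\<^sub>F n in sequentially. 1 < cmod (p + zn n)" by (intro order_tendstoD(1)) auto
    then show "\<forall>\<^sub>F n in sequentially. norm (Re (t n)) \<le> 2 * (1 - cmod (zn n))"
    proof eventually_elim
      case (elim n)
      have z: "0 \<le> 1 - (cmod (zn n))\<^sup>2" using zn1[of n] by (simp add: abs_square_le_1)
      have "Re (t n) \<le> (1 - (cmod (zn n))\<^sup>2) / 1"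
        unfolding Ret using elim z by (intro divide_left_mono) (auto simp: one_le_power)
      also have "\<dots> = (1 + cmod (zn n)) * (1 - cmod (zn n))" by (simp add: power2_eq_square algebra_simps)
      also have "\<dots> \<le> 2 * (1 - cmod (zn n))" using zn1[of n] by (intro mult_right_mono) auto
      finally show ?case using Retpos[of n] by simp
    qed
    show "summable (\<lambda>n. 2 * (1 - cmod (zn n)))" by (intro summable_mult s)
  qed
  ultimately show ?thesis by (auto simp: zn_def)
qed

end

section \<open>Inner functions of finite valence\<close>

lemma bounded_holomorphic_Cauchy_boundary:
  assumes h: "h holomorphic_on unit_disc" and M: "\<And>z. cmod z < 1 \<Longrightarrow> cmod (h z) \<le> M" and z: "cmod z < 1"
  shows "(LINT \<xi>|circle_measure. radial_limit h \<xi> * (\<xi> / (\<xi> - z))) = h z"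
proof (rule reproducing_kernel_radial_limit[OF h M z])
  show "continuous_on unit_circle (\<lambda>\<xi>. \<xi> / (\<xi> - z))"
    using z by (intro continuous_intros) auto
  fix F :: "complex \<Rightarrow> complex" assume "continuous_on (cball 0 1) F" "F holomorphic_on unit_disc"
  from circle_integral_Cauchy[OF this z] show "(LINT \<xi>|circle_measure. F \<xi> * (\<xi> / (\<xi> - z))) = F z" by simp
qed

text \<open>
  If \<open>F\<close> is inner and bounded away from zero near the circle, then \<open>F\<close> and its reflection
  \<open>1 / cnj (F (1 / cnj \<zeta>))\<close> have the same boundary values, so the Cauchy integral of the reflection
  over a larger circle represents \<open>F\<close>.
\<close>

lemma inner_reflection_extension:
  assumes F: "F holomorphic_on unit_disc" and F1: "\<And>z. cmod z < 1 \<Longrightarrow> cmod (F z) \<le> 1"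
    and inner: "AE \<xi> in circle_measure. cmod (radial_limit F \<xi>) = 1"
    and \<eta>: "\<eta> > 0" and r0: "0 < r0" "r0 < 1" and low: "\<And>z. r0 < cmod z \<Longrightarrow> cmod z < 1 \<Longrightarrow> \<eta> \<le> cmod (F z)"
  shows "\<exists>s>1. \<exists>H. H holomorphic_on ball 0 s \<and> (\<forall>z. cmod z < 1 \<longrightarrow> H z = F z)"
proof -
  have Fc: "continuous_on unit_disc F" by (rule holomorphic_on_imp_continuous_on[OF F])
  define Ft where "Ft = (\<lambda>\<zeta>. 1 / cnj (F (1 / cnj \<zeta>)))"
  define ann where "ann = {\<zeta>. 1 < cmod \<zeta> \<and> cmod \<zeta> < 1 / r0}"
  have ann_eq: "ann = ball 0 (1 / r0) - cball 0 1" by (auto simp: ann_def)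
  have ann_open: "open ann" unfolding ann_eq by (intro open_Diff) auto
  have in1: "r0 < cmod (1 / \<zeta>)" "cmod (1 / \<zeta>) < 1" if "\<zeta> \<in> ann" for \<zeta>
  proof -
    have c: "1 < cmod \<zeta>" "cmod \<zeta> < 1 / r0" using that by (auto simp: ann_def)
    have "cmod \<zeta> * r0 < 1" using c(2) r0 by (simp add: field_simps)
    moreover have "0 < cmod \<zeta>" using c(1) by linarith
    ultimately show "r0 < cmod (1 / \<zeta>)" by (simp add: norm_divide pos_less_divide_eq mult.commute)
    show "cmod (1 / \<zeta>) < 1" using c(1) by (simp add: norm_divide divide_less_eq)
  qed
  have Fth: "Ft holomorphic_on ann"
  proof -
    have c: "cnj \<circ> F \<circ> cnj holomorphic_on unit_disc"
    proof (rule holomorphic_on_compose_cnj_cnj)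
      have "cnj ` unit_disc \<subseteq> unit_disc" by auto
      then show "F holomorphic_on cnj ` unit_disc" using F holomorphic_on_subset by blast
    qed simp
    have "((cnj \<circ> F \<circ> cnj) \<circ> (\<lambda>\<zeta>. 1 / \<zeta>)) holomorphic_on ann"
      by (intro holomorphic_on_compose_gen[OF _ c] holomorphic_intros) (use in1 in \<open>auto simp: ann_def\<close>)
    then have "(\<lambda>\<zeta>. 1 / cnj (F (1 / cnj \<zeta>))) holomorphic_on ann"
    proof (intro holomorphic_intros)
      assume "(cnj \<circ> F \<circ> cnj \<circ> (\<lambda>\<zeta>. 1 / \<zeta>)) holomorphic_on ann"
      then show "(\<lambda>\<zeta>. cnj (F (1 / cnj \<zeta>))) holomorphic_on ann" by (simp add: o_def)
      fix \<zeta> assume "\<zeta> \<in> ann"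
      then have "\<eta> \<le> cmod (F (1 / cnj \<zeta>))"
        using in1[of \<zeta>] low[of "1 / cnj \<zeta>"] by (simp add: norm_divide)
      then show "cnj (F (1 / cnj \<zeta>)) \<noteq> 0" using \<eta> by auto
    qed
    then show ?thesis by (simp add: Ft_def)
  qed
  have Ftc: "continuous_on ann Ft" by (rule holomorphic_on_imp_continuous_on[OF Fth])
  have FtB: "cmod (Ft \<zeta>) \<le> 1 / \<eta>" if "\<zeta> \<in> ann" for \<zeta>
  proof -
    have "\<eta> \<le> cmod (F (1 / cnj \<zeta>))"
      using in1[OF that] low[of "1 / cnj \<zeta>"] by (simp add: norm_divide)
    then show ?thesis unfolding Ft_def norm_divide complex_mod_cnj norm_one using \<eta>
      by (intro divide_left_mono mult_pos_pos) auto
  qed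
  define s0 where "s0 = (1 + 1 / r0) / 2"
  have r01: "1 / r0 > 1" using r0 by simp
  have s0: "1 < s0" "s0 < 1 / r0" using r01 by (simp_all add: s0_def)
  \<comment> \<open>The exponent 1 puts the kernel into the form in which Cauchy-type integrals with
    a power in the denominator are differentiated.\<close>
  define H where "H z = contour_integral (circlepath 0 s0) (\<lambda>\<zeta>. Ft \<zeta> / (\<zeta> - z) ^ 1)" for z
  have circ_ann: "path_image (circlepath 0 s) \<subseteq> ann" if "1 < s" "s < 1 / r0" for s
    using that by (auto simp: ann_def)
  have Hh: "H holomorphic_on ball 0 s0"
  proof -
    have "(H has_field_derivative (of_nat 1 * contour_integral (circlepath 0 s0) (\<lambda>u. Ft u / (u - w) ^ Suc 1))) (at w)"
      if w: "w \<in> ball 0 s0" for w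
    proof (rule Cauchy_next_derivative_circlepath(2)[OF _ _ _ w])
      show "continuous_on (path_image (circlepath 0 s0)) Ft"
        by (rule continuous_on_subset[OF Ftc circ_ann[OF s0]])
      fix v :: complex assume v: "v \<in> ball 0 s0"
      have "(\<lambda>u. Ft u / (u - v) ^ 1) contour_integrable_on circlepath 0 s0"
      proof (rule contour_integrable_continuous_circlepath)
        show "continuous_on (path_image (circlepath 0 s0)) (\<lambda>u. Ft u / (u - v) ^ 1)"
          by (intro continuous_intros continuous_on_subset[OF Ftc circ_ann[OF s0]]) (use v s0 in auto)
      qed
      then show "((\<lambda>u. Ft u / (u - v) ^ 1) has_contour_integral H v) (circlepath 0 s0)"
        unfolding H_def by (rule has_contour_integral_integral)
    qed simp
    then show ?thesis unfolding holomorphic_on_open[OF open_ball] by blast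
  qed
  have key: "H z / (2 * of_real pi * \<i>) = F z" if z: "cmod z < 1" for z
  proof -
    have kc: "continuous_on unit_circle (\<lambda>\<xi>. Ft (of_real s * \<xi>) * (of_real s * \<xi> / (of_real s * \<xi> - z)))"
      if s: "1 < s" "s < 1 / r0" for s
    proof (intro continuous_intros continuous_on_compose2[OF Ftc])
      show "(\<lambda>\<xi>. of_real s * \<xi>) ` unit_circle \<subseteq> ann" using s by (auto simp: ann_def norm_mult)
      show "\<forall>\<xi>\<in>unit_circle. of_real s * \<xi> - z \<noteq> 0"
      proof
        fix \<xi> assume "\<xi> \<in> unit_circle"
        then have "cmod (of_real s * \<xi>) > cmod z" using s z by (simp add: norm_mult)
        then show "of_real s * \<xi> - z \<noteq> 0" by auto
      qed
    qed
    have A: "(LINT \<xi>|circle_measure. Ft (of_real s * \<xi>) * (of_real s * \<xi> / (of_real s * \<xi> - z))) =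
        contour_integral (circlepath 0 s) (\<lambda>\<zeta>. Ft \<zeta> / (\<zeta> - z)) / (2 * of_real pi * \<i>)"
      if s: "1 < s" "s < 1 / r0" for s
    proof -
      have "contour_integral (circlepath 0 1) (\<lambda>\<xi>. Ft (of_real s * \<xi>) * (of_real s * \<xi> / (of_real s * \<xi> - z)) / \<xi>) =
          contour_integral (circlepath 0 s) (\<lambda>\<zeta>. Ft \<zeta> / (\<zeta> - z))"
        unfolding circlepath_def
        by (subst (1 2) contour_integral_part_circlepath_eq) (simp_all add: mult_ac)
      then show ?thesis using circle_integral_eq_contour_integral[OF kc[OF s]] by simp
    qed
    \<comment> \<open>Circles in the annulus are homotopic there, and the integrand is holomorphic
      on it because \<open>z\<close> lies in the unit disc. So the value does not depend on the
      radius, which may shrink to 1.\<close>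
    have B: "contour_integral (circlepath 0 s) (\<lambda>\<zeta>. Ft \<zeta> / (\<zeta> - z)) = H z" if s: "1 < s" "s < 1 / r0" for s
    proof -
      have "contour_integral (circlepath 0 s) (\<lambda>\<zeta>. Ft \<zeta> / (\<zeta> - z)) = contour_integral (circlepath 0 s0) (\<lambda>\<zeta>. Ft \<zeta> / (\<zeta> - z))"
      proof (rule Cauchy_theorem_homotopic_loops[OF _ ann_open])
        show "(\<lambda>\<zeta>. Ft \<zeta> / (\<zeta> - z)) holomorphic_on ann"
          by (intro holomorphic_intros Fth) (use z in \<open>auto simp: ann_def\<close>)
        show "homotopic_loops ann (circlepath 0 s) (circlepath 0 s0)"
        proof (rule homotopic_loops_linear)
          fix t :: real and x :: real
          show "closed_segment (circlepath 0 s t) (circlepath 0 s0 t) \<subseteq> ann"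
          proof
            fix y assume "y \<in> closed_segment (circlepath 0 s t) (circlepath 0 s0 t)"
            then obtain u where u: "0 \<le> u" "u \<le> 1" "y = (1 - u) *\<^sub>R circlepath 0 s t + u *\<^sub>R circlepath 0 s0 t"
              by (auto simp: closed_segment_def)
            define E where "E = exp (2 * of_real pi * \<i> * of_real t)"
            have E: "cmod E = 1" unfolding E_def by (simp add: norm_exp_eq_Re)
            have "y = of_real ((1 - u) * s + u * s0) * E"
              unfolding u(3) circlepath E_def by (simp add: scaleR_conv_of_real algebra_simps)
            moreover have "1 < (1 - u) * s + u * s0" "(1 - u) * s + u * s0 < 1 / r0"
            proof -
              show "1 < (1 - u) * s + u * s0" using convex_bound_lt[of "-s" "-1" "-s0" "1-u" u] s s0 u by simp
              show "(1 - u) * s + u * s0 < 1 / r0" using convex_bound_lt[of s "1/r0" s0 "1-u" u] s s0 u by simp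
            qed
            ultimately show "y \<in> ann" using E by (auto simp: ann_def norm_mult simp del: of_real_add of_real_mult)
          qed
        qed auto
      qed auto
      then show ?thesis by (simp add: H_def)
    qed
    \<comment> \<open>Radii tending to 1 from above, written through their reciprocals
      \<open>q n\<close>: reflection takes the circle of radius \<open>s n\<close> to that of radius
      \<open>q n\<close>, where the radial limits of \<open>F\<close> are approached.\<close>
    define s where "s n = 1 / (1 - (1 - 1 / s0) / real (Suc (Suc n)))" for n
    have s0i: "0 < 1 - 1 / s0" "1 - 1 / s0 < 1" using s0 by auto
    define q where "q n = 1 - (1 - 1 / s0) / real (Suc (Suc n))" for n
    have q: "1 / s0 < q n" "q n < 1" "0 < q n" for n
    proof -
      have "(1 - 1 / s0) / real (Suc (Suc n)) < (1 - 1 / s0) / 1"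
        using s0i by (intro divide_strict_left_mono) auto
      then show "1 / s0 < q n" by (simp add: q_def)
      then show "0 < q n" using s0 by (metis less_trans zero_less_divide_1_iff zero_less_one)
      show "q n < 1" using s0i by (simp add: q_def)
    qed
    have sq: "s n = 1 / q n" for n by (simp add: s_def q_def)
    have s: "1 < s n" "s n < 1 / r0" for n
    proof -
      show "1 < s n" using q[of n] by (simp add: sq)
      have "1 / q n < s0" using q[of n] s0 by (simp add: field_simps)
      then show "s n < 1 / r0" using s0 by (simp add: sq)
    qed
    have "(\<lambda>n. LINT \<xi>|circle_measure. Ft (of_real (s n) * \<xi>) * (of_real (s n) * \<xi> / (of_real (s n) * \<xi> - z)))
      \<longlonglongrightarrow> (LINT \<xi>|circle_measure. radial_limit F \<xi> * (\<xi> / (\<xi> - z)))"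
    proof (rule integral_dominated_convergence[where w = "\<lambda>\<xi>. 1 / \<eta> * (s0 / (1 - cmod z))"])
      have q1: "(\<lambda>\<xi>. \<xi> / (\<xi> - z)) \<in> borel_measurable circle_measure"
        using z by (intro borel_measurable_circle_continuous continuous_intros) auto
      note [measurable] = q1 measurable_radial_limit[OF Fc]
      show "(\<lambda>\<xi>. radial_limit F \<xi> * (\<xi> / (\<xi> - z))) \<in> borel_measurable circle_measure" by measurable
      show "(\<lambda>\<xi>. Ft (of_real (s n) * \<xi>) * (of_real (s n) * \<xi> / (of_real (s n) * \<xi> - z))) \<in> borel_measurable circle_measure" for n
        by (intro borel_measurable_circle_continuous kc s)
      show "AE \<xi> in circle_measure. norm (Ft (of_real (s n) * \<xi>) * (of_real (s n) * \<xi> / (of_real (s n) * \<xi> - z))) \<le> 1 / \<eta> * (s0 / (1 - cmod z))" for n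
      proof (rule AE_I2)
        fix \<xi> assume "\<xi> \<in> space circle_measure"
        then have x: "cmod \<xi> = 1" by simp
        have sn: "cmod (of_real (s n) * \<xi>) = s n" using x s(1)[of n] by (simp add: norm_mult)
        have l: "1 - cmod z \<le> cmod (of_real (s n) * \<xi> - z)"
          using norm_triangle_ineq2[of "of_real (s n) * \<xi>" z] s(1)[of n] unfolding sn by linarith
        have "1 / q n < s0" using q[of n] s0 by (simp add: field_simps)
        then have "s n \<le> s0" by (simp add: sq)
        then have "cmod (of_real (s n) * \<xi> / (of_real (s n) * \<xi> - z)) \<le> s0 / (1 - cmod z)"
          unfolding norm_divide sn using l z s0 by (intro frac_le) auto
        moreover have "cmod (Ft (of_real (s n) * \<xi>)) \<le> 1 / \<eta>"
          using s[of n] by (intro FtB) (simp add: ann_def sn)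
        ultimately show "norm (Ft (of_real (s n) * \<xi>) * (of_real (s n) * \<xi> / (of_real (s n) * \<xi> - z))) \<le> 1 / \<eta> * (s0 / (1 - cmod z))"
          unfolding norm_mult[of "Ft _"] using \<eta> by (intro mult_mono) auto
      qed
      have "AE \<xi> in circle_measure. ((\<lambda>r. F (of_real r * \<xi>)) \<longlongrightarrow> radial_limit F \<xi>) (at_left 1)"
        by (rule Fatou_radial_limits[OF F]) (rule F1)
      moreover have "AE \<xi> in circle_measure. \<xi> \<in> unit_circle" using AE_space[of circle_measure] by simp
      ultimately show "AE \<xi> in circle_measure. (\<lambda>n. Ft (of_real (s n) * \<xi>) * (of_real (s n) * \<xi> / (of_real (s n) * \<xi> - z))) \<longlonglongrightarrow> radial_limit F \<xi> * (\<xi> / (\<xi> - z))"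
        using inner
      proof eventually_elim
        case (elim \<xi>)
        have xx: "\<xi> * cnj \<xi> = 1" using elim(2) by (simp add: complex_norm_square[symmetric])
        have xn: "\<xi> \<noteq> 0" using elim(2) by auto
        have qlim: "q \<longlonglongrightarrow> 1" unfolding q_def by real_asymp
        then have "filterlim q (at_left 1) sequentially"
          using q(2) by (auto simp: filterlim_at intro!: always_eventually) (metis less_irrefl)
        from filterlim_compose[OF elim(1) this]
        have Fq: "(\<lambda>n. F (of_real (q n) * \<xi>)) \<longlonglongrightarrow> radial_limit F \<xi>" .
        have Fte: "Ft (of_real (s n) * \<xi>) = 1 / cnj (F (of_real (q n) * \<xi>))" for n
        proof -
          have "1 / cnj \<xi> = \<xi>" using xx xn by (simp add: field_simps)
          moreover have "1 / cnj (of_real (s n) * \<xi>) = of_real (q n) * (1 / cnj \<xi>)"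
            by (simp add: sq)
          ultimately have "1 / cnj (of_real (s n) * \<xi>) = of_real (q n) * \<xi>" by (simp only:)
          then show ?thesis by (simp only: Ft_def)
        qed
        have rl: "radial_limit F \<xi> \<noteq> 0" using elim(3) by auto
        have "(\<lambda>n. 1 / cnj (F (of_real (q n) * \<xi>))) \<longlonglongrightarrow> 1 / cnj (radial_limit F \<xi>)"
          using rl by (intro tendsto_intros Fq) auto
        also have "1 / cnj (radial_limit F \<xi>) = radial_limit F \<xi>"
        proof -
          have "radial_limit F \<xi> * cnj (radial_limit F \<xi>) = 1"
            using elim(3) by (simp add: complex_norm_square[symmetric])
          then show ?thesis using rl by (simp add: field_simps)
        qed
        finally have l1: "(\<lambda>n. Ft (of_real (s n) * \<xi>)) \<longlonglongrightarrow> radial_limit F \<xi>" by (simp only: Fte)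
        have "s \<longlonglongrightarrow> 1" unfolding s_def by real_asymp
        then have sl: "(\<lambda>n. complex_of_real (s n)) \<longlonglongrightarrow> of_real 1" by (rule tendsto_of_real)
        have "1 * \<xi> - z \<noteq> 0" using elim(2) z by auto
        then have "(\<lambda>n. of_real (s n) * \<xi> / (of_real (s n) * \<xi> - z)) \<longlonglongrightarrow> of_real 1 * \<xi> / (of_real 1 * \<xi> - z)"
          by (intro tendsto_intros sl) auto
        from tendsto_mult[OF l1 this] show ?case by simp
      qed
    qed simp
    moreover have "(LINT \<xi>|circle_measure. radial_limit F \<xi> * (\<xi> / (\<xi> - z))) = F z"
      by (rule bounded_holomorphic_Cauchy_boundary[OF F F1 z])
    ultimately have "(\<lambda>n::nat. H z / (2 * of_real pi * \<i>)) \<longlonglongrightarrow> F z" by (simp only: A[OF s] B[OF s])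
    then show ?thesis using LIMSEQ_unique tendsto_const by blast
  qed
  have "(\<lambda>z. H z / (2 * of_real pi * \<i>)) holomorphic_on ball 0 s0" by (intro holomorphic_intros Hh) auto
  then show ?thesis using s0(1) key by blast
qed

section \<open>Valence near the circle and convergence of the orbit of 0\<close>

lemma finite_separated_radius:
  assumes "finite Z" "Z \<subseteq> unit_disc"
  shows "\<exists>\<epsilon>>0. (\<forall>x\<in>Z. cmod x + \<epsilon> < 1) \<and> (\<forall>x\<in>Z. \<forall>y\<in>Z. x \<noteq> y \<longrightarrow> 2 * \<epsilon> \<le> dist x y)"
proof -
  define D where "D = (\<lambda>(x, y). dist x y) ` {(x, y). x \<in> Z \<and> y \<in> Z \<and> x \<noteq> y} \<union> (\<lambda>x. 1 - cmod x) ` Z \<union> {1}"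
  have "finite {(x, y). x \<in> Z \<and> y \<in> Z \<and> x \<noteq> y}"
    by (rule finite_subset[of _ "Z \<times> Z"]) (use assms in auto)
  then have fD: "finite D" using assms by (simp add: D_def)
  have D0: "D \<noteq> {}" by (simp add: D_def)
  have pos: "\<forall>d\<in>D. d > 0" using assms(2) by (auto simp: D_def)
  define \<epsilon> where "\<epsilon> = Min D / 2"
  have mp: "Min D > 0" using fD D0 pos by simp
  have le: "Min D \<le> d" if "d \<in> D" for d using fD that by simp
  show ?thesis
  proof (intro exI conjI ballI impI)
    show "\<epsilon> > 0" using mp by (simp add: \<epsilon>_def)
    show "cmod x + \<epsilon> < 1" if "x \<in> Z" for x
      using le[of "1 - cmod x"] that mp by (simp add: \<epsilon>_def D_def)
    show "2 * \<epsilon> \<le> dist x y" if "x \<in> Z" "y \<in> Z" "x \<noteq> y" for x y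
      using le[of "dist x y"] that by (force simp: \<epsilon>_def D_def)
  qed
qed

text \<open>Let \<open>w0\<close> have the largest possible number of distinct preimages. By the
  open mapping theorem all values near \<open>w0\<close> are taken in each of the small disjoint
  discs around these preimages, so a further preimage near the circle would exceed the
  maximum.\<close>

lemma finite_valence_avoids_near_circle:
  assumes g: "g holomorphic_on unit_disc" and disc: "\<And>z. cmod z < 1 \<Longrightarrow> cmod (g z) < 1"
    and nc: "\<not> g constant_on unit_disc"
    and fin: "\<And>w. cmod w < 1 \<Longrightarrow> finite {z \<in> unit_disc. g z = w} \<and> card {z \<in> unit_disc. g z = w} \<le> N"
  shows "\<exists>w0 \<delta> r0. cmod w0 < 1 \<and> \<delta> > 0 \<and> 0 < r0 \<and> r0 < 1 \<and>
    (\<forall>z. r0 < cmod z \<and> cmod z < 1 \<longrightarrow> \<delta> \<le> cmod (g z - w0))"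
proof -
  let ?c = "\<lambda>w. card {z \<in> unit_disc. g z = w}"
  have "\<exists>w. cmod w < 1 \<and> (\<forall>y. cmod y < 1 \<longrightarrow> ?c y \<le> ?c w)"
    by (rule ex_has_greatest_nat[of _ 0 _ "Suc N"]) (use fin in \<open>auto simp: less_Suc_eq_le\<close>)
  then obtain w0 where w0: "cmod w0 < 1" "\<And>y. cmod y < 1 \<Longrightarrow> ?c y \<le> ?c w0" by blast
  define Z where "Z = {z \<in> unit_disc. g z = w0}"
  have Z: "finite Z" "Z \<subseteq> unit_disc" using fin[OF w0(1)] by (auto simp: Z_def)
  obtain \<epsilon> where \<epsilon>: "\<epsilon> > 0" "\<And>x. x \<in> Z \<Longrightarrow> cmod x + \<epsilon> < 1"
      "\<And>x y. x \<in> Z \<Longrightarrow> y \<in> Z \<Longrightarrow> x \<noteq> y \<Longrightarrow> 2 * \<epsilon> \<le> dist x y"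
    using finite_separated_radius[OF Z] by blast
  have sub: "ball x \<epsilon> \<subseteq> unit_disc" if "x \<in> Z" for x
  proof
    fix y assume "y \<in> ball x \<epsilon>"
    then have "cmod y \<le> cmod x + \<epsilon>" using norm_triangle_ineq[of x "y - x"] by (auto simp: dist_norm norm_minus_commute)
    then show "y \<in> unit_disc" using \<epsilon>(2)[OF that] by simp
  qed
  define O' where "O' = (\<Inter>x\<in>Z. g ` ball x \<epsilon>) \<inter> unit_disc"
  have "open (\<Inter>x\<in>Z. g ` ball x \<epsilon>)"
    by (intro open_INT Z ballI open_mapping_thm[OF g open_ball connected_ball open_ball sub nc])
  then have "open O'" unfolding O'_def by (intro open_Int) auto
  moreover have "w0 \<in> O'" using w0(1) \<epsilon>(1) by (force simp: O'_def Z_def)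
  ultimately obtain \<delta> where \<delta>: "\<delta> > 0" "ball w0 \<delta> \<subseteq> O'" by (meson open_contains_ball)
  \<comment> \<open>The entry \<open>1/2\<close> makes the set nonempty and the radius positive in
    any case.\<close>
  define r0 where "r0 = Max (insert (1/2) ((\<lambda>x. cmod x + \<epsilon>) ` Z))"
  have "1 / 2 \<le> r0" unfolding r0_def using Z(1) by (intro Max_ge) auto
  moreover have "r0 < 1" unfolding r0_def using Z(1) \<epsilon>(2) by (subst Max_less_iff) auto
  moreover have "cmod x + \<epsilon> \<le> r0" if "x \<in> Z" for x unfolding r0_def using Z(1) that by (intro Max_ge) auto
  ultimately have r0: "1 / 2 \<le> r0" "r0 < 1" "\<And>x. x \<in> Z \<Longrightarrow> cmod x + \<epsilon> \<le> r0" by blast+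
  have "\<delta> \<le> cmod (g z - w0)" if z: "r0 < cmod z" "cmod z < 1" for z
  proof (rule ccontr)
    assume "\<not> \<delta> \<le> cmod (g z - w0)"
    then have "g z \<in> ball w0 \<delta>" by (simp add: dist_norm norm_minus_commute)
    then have gz: "g z \<in> O'" using \<delta> by blast
    then have "\<forall>x\<in>Z. \<exists>q. q \<in> ball x \<epsilon> \<and> g q = g z" by (force simp: O'_def)
    \<comment> \<open>One solution \<open>q x\<close> of \<open>g q = g z\<close> close to each
      preimage \<open>x\<close> of \<open>w0\<close>. They are distinct because the discs are
      disjoint, and \<open>z\<close> itself is one more.\<close>
    then obtain q where q: "\<And>x. x \<in> Z \<Longrightarrow> q x \<in> ball x \<epsilon> \<and> g (q x) = g z" by metis
    have inj: "inj_on q Z"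
    proof (rule inj_onI, rule ccontr)
      fix x y assume xy: "x \<in> Z" "y \<in> Z" "q x = q y" "x \<noteq> y"
      have "dist x y \<le> dist x (q x) + dist y (q x)" by (rule dist_triangle2)
      also have "\<dots> < 2 * \<epsilon>" using q[OF xy(1)] q[OF xy(2)] xy(3) by simp
      finally show False using \<epsilon>(3)[OF xy(1,2,4)] by simp
    qed
    have zn: "z \<notin> q ` Z"
    proof
      assume "z \<in> q ` Z"
      then obtain x where x: "x \<in> Z" "z = q x" by blast
      have "cmod z \<le> cmod x + \<epsilon>"
        using norm_triangle_ineq[of x "z - x"] q[OF x(1)] x(2) by (auto simp: dist_norm norm_minus_commute)
      then show False using r0(3)[OF x(1)] z(1) by simp
    qed
    have "insert z (q ` Z) \<subseteq> {z' \<in> unit_disc. g z' = g z}"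
    proof -
      have "q x \<in> unit_disc" if "x \<in> Z" for x using subsetD[OF sub[OF that]] q[OF that] by blast
      then show ?thesis using z(2) q by auto
    qed
    then have "card (insert z (q ` Z)) \<le> ?c (g z)"
      using fin[OF disc[OF z(2)]] by (intro card_mono) auto
    then have "Suc (card Z) \<le> ?c (g z)" using Z(1) zn by (simp add: card_image[OF inj])
    then show False using w0(2)[OF disc[OF z(2)]] by (simp add: Z_def)
  qed
  then show ?thesis using w0(1) \<delta>(1) r0(1,2) by (intro exI[of _ w0] exI[of _ \<delta>] exI[of _ r0]) auto
qed

text \<open>By compactness the sequence is eventually close to the finite set \<open>A\<close>. When
  the steps are small it cannot pass from the neighbourhood of one point of \<open>A\<close> to that
  of another, so it stays with a single one.\<close>

lemma convergent_if_finite_limit_points: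
  fixes x :: "nat \<Rightarrow> 'a::metric_space"
  assumes K: "compact K" "\<And>n. x n \<in> K" and step: "(\<lambda>n. dist (x (Suc n)) (x n)) \<longlonglongrightarrow> 0"
    and A: "finite A" "\<And>r l. strict_mono r \<Longrightarrow> (x \<circ> r) \<longlonglongrightarrow> l \<Longrightarrow> l \<in> A"
  shows "\<exists>a\<in>A. x \<longlonglongrightarrow> a"
proof -
  have near: "\<exists>M. \<forall>n\<ge>M. \<exists>a\<in>A. dist (x n) a < e" if e: "e > 0" for e
  proof (rule ccontr)
    assume "\<not> ?thesis"
    then have "\<forall>M. \<exists>n\<ge>M. \<forall>a\<in>A. e \<le> dist (x n) a" by (metis not_le)
    then have "infinite {n. \<forall>a\<in>A. e \<le> dist (x n) a}"
      unfolding infinite_nat_iff_unbounded_le by blast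
    from infinite_enumerate[OF this] obtain r :: "nat \<Rightarrow> nat" where r: "strict_mono r" "\<And>n a. a \<in> A \<Longrightarrow> e \<le> dist (x (r n)) a"
      by blast
    have "\<forall>n. (x \<circ> r) n \<in> K" using K(2) by simp
    then obtain l r' where l: "l \<in> K" "strict_mono r'" "((x \<circ> r) \<circ> r') \<longlonglongrightarrow> l"
      using K(1) unfolding compact_def by meson
    have "l \<in> A" using A(2)[of "r \<circ> r'" l] l strict_mono_o[OF r(1) l(2)] by (simp add: o_assoc)
    then have "e \<le> dist ((x \<circ> r \<circ> r') n) l" for n using r(2) by simp
    moreover have "(\<lambda>n. dist ((x \<circ> r \<circ> r') n) l) \<longlonglongrightarrow> 0" using l(3) by (rule tendsto_dist_iff[THEN iffD1])
    ultimately have "e \<le> 0" by (intro tendsto_lowerbound[of _ 0 sequentially e]) auto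
    then show False using e by simp
  qed
  obtain d where d: "d > 0" "\<And>a b. a \<in> A \<Longrightarrow> b \<in> A \<Longrightarrow> a \<noteq> b \<Longrightarrow> d \<le> dist a b"
  proof -
    define D where "D = insert 1 ((\<lambda>(a, b). dist a b) ` {(a, b). a \<in> A \<and> b \<in> A \<and> a \<noteq> b})"
    have "finite {(a, b). a \<in> A \<and> b \<in> A \<and> a \<noteq> b}" by (rule finite_subset[of _ "A \<times> A"]) (use A(1) in auto)
    then have fD: "finite D" by (simp add: D_def)
    have "\<forall>d\<in>D. d > 0" by (auto simp: D_def)
    moreover have "D \<noteq> {}" by (simp add: D_def)
    ultimately have "Min D > 0" using fD by simp
    moreover have "Min D \<le> dist a b" if "a \<in> A" "b \<in> A" "a \<noteq> b" for a b
      using fD that by (intro Min_le) (auto simp: D_def)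
    ultimately show ?thesis using that by blast
  qed
  obtain M1 where M1: "\<And>n. n \<ge> M1 \<Longrightarrow> \<exists>a\<in>A. dist (x n) a < d / 4" using near[of "d/4"] d(1) by auto
  obtain M2 where M2: "\<And>n. n \<ge> M2 \<Longrightarrow> dist (x (Suc n)) (x n) < d / 4"
    using order_tendstoD(2)[OF step, of "d/4"] d(1) by (auto simp: eventually_sequentially)
  define M where "M = max M1 M2"
  obtain a where a: "a \<in> A" "dist (x M) a < d / 4" using M1[of M] by (auto simp: M_def)
  have stay: "dist (x n) a < d / 4" if "n \<ge> M" for n
    using that
  proof (induction n rule: dec_induct)
    case (step n)
    obtain b where b: "b \<in> A" "dist (x (Suc n)) b < d / 4" using M1[of "Suc n"] step by (auto simp: M_def)
    have "dist a b \<le> dist (x n) a + dist (x (Suc n)) (x n) + dist (x (Suc n)) b"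
      using dist_triangle[of a b "x n"] dist_triangle[of "x n" b "x (Suc n)"] by (simp add: dist_commute)
    also have "\<dots> < d" using step b(2) M2[of n] d(1) by (simp add: M_def)
    finally have "a = b" using d(2)[OF a(1) b(1)] by force
    then show ?case using b by simp
  qed (rule a)
  have "x \<longlonglongrightarrow> a"
  proof (rule metric_LIMSEQ_I)
    fix e :: real assume "e > 0"
    then have "min e (d / 4) > 0" using d(1) by simp
    from near[OF this] obtain M3 where M3: "\<And>n. n \<ge> M3 \<Longrightarrow> \<exists>b\<in>A. dist (x n) b < min e (d / 4)" by blast
    have "dist (x n) a < e" if n: "n \<ge> max M M3" for n
    proof -
      obtain b where b: "b \<in> A" "dist (x n) b < min e (d / 4)" using M3[of n] n by auto
      have "dist a b \<le> dist (x n) a + dist (x n) b" by (rule dist_triangle3)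
      also have "\<dots> < d" using stay[of n] n b(2) d(1) by simp
      finally have "a = b" using d(2)[OF a(1) b(1)] by force
      then show ?thesis using b by simp
    qed
    then show "\<exists>no. \<forall>n\<ge>no. dist (x n) a < e" by blast
  qed
  then show ?thesis using a(1) by blast
qed

context inner_boundary_map
begin

text \<open>The Moebius map that sends the avoided value \<open>w0\<close> to 0 turns
  \<open>g\<close> into an inner function bounded away from zero near the circle, which reflection
  extends. The inverse Moebius map has no pole on the values of the extension over the closed disc,
  hence none on a slightly larger disc, by compactness.\<close>

theorem finite_valence_extension:
  assumes nc: "\<not> g constant_on unit_disc"
    and fin: "\<And>w. cmod w < 1 \<Longrightarrow> finite {z \<in> unit_disc. g z = w} \<and> card {z \<in> unit_disc. g z = w} \<le> N"
  shows "\<exists>s>1. \<exists>h. h holomorphic_on ball 0 s \<and> (\<forall>z. cmod z < 1 \<longrightarrow> h z = g z)"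
proof -
  obtain w0 \<delta> r0 where w0: "cmod w0 < 1" and \<delta>: "\<delta> > 0" and r0: "0 < r0" "r0 < 1"
    and low: "\<And>z. r0 < cmod z \<Longrightarrow> cmod z < 1 \<Longrightarrow> \<delta> \<le> cmod (g z - w0)"
    using finite_valence_avoids_near_circle[OF holo disc nc fin] by blast
  have den: "1 - cnj w0 * u \<noteq> 0" if "cmod u \<le> 1" for u using disc_denominator_nonzero[OF w0 that] .
  define F where "F z = (g z - w0) / (1 - cnj w0 * g z)" for z
  have Fh: "F holomorphic_on unit_disc"
    unfolding F_def using den disc by (intro holomorphic_intros holo) (auto simp: less_imp_le)
  have F1: "cmod (F z) < 1" if "cmod z < 1" for z
    using pseudohyperbolic_lt_1[OF w0 disc[OF that]] by (simp add: pseudohyperbolic_def F_def)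
  have low': "\<delta> / 2 \<le> cmod (F z)" if "r0 < cmod z" "cmod z < 1" for z
  proof -
    have "cmod (1 - cnj w0 * g z) \<le> 1 + cmod w0 * cmod (g z)"
      using norm_triangle_ineq4[of 1 "cnj w0 * g z"] by (simp add: norm_mult)
    also have "\<dots> \<le> 1 + 1 * 1" using w0 disc[OF that(2)] by (intro add_mono mult_mono) auto
    finally have "cmod (1 - cnj w0 * g z) \<le> 2" by simp
    then show ?thesis unfolding F_def norm_divide using low[OF that] \<delta> den[of "g z"] disc[OF that(2)]
      by (intro frac_le) auto
  qed
  have lim1: "AE \<xi> in circle_measure. cmod (radial_limit F \<xi>) = 1"
  proof -
    have "AE \<xi> in circle_measure. \<xi> \<in> unit_circle" using AE_space[of circle_measure] by simp
    with G_limit show ?thesis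
    proof eventually_elim
      case (elim \<xi>)
      have G1: "cmod (G \<xi>) = 1" using G_unit elim(2) by simp
      have "((\<lambda>r. (g (of_real r * \<xi>) - w0) / (1 - cnj w0 * g (of_real r * \<xi>))) \<longlongrightarrow> (G \<xi> - w0) / (1 - cnj w0 * G \<xi>)) (at_left 1)"
        using den[of "G \<xi>"] G1 by (intro tendsto_intros elim(1)) auto
      then have e: "radial_limit F \<xi> = (G \<xi> - w0) / (1 - cnj w0 * G \<xi>)"
        by (intro radial_limitI) (simp add: F_def)
      have "1 - (pseudohyperbolic (G \<xi>) w0)\<^sup>2 = 0"
        using one_minus_pseudohyperbolic_sq[OF w0, of "G \<xi>"] G1 by simp
      then have "(cmod (radial_limit F \<xi>))\<^sup>2 = 1" unfolding e pseudohyperbolic_def by simp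
      then show ?case by (simp add: power2_eq_1_iff) (use norm_ge_zero[of "radial_limit F \<xi>"] in linarith)
    qed
  qed
  obtain s H where s: "s > 1" and H: "H holomorphic_on ball 0 s" "\<And>z. cmod z < 1 \<Longrightarrow> H z = F z"
    using inner_reflection_extension[OF Fh less_imp_le[OF F1] lim1 _ r0 low'] \<delta> by force
  have Hc: "continuous_on (ball 0 s) H" using H(1) by (rule holomorphic_on_imp_continuous_on)
  have H1: "cmod (H z) \<le> 1" if "cmod z \<le> 1" for z
  proof -
    have "z \<in> closure unit_disc" using that by simp
    moreover have "continuous_on (closure unit_disc) (\<lambda>z. cmod (H z))"
      using s by (intro continuous_intros continuous_on_subset[OF Hc]) auto
    ultimately show ?thesis
      using continuous_le_on_closure[of unit_disc "\<lambda>z. cmod (H z)" z 1] H(2) F1 by (force simp: less_imp_le)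
  qed
  define O' where "O' = {z \<in> ball 0 s. 1 + cnj w0 * H z \<noteq> 0}"
  have "O' = ball 0 s \<inter> (\<lambda>z. 1 + cnj w0 * H z) -` (- {0})" by (auto simp: O'_def)
  moreover have "open \<dots>" by (intro continuous_open_preimage continuous_intros Hc) auto
  ultimately have oO: "open O'" by simp
  have cO: "cball 0 1 \<subseteq> O'"
  proof
    fix z :: complex assume "z \<in> cball 0 1"
    then have z: "cmod z \<le> 1" by simp
    then have "1 - cnj w0 * (- H z) \<noteq> 0" using H1 by (intro den) auto
    then show "z \<in> O'" using z s by (simp add: O'_def)
  qed
  obtain e where e: "e > 0" "(\<Union>x\<in>cball 0 1. ball x e) \<subseteq> O'"
  proof -
    have "compact (cball (0::complex) 1)" by simp
    from compact_subset_open_imp_ball_epsilon_subset[OF this oO cO] that show ?thesis by blast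
  qed
  have sub: "ball 0 (1 + e) \<subseteq> O'"
  proof
    fix z :: complex assume z: "z \<in> ball 0 (1 + e)"
    show "z \<in> O'"
    proof (cases "cmod z \<le> 1")
      case True
      then show ?thesis using cO by auto
    next
      case False
      define x where "x = z / of_real (cmod z)"
      have "cmod x = 1" using False by (auto simp: x_def norm_divide)
      moreover have "dist x z < e"
      proof -
        have zz: "z = of_real (cmod z) * x" using False by (auto simp: x_def)
        have "x - z = x - of_real (cmod z) * x" by (rule arg_cong[OF zz])
        then have "x - z = of_real (1 - cmod z) * x" by (simp add: left_diff_distrib)
        then have "dist x z = \<bar>1 - cmod z\<bar>" using \<open>cmod x = 1\<close> by (simp only: dist_norm norm_mult norm_of_real mult_1_right)
        then show ?thesis using False z by simp
      qed
      ultimately show ?thesis using e(2) by force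
    qed
  qed
  show ?thesis
  proof (intro exI conjI allI impI)
    show "1 + e > 1" using e by simp
    show "(\<lambda>z. (H z + w0) / (1 + cnj w0 * H z)) holomorphic_on ball 0 (1 + e)"
      using sub by (intro holomorphic_intros holomorphic_on_subset[OF H(1)]) (auto simp: O'_def)
    fix z :: complex assume z: "cmod z < 1"
    define u where "u = g z"
    have u: "1 - cnj w0 * u \<noteq> 0" using den disc[OF z] by (simp add: u_def less_imp_le)
    have ww: "1 - w0 * cnj w0 \<noteq> 0" using den[of w0] w0 by (simp add: mult.commute)
    have a: "H z + w0 = u * (1 - w0 * cnj w0) / (1 - cnj w0 * u)" "1 + cnj w0 * H z = (1 - w0 * cnj w0) / (1 - cnj w0 * u)"
      unfolding H(2)[OF z] F_def u_def[symmetric] using u by (simp_all add: divide_simps) (simp_all add: algebra_simps)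
    show "(H z + w0) / (1 + cnj w0 * H z) = g z"
      unfolding a using u ww by (simp add: u_def)
  qed
qed

text \<open>Consecutive points of the orbit approach each other, so every limit point is a fixed
  point of the extension in the closed disc, and there are finitely many of these. As no fixed point
  lies inside, the limit is on the circle.\<close>

theorem finite_valence_orbit_converges:
  assumes ext: "s > 1" "h holomorphic_on ball 0 s" "\<And>z. cmod z < 1 \<Longrightarrow> h z = g z"
    and nofix: "\<And>z. cmod z < 1 \<Longrightarrow> g z \<noteq> z"
    and rho: "(\<lambda>n. pseudohyperbolic ((g ^^ Suc n) 0) ((g ^^ n) 0)) \<longlonglongrightarrow> 0"
  shows "\<exists>p. cmod p = 1 \<and> (\<lambda>n. (g ^^ n) 0) \<longlonglongrightarrow> p"
proof -
  define x where "x = (\<lambda>n. (g ^^ n) 0)"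
  have x1: "cmod (x n) < 1" for n unfolding x_def by (rule funpow_disc) simp
  have xS: "x (Suc n) = g (x n)" for n by (simp add: x_def)
  have hc: "continuous_on (ball 0 s) h" using ext(2) by (rule holomorphic_on_imp_continuous_on)
  have step: "(\<lambda>n. dist (x (Suc n)) (x n)) \<longlonglongrightarrow> 0"
  proof (rule Lim_null_comparison)
    show "(\<lambda>n. pseudohyperbolic (x (Suc n)) (x n) * 2) \<longlonglongrightarrow> 0"
      using tendsto_mult_left_zero[OF rho, of 2] by (simp add: x_def)
    show "\<forall>\<^sub>F n in sequentially. norm (dist (x (Suc n)) (x n)) \<le> pseudohyperbolic (x (Suc n)) (x n) * 2"
    proof (rule always_eventually, rule allI)
      fix n
      have "cmod (1 - cnj (x n) * x (Suc n)) \<le> 1 + cmod (x n) * cmod (x (Suc n))"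
        using norm_triangle_ineq4[of 1 "cnj (x n) * x (Suc n)"] by (simp add: norm_mult)
      also have "\<dots> \<le> 1 + 1 * 1" using x1[of n] x1[of "Suc n"] by (intro add_mono mult_mono) auto
      finally have le: "cmod (1 - cnj (x n) * x (Suc n)) \<le> 2" by simp
      have "1 - cnj (x n) * x (Suc n) \<noteq> 0" using disc_denominator_nonzero[OF x1[of n], of "x (Suc n)"] x1[of "Suc n"] by simp
      then have "dist (x (Suc n)) (x n) = pseudohyperbolic (x (Suc n)) (x n) * cmod (1 - cnj (x n) * x (Suc n))"
        by (simp add: pseudohyperbolic_def norm_divide dist_norm)
      also have "\<dots> \<le> pseudohyperbolic (x (Suc n)) (x n) * 2"
        by (intro mult_left_mono le pseudohyperbolic_nonneg)
      finally show "norm (dist (x (Suc n)) (x n)) \<le> pseudohyperbolic (x (Suc n)) (x n) * 2" by simp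
    qed
  qed
  define A where "A = {z \<in> cball 0 1. h z - z = 0}"
  have finA: "finite A"
  proof (cases "(\<lambda>z. h z - z) constant_on ball 0 s")
    case True
    then obtain c where c: "\<And>z. z \<in> ball 0 s \<Longrightarrow> h z - z = c" unfolding constant_on_def by blast
    have "c \<noteq> 0" using c[of 0] ext nofix[of 0] by simp
    have "z \<notin> A" for z
    proof
      assume "z \<in> A"
      then have "h z - z = 0" "z \<in> ball 0 s" using ext(1) by (auto simp: A_def)
      with c[of z] \<open>c \<noteq> 0\<close> show False by simp
    qed
    then have "A = {}" by blast
    then show ?thesis by simp
  next
    case False
    show ?thesis unfolding A_def
      by (rule holomorphic_compact_finite_zeros[OF _ open_ball connected_ball _ _ False])
         (use ext in \<open>auto intro!: holomorphic_intros\<close>)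
  qed
  have limA: "l \<in> A" if r: "strict_mono r" "(x \<circ> r) \<longlonglongrightarrow> l" for r l
  proof -
    have l1: "l \<in> cball 0 1"
      by (rule Lim_in_closed_set[OF closed_cball _ _ r(2)]) (use x1 in \<open>auto simp: less_imp_le\<close>)
    then have "isCont h l" using hc ext(1) by (auto simp: continuous_on_eq_continuous_at)
    then have "(\<lambda>n. h ((x \<circ> r) n)) \<longlonglongrightarrow> h l" by (rule isCont_tendsto_compose[OF _ r(2)])
    then have a: "(\<lambda>n. h (x (r n)) - x (r n)) \<longlonglongrightarrow> h l - l" using r(2) by (intro tendsto_diff) (auto simp: o_def)
    have "(\<lambda>n. norm (h (x (r n)) - x (r n))) \<longlonglongrightarrow> 0"
      using LIMSEQ_subseq_LIMSEQ[OF step r(1)] by (simp add: o_def dist_norm xS ext(3) x1)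
    then have "(\<lambda>n. h (x (r n)) - x (r n)) \<longlonglongrightarrow> 0" by (rule tendsto_norm_zero_cancel)
    then have "h l - l = 0" using a LIMSEQ_unique by blast
    then show ?thesis using l1 by (simp add: A_def)
  qed
  obtain p where p: "p \<in> A" "x \<longlonglongrightarrow> p"
    using convergent_if_finite_limit_points[of "cball 0 1" x A] x1 step finA limA by (auto simp: less_imp_le)
  have "cmod p = 1"
  proof (rule ccontr)
    assume "cmod p \<noteq> 1"
    then have "cmod p < 1" using p(1) by (simp add: A_def)
    then show False using nofix[of p] ext(3)[of p] p(1) by (simp add: A_def)
  qed
  then show ?thesis using p(2) by (auto simp: x_def)
qed

end

section \<open>Boundary values of univalent functions\<close>

text \<open>
  The \<open>k\<close>-th roots of a nonvanishing bounded \<open>h\<close> tend to modulus one at the origin but keep the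
  zeros of the boundary function, so these zeros cannot carry positive measure.
\<close>

lemma nonvanishing_radial_limit_nonzero:
  assumes h: "h holomorphic_on unit_disc" and M: "\<And>z. cmod z < 1 \<Longrightarrow> cmod (h z) \<le> M"
    and nz: "\<And>z. cmod z < 1 \<Longrightarrow> h z \<noteq> 0"
  shows "AE \<xi> in circle_measure. radial_limit h \<xi> \<noteq> 0"
proof -
  obtain L where L: "L holomorphic_on unit_disc" "\<And>z. z \<in> unit_disc \<Longrightarrow> h z = exp (L z)"
    using contractible_imp_holomorphic_log[OF h] nz convex_imp_contractible[of unit_disc] by auto
  have hc: "continuous_on unit_disc h" by (rule holomorphic_on_imp_continuous_on[OF h])
  \<comment> \<open>A bound of at least 1 has a logarithm, which bounds the real part of
    \<open>L\<close>.\<close>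
  define M1 where "M1 = max 1 M"
  have M1: "M1 \<ge> 1" "\<And>z. cmod z < 1 \<Longrightarrow> cmod (h z) \<le> M1" using M by (auto simp: M1_def le_max_iff_disj)
  define Z where "Z = {\<xi> \<in> unit_circle. radial_limit h \<xi> = 0}"
  note [measurable] = measurable_radial_limit[OF hc]
  have "{\<xi> \<in> space circle_measure. radial_limit h \<xi> = 0} \<in> sets circle_measure" by measurable
  then have Zs: "Z \<in> sets circle_measure" by (simp add: Z_def)
  have limh: "AE \<xi> in circle_measure. ((\<lambda>r. h (of_real r * \<xi>)) \<longlongrightarrow> radial_limit h \<xi>) (at_left 1)"
    by (rule Fatou_radial_limits[OF h]) (rule M)
  have bound: "exp (Re (L 0) / real (Suc k)) \<le> exp (ln M1 / real (Suc k)) * (1 - measure circle_measure Z)" for k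
  proof -
    define hk where "hk z = exp (L z / of_nat (Suc k))" for z
    have hkh: "hk holomorphic_on unit_disc" unfolding hk_def by (intro holomorphic_intros L) auto
    have pk: "hk z ^ Suc k = h z" if "cmod z < 1" for z
      using L(2)[of z] that unfolding hk_def exp_of_nat_mult[symmetric] by (simp del: of_nat_Suc)
    define C where "C = exp (ln M1 / real (Suc k))"
    have C: "C > 0" by (simp add: C_def)
    have hkC: "cmod (hk z) \<le> C" if "cmod z < 1" for z
    proof -
      have "exp (Re (L z)) \<le> M1" using M1(2)[OF that] L(2)[of z] that by (simp add: norm_exp_eq_Re)
      then have "Re (L z) \<le> ln M1" using M1(1) by (simp add: ln_ge_iff)
      then have "Re (L z) / real (Suc k) \<le> ln M1 / real (Suc k)" by (intro divide_right_mono) auto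
      moreover have "Re (L z / of_nat (Suc k)) = Re (L z) / real (Suc k)" by (metis Re_divide_of_nat)
      ultimately show ?thesis unfolding hk_def C_def norm_exp_eq_Re by simp
    qed
    have hkc: "continuous_on unit_disc hk" by (rule holomorphic_on_imp_continuous_on[OF hkh])
    have limk: "AE \<xi> in circle_measure. ((\<lambda>r. hk (of_real r * \<xi>)) \<longlongrightarrow> radial_limit hk \<xi>) (at_left 1)"
      by (rule Fatou_radial_limits[OF hkh]) (rule hkC)
    have sp: "AE \<xi> in circle_measure. \<xi> \<in> unit_circle" using AE_space[of circle_measure] by simp
    have b: "AE \<xi> in circle_measure. cmod (radial_limit hk \<xi>) \<le> C * indicator (unit_circle - Z) \<xi>"
      using limh limk sp
    proof eventually_elim
      case (elim \<xi>)
      have x: "cmod \<xi> = 1" using elim(3) by simp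
      have le: "cmod (radial_limit hk \<xi>) \<le> C" by (rule radial_limit_norm_le[OF elim(2) x hkC])
      show ?case
      proof (cases "\<xi> \<in> Z")
        case True
        have "((\<lambda>r. hk (of_real r * \<xi>) ^ Suc k) \<longlongrightarrow> radial_limit hk \<xi> ^ Suc k) (at_left 1)"
          by (intro tendsto_intros elim(2))
        moreover have "\<forall>\<^sub>F r in at_left (1::real). hk (of_real r * \<xi>) ^ Suc k = h (of_real r * \<xi>)"
          by (intro eventually_at_leftI[of 0] pk) (use x in \<open>auto simp: norm_mult\<close>)
        ultimately have "((\<lambda>r. h (of_real r * \<xi>)) \<longlongrightarrow> radial_limit hk \<xi> ^ Suc k) (at_left 1)"
          by (rule Lim_transform_eventually)
        then have "radial_limit hk \<xi> ^ Suc k = radial_limit h \<xi>"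
          using elim(1) tendsto_unique[OF trivial_limit_at_left_real] by blast
        also have "\<dots> = 0" using True by (simp add: Z_def)
        finally have "radial_limit hk \<xi> = 0" by (simp only: power_eq_0_iff)
        then show ?thesis using True by simp
      next
        case False
        then show ?thesis using le elim(3) by simp
      qed
    qed
    have "Re (L 0) / real (Suc k) = Re (L 0 / of_nat (Suc k))" by (metis Re_divide_of_nat)
    then have "exp (Re (L 0) / real (Suc k)) = cmod (hk 0)" by (simp add: hk_def norm_exp_eq_Re)
    also have "hk 0 = (LINT \<xi>|circle_measure. Poisson_kernel 0 \<xi> *\<^sub>R radial_limit hk \<xi>)"
      by (rule bounded_holomorphic_Poisson[symmetric, OF hkh hkC]) auto
    also have "\<dots> = (LINT \<xi>|circle_measure. radial_limit hk \<xi>)"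
      by (intro Bochner_Integration.integral_cong) (auto simp: Poisson_kernel_def)
    also have "cmod \<dots> \<le> (LINT \<xi>|circle_measure. cmod (radial_limit hk \<xi>))" by (rule integral_norm_bound)
    also have "\<dots> \<le> (LINT \<xi>|circle_measure. C * indicator (unit_circle - Z) \<xi>)"
    proof (rule integral_mono_AE[OF _ _ b])
      have [measurable]: "radial_limit hk \<in> borel_measurable circle_measure" by (rule measurable_radial_limit[OF hkc])
      show "integrable circle_measure (\<lambda>\<xi>. cmod (radial_limit hk \<xi>))"
      proof (rule circle.integrable_const_bound[of _ C])
        show "AE \<xi> in circle_measure. norm (cmod (radial_limit hk \<xi>)) \<le> C"
          using b
        proof eventually_elim
          case (elim \<xi>)
          have "C * indicator (unit_circle - Z) \<xi> \<le> C * 1"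
            using C by (intro mult_left_mono) (auto simp: indicator_def)
          then show ?case using elim by simp
        qed
      qed measurable
      have "unit_circle - Z \<in> sets circle_measure" using Zs sets.compl_sets[OF Zs] by simp
      then show "integrable circle_measure (\<lambda>\<xi>. C * indicator (unit_circle - Z) \<xi>)"
        by (intro integrable_mult_right integrable_real_indicator) (simp_all add: circle.emeasure_eq_measure)
    qed
    also have "\<dots> = C * measure circle_measure (unit_circle - Z)"
      using sets.compl_sets[OF Zs] by (simp add: Int_absorb2)
    also have "measure circle_measure (unit_circle - Z) = 1 - measure circle_measure Z"
      using circle.prob_compl[OF Zs] by simp
    finally show ?thesis by (simp add: C_def)
  qed
  have l1: "(\<lambda>k. exp (Re (L 0) / real (Suc k))) \<longlonglongrightarrow> 1" by real_asymp
  have "(\<lambda>k. exp (ln M1 / real (Suc k))) \<longlonglongrightarrow> 1" by real_asymp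
  then have "(\<lambda>k. exp (ln M1 / real (Suc k)) * (1 - measure circle_measure Z)) \<longlonglongrightarrow> 1 * (1 - measure circle_measure Z)"
    by (rule tendsto_mult_right)
  then have "1 \<le> 1 * (1 - measure circle_measure Z)"
    by (rule LIMSEQ_le[OF l1]) (use bound in blast)
  then have "measure circle_measure Z = 0" using measure_nonneg[of circle_measure Z] by simp
  then have "AE \<xi> in circle_measure. \<xi> \<notin> Z" using Zs by (simp add: circle.prob_eq_0)
  moreover have "AE \<xi> in circle_measure. \<xi> \<in> unit_circle" using AE_space[of circle_measure] by simp
  ultimately show ?thesis by eventually_elim (auto simp: Z_def)
qed

text \<open>
  The square root \<open>S\<close> of \<open>\<phi> - z0\<close> is univalent and never takes the values \<open>v\<close> and \<open>-v\<close> both, so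
  \<open>m = 1 / (S + v)\<close> is bounded for every value \<open>v\<close> of \<open>S\<close>.
\<close>

lemma univalent_bounded_transform:
  assumes \<phi>: "\<phi> holomorphic_on unit_disc" "inj_on \<phi> unit_disc" and z0: "\<And>z. cmod z < 1 \<Longrightarrow> \<phi> z \<noteq> z0"
    and z1: "cmod z1 < 1"
  obtains v m M where "v\<^sup>2 = \<phi> z1 - z0" "m holomorphic_on unit_disc"
    "\<forall>z. cmod z < 1 \<longrightarrow> cmod (m z) \<le> M" "\<forall>z. cmod z < 1 \<longrightarrow> m z \<noteq> 0"
    "\<forall>z. cmod z < 1 \<longrightarrow> \<phi> z = (1 / m z - v)\<^sup>2 + z0" "m z1 = 1 / (2 * v)"
proof -
  have "(\<lambda>z. \<phi> z - z0) holomorphic_on unit_disc" by (intro holomorphic_intros \<phi>)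
  then obtain S where S: "S holomorphic_on unit_disc" "\<And>z. z \<in> unit_disc \<Longrightarrow> \<phi> z - z0 = (S z)\<^sup>2"
    using contractible_imp_holomorphic_sqrt[of "\<lambda>z. \<phi> z - z0" unit_disc] z0 convex_imp_contractible[of unit_disc]
    by (metis convex_ball eq_iff_diff_eq_0 mem_ball_0)
  define v where "v = S z1"
  have Snz: "S z \<noteq> 0" if "cmod z < 1" for z using S(2)[of z] z0[OF that] that by auto
  have Seq: "z = w" if "(S z)\<^sup>2 = (S w)\<^sup>2" "cmod z < 1" "cmod w < 1" for z w
  proof -
    have "\<phi> z - z0 = \<phi> w - z0" using S(2)[of z] S(2)[of w] that by simp
    then show ?thesis using inj_onD[OF \<phi>(2), of z w] that by simp
  qed
  have nc: "\<not> S constant_on unit_disc"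
  proof
    assume "S constant_on unit_disc"
    then obtain c where "\<And>x. x \<in> unit_disc \<Longrightarrow> S x = c" unfolding constant_on_def by blast
    then have "S 0 = c" "S (1/2) = c" by (auto simp: norm_divide)
    then show False using Seq[of 0 "1/2"] by (simp add: norm_divide)
  qed
  have "open (S ` unit_disc)"
    by (rule open_mapping_thm[OF S(1) open_ball connected_ball open_ball subset_refl nc])
  moreover have "v \<in> S ` unit_disc" using z1 by (auto simp: v_def)
  \<comment> \<open>All values in this ball are taken by \<open>S\<close>. If \<open>-S z\<close>
    were among them, say \<open>-S z = S w\<close>, then injectivity of \<open>\<phi>\<close> would
    give \<open>z = w\<close> and \<open>S z = 0\<close>.\<close>
  ultimately obtain \<rho> where \<rho>: "\<rho> > 0" "ball v \<rho> \<subseteq> S ` unit_disc" by (meson open_contains_ball)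
  have far: "\<rho> \<le> cmod (S z + v)" if z: "cmod z < 1" for z
  proof (rule ccontr)
    assume "\<not> \<rho> \<le> cmod (S z + v)"
    then have "- S z \<in> ball v \<rho>" by (simp add: dist_norm add.commute)
    then obtain w where w: "cmod w < 1" "- S z = S w" using \<rho>(2) by auto
    have "(S w)\<^sup>2 = (- S z)\<^sup>2" by (simp only: w(2))
    then have "(S z)\<^sup>2 = (S w)\<^sup>2" by (simp only: power2_minus)
    then have "z = w" using z w(1) by (rule Seq)
    with w(2) have "- S z = S z" by (simp only:)
    then have "S z + S z = 0" using add.left_inverse[of "S z"] by (simp only:)
    then have "2 * S z = 0" by (simp only: mult_2)
    then show False using Snz[OF z] by simp
  qed
  have nz: "S z + v \<noteq> 0" if "cmod z < 1" for z using far[OF that] \<rho>(1) by auto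
  show ?thesis
  proof (rule that[of v "\<lambda>z. 1 / (S z + v)" "1 / \<rho>"])
    show "v\<^sup>2 = \<phi> z1 - z0" using S(2)[of z1] z1 by (simp add: v_def)
    show "(\<lambda>z. 1 / (S z + v)) holomorphic_on unit_disc" by (intro holomorphic_intros S) (use nz in auto)
    have "cmod (1 / (S z + v)) \<le> 1 / \<rho>" if "cmod z < 1" for z
      unfolding norm_divide norm_one using far[OF that] \<rho>(1) by (intro divide_left_mono mult_pos_pos) auto
    then show "\<forall>z. cmod z < 1 \<longrightarrow> cmod (1 / (S z + v)) \<le> 1 / \<rho>" by simp
    show "\<forall>z. cmod z < 1 \<longrightarrow> 1 / (S z + v) \<noteq> 0" using nz by simp
    have "\<phi> z = (1 / (1 / (S z + v)) - v)\<^sup>2 + z0" if "cmod z < 1" for z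
      using S(2)[of z] that nz[OF that] by (simp add: algebra_simps)
    then show "\<forall>z. cmod z < 1 \<longrightarrow> \<phi> z = (1 / (1 / (S z + v)) - v)\<^sup>2 + z0" by blast
    show "1 / (S z1 + v) = 1 / (2 * v)" unfolding v_def mult_2 ..
  qed
qed

text \<open>The curve \<open>c\<close> is arbitrary because limits are taken both along radii and
  along images of radii under \<open>g\<close>.\<close>

lemma univalent_bounded_transform_limit:
  fixes m \<phi> :: "complex \<Rightarrow> complex" and c :: "real \<Rightarrow> complex"
  assumes "((\<lambda>r. m (c r)) \<longlongrightarrow> l) (at_left (1::real))" "l \<noteq> 0" "\<And>r. 0 < r \<Longrightarrow> r < 1 \<Longrightarrow> cmod (c r) < 1"
    and "\<forall>z. cmod z < 1 \<longrightarrow> \<phi> z = (1 / m z - v)\<^sup>2 + z0"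
  shows "((\<lambda>r. \<phi> (c r)) \<longlongrightarrow> (1 / l - v)\<^sup>2 + z0) (at_left 1)"
proof (rule Lim_transform_eventually)
  show "((\<lambda>r. (1 / m (c r) - v)\<^sup>2 + z0) \<longlongrightarrow> (1 / l - v)\<^sup>2 + z0) (at_left 1)"
    by (intro tendsto_intros assms)
  show "\<forall>\<^sub>F r in at_left (1::real). (1 / m (c r) - v)\<^sup>2 + z0 = \<phi> (c r)"
    using assms(3,4) by (intro eventually_at_leftI[of 0]) auto
qed

text \<open>\<open>\<phi>\<close> may be unbounded, but it equals \<open>(1 / m - v)^2 + z0\<close>
  with a bounded nonvanishing \<open>m\<close>. Its limits are finite wherever those of
  \<open>m\<close> are nonzero, that is almost everywhere.\<close>

lemma univalent_radial_limit:
  assumes \<phi>: "\<phi> holomorphic_on unit_disc" "inj_on \<phi> unit_disc" and z0: "\<And>z. cmod z < 1 \<Longrightarrow> \<phi> z \<noteq> z0"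
  shows "AE \<xi> in circle_measure. ((\<lambda>r. \<phi> (of_real r * \<xi>)) \<longlongrightarrow> radial_limit \<phi> \<xi>) (at_left 1)"
proof -
  have zero: "cmod (0::complex) < 1" by simp
  obtain v m M where mm: "v\<^sup>2 = \<phi> 0 - z0" "m holomorphic_on unit_disc"
    "\<forall>z. cmod z < 1 \<longrightarrow> cmod (m z) \<le> M" "\<forall>z. cmod z < 1 \<longrightarrow> m z \<noteq> 0"
    "\<forall>z. cmod z < 1 \<longrightarrow> \<phi> z = (1 / m z - v)\<^sup>2 + z0" "m 0 = 1 / (2 * v)"
    by (rule univalent_bounded_transform[OF \<phi> z0 zero]) (assumption, rule that)
  note m = mm(2) mm(3-5)[rule_format]
  have "AE \<xi> in circle_measure. ((\<lambda>r. m (of_real r * \<xi>)) \<longlongrightarrow> radial_limit m \<xi>) (at_left 1)"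
    by (rule Fatou_radial_limits[OF m(1)]) (rule m(2))
  moreover have "AE \<xi> in circle_measure. radial_limit m \<xi> \<noteq> 0"
    by (rule nonvanishing_radial_limit_nonzero[OF m(1)]) (use m in auto)
  moreover have "AE \<xi> in circle_measure. \<xi> \<in> unit_circle" using AE_space[of circle_measure] by simp
  ultimately show ?thesis
  proof eventually_elim
    case (elim \<xi>)
    have l: "((\<lambda>r. \<phi> (of_real r * \<xi>)) \<longlongrightarrow> (1 / radial_limit m \<xi> - v)\<^sup>2 + z0) (at_left 1)"
      by (rule univalent_bounded_transform_limit[OF elim(1,2) _ mm(5)]) (use elim(3) in \<open>auto simp: norm_mult\<close>)
    from radial_limitI[OF this] l show ?case by simp
  qed
qed

text \<open>The curve \<open>g (r \<xi>)\<close> tends to \<open>G \<xi>\<close>, but not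
  necessarily along the radius. For the bounded \<open>m\<close> the limit along the curve is
  nevertheless the radial limit at \<open>G \<xi>\<close>, and \<open>\<phi>\<close> inherits
  this.\<close>

lemma (in inner_boundary_map) univalent_radial_limit_compose:
  assumes \<phi>: "\<phi> holomorphic_on unit_disc" "inj_on \<phi> unit_disc" and z0: "\<And>z. cmod z < 1 \<Longrightarrow> \<phi> z \<noteq> z0"
  shows "AE \<xi> in circle_measure. ((\<lambda>r. \<phi> (g (of_real r * \<xi>))) \<longlongrightarrow> radial_limit \<phi> (G \<xi>)) (at_left 1)"
proof -
  have zero: "cmod (0::complex) < 1" by simp
  obtain v m M where mm: "v\<^sup>2 = \<phi> 0 - z0" "m holomorphic_on unit_disc"
    "\<forall>z. cmod z < 1 \<longrightarrow> cmod (m z) \<le> M" "\<forall>z. cmod z < 1 \<longrightarrow> m z \<noteq> 0"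
    "\<forall>z. cmod z < 1 \<longrightarrow> \<phi> z = (1 / m z - v)\<^sup>2 + z0" "m 0 = 1 / (2 * v)"
    by (rule univalent_bounded_transform[OF \<phi> z0 zero]) (assumption, rule that)
  note m = mm(2) mm(3-5)[rule_format]
  have limm: "AE \<xi> in circle_measure. ((\<lambda>r. m (of_real r * \<xi>)) \<longlongrightarrow> radial_limit m \<xi>) (at_left 1)"
    by (rule Fatou_radial_limits[OF m(1)]) (rule m(2))
  have nzm: "AE \<xi> in circle_measure. radial_limit m \<xi> \<noteq> 0"
    by (rule nonvanishing_radial_limit_nonzero[OF m(1)]) (use m in auto)
  have "g ` unit_disc \<subseteq> unit_disc" using disc by auto
  then have mg: "(\<lambda>z. m (g z)) holomorphic_on unit_disc"
    using holomorphic_on_compose_gen[OF holo m(1)] by (simp add: o_def)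
  have limmg: "AE \<xi> in circle_measure. ((\<lambda>r. m (g (of_real r * \<xi>))) \<longlongrightarrow> radial_limit (\<lambda>z. m (g z)) \<xi>) (at_left 1)"
    by (rule Fatou_radial_limits[OF mg]) (rule m(2)[OF disc])
  have "AE \<xi> in circle_measure. radial_limit (\<lambda>z. m (g z)) \<xi> = radial_limit m (G \<xi>)"
    by (rule radial_limit_compose[OF m(1)]) (rule m(2))
  moreover have "AE \<xi> in circle_measure. \<xi> \<in> unit_circle" using AE_space[of circle_measure] by simp
  ultimately show ?thesis
    using AE_compose_G[OF limm] AE_compose_G[OF nzm] limmg
  proof eventually_elim
    case (elim \<xi>)
    have G1: "cmod (G \<xi>) = 1" using elim(2) G_unit by simp
    have "((\<lambda>r. \<phi> (of_real r * G \<xi>)) \<longlongrightarrow> (1 / radial_limit m (G \<xi>) - v)\<^sup>2 + z0) (at_left 1)"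
      by (rule univalent_bounded_transform_limit[OF elim(3,4) _ mm(5)]) (use G1 in \<open>auto simp: norm_mult\<close>)
    from radial_limitI[OF this] have e: "radial_limit \<phi> (G \<xi>) = (1 / radial_limit m (G \<xi>) - v)\<^sup>2 + z0" .
    show ?case unfolding e
      by (rule univalent_bounded_transform_limit[OF elim(5)[unfolded elim(1)] elim(4) _ mm(5)])
         (use elim(2) in \<open>auto simp: norm_mult intro: disc\<close>)
  qed
qed

text \<open>If the limit were a value of \<open>\<phi>\<close>, the continuous inverse would make
  the radius converge to an interior point of the disc instead of to \<open>\<xi>\<close>.\<close>

lemma Riemann_map_radial_limit_frontier:
  assumes \<phi>: "\<phi> holomorphic_on unit_disc" "inj_on \<phi> unit_disc"
    and lim: "((\<lambda>r. \<phi> (of_real r * \<xi>)) \<longlongrightarrow> l) (at_left 1)" and \<xi>: "cmod \<xi> = 1"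
  shows "l \<in> frontier (\<phi> ` unit_disc)"
proof -
  obtain \<psi> where \<psi>: "\<psi> holomorphic_on \<phi> ` unit_disc" "\<And>z. z \<in> unit_disc \<Longrightarrow> \<psi> (\<phi> z) = z"
    using holomorphic_has_inverse[OF \<phi>(1) open_ball \<phi>(2)] by metis
  have nc: "\<not> \<phi> constant_on unit_disc"
  proof
    assume "\<phi> constant_on unit_disc"
    then obtain c where "\<And>x. x \<in> unit_disc \<Longrightarrow> \<phi> x = c" unfolding constant_on_def by blast
    then have "\<phi> 0 = \<phi> (1/2)" by (auto simp: norm_divide)
    then show False using inj_onD[OF \<phi>(2), of 0 "1/2"] by (simp add: norm_divide)
  qed
  have oU: "open (\<phi> ` unit_disc)"
    by (rule open_mapping_thm[OF \<phi>(1) open_ball connected_ball open_ball subset_refl nc])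
  have ev: "\<forall>\<^sub>F r in at_left (1::real). of_real r * \<xi> \<in> unit_disc"
    by (intro eventually_at_leftI[of 0]) (use \<xi> in \<open>auto simp: norm_mult\<close>)
  have "l \<in> closure (\<phi> ` unit_disc)"
  proof (rule Lim_in_closed_set[OF closed_closure _ _ lim])
    show "\<forall>\<^sub>F r in at_left 1. \<phi> (of_real r * \<xi>) \<in> closure (\<phi> ` unit_disc)"
      using ev by eventually_elim (intro closure_subset[THEN subsetD] imageI)
  qed simp
  moreover have "l \<notin> \<phi> ` unit_disc"
  proof
    assume l: "l \<in> \<phi> ` unit_disc"
    have "isCont \<psi> l" using continuous_on_eq_continuous_at[OF oU] holomorphic_on_imp_continuous_on[OF \<psi>(1)] l
      by blast
    then have "((\<lambda>r. \<psi> (\<phi> (of_real r * \<xi>))) \<longlongrightarrow> \<psi> l) (at_left 1)" by (rule isCont_tendsto_compose[OF _ lim])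
    moreover have "\<forall>\<^sub>F r in at_left 1. \<psi> (\<phi> (of_real r * \<xi>)) = of_real r * \<xi>"
      using ev by eventually_elim (rule \<psi>(2))
    ultimately have "((\<lambda>r. of_real r * \<xi>) \<longlongrightarrow> \<psi> l) (at_left (1::real))" by (rule Lim_transform_eventually)
    moreover have "((\<lambda>r. of_real r * \<xi>) \<longlongrightarrow> of_real 1 * \<xi>) (at_left (1::real))" by (intro tendsto_intros)
    ultimately have "\<psi> l = \<xi>" using tendsto_unique[OF trivial_limit_at_left_real] by fastforce
    moreover have "\<psi> l \<in> unit_disc" using l \<psi>(2) by auto
    ultimately show False using \<xi> by simp
  qed
  ultimately show ?thesis using oU by (simp add: frontier_def interior_open)
qed

text \<open>
  If \<open>\<phi>\<close> had no radial limits near the frontier point \<open>z0\<close>, then \<open>1 / (S + v)\<close> would be bounded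
  by a constant not depending on \<open>v\<close>; but at the point with \<open>S = v\<close> it takes the value \<open>1 / (2 v)\<close>,
  and \<open>v\<close> can be chosen arbitrarily small.
\<close>

lemma harmonic_measure_ball_pos:
  assumes \<phi>: "\<phi> holomorphic_on unit_disc" "inj_on \<phi> unit_disc" and z0: "z0 \<in> frontier (\<phi> ` unit_disc)"
    and oU: "open (\<phi> ` unit_disc)" and e: "e > 0"
  shows "measure circle_measure {\<xi> \<in> unit_circle. radial_limit \<phi> \<xi> \<in> ball z0 e} > 0"
proof (rule ccontr)
  assume "\<not> ?thesis"
  then have m0: "measure circle_measure {\<xi> \<in> unit_circle. radial_limit \<phi> \<xi> \<in> ball z0 e} = 0"
    using measure_nonneg[of circle_measure "{\<xi> \<in> unit_circle. radial_limit \<phi> \<xi> \<in> ball z0 e}"] by linarith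
  have [measurable]: "radial_limit \<phi> \<in> borel_measurable circle_measure"
    by (intro measurable_radial_limit holomorphic_on_imp_continuous_on \<phi>)
  have "radial_limit \<phi> -` ball z0 e \<inter> space circle_measure \<in> sets circle_measure"
    by (rule measurable_sets[OF measurable_radial_limit[OF holomorphic_on_imp_continuous_on[OF \<phi>(1)]]]) simp
  moreover have "radial_limit \<phi> -` ball z0 e \<inter> space circle_measure = {\<xi> \<in> unit_circle. radial_limit \<phi> \<xi> \<in> ball z0 e}"
    by auto
  ultimately have "AE \<xi> in circle_measure. \<xi> \<notin> {\<xi> \<in> unit_circle. radial_limit \<phi> \<xi> \<in> ball z0 e}"
    using m0 by (simp add: circle.prob_eq_0)
  moreover have sp: "AE \<xi> in circle_measure. \<xi> \<in> unit_circle" using AE_space[of circle_measure] by simp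
  ultimately have far: "AE \<xi> in circle_measure. e \<le> cmod (radial_limit \<phi> \<xi> - z0)"
    by eventually_elim (auto simp: dist_norm norm_minus_commute)
  have z0U: "z0 \<notin> \<phi> ` unit_disc" using z0 oU by (simp add: frontier_def interior_open)
  then have z0n: "\<phi> z \<noteq> z0" if "cmod z < 1" for z using that by auto
  \<comment> \<open>Where the boundary values of \<open>\<phi>\<close> keep the distance
    \<open>e\<close> from \<open>z0\<close>, those of its root \<open>S\<close> have modulus at
    least \<open>4 \<eta>\<close>. With \<open>|v| < \<eta>\<close> this gives
    \<open>|S + v| \<ge> 3 \<eta>\<close>, whereas at \<open>z1\<close> the modulus of
    \<open>S + v = 2 v\<close> is below \<open>2 \<eta>\<close>.\<close>
  define \<eta> where "\<eta> = sqrt e / 4"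
  have \<eta>: "\<eta> > 0" using e by (simp add: \<eta>_def)
  have "z0 \<in> closure (\<phi> ` unit_disc)" using z0 by (simp add: frontier_def)
  then have "\<forall>e>0. \<exists>y\<in>\<phi> ` unit_disc. dist y z0 < e" by (simp only: closure_approachable)
  moreover have "\<eta>\<^sup>2 > 0" using \<eta> by simp
  ultimately obtain y where "y \<in> \<phi> ` unit_disc" "dist y z0 < \<eta>\<^sup>2" by blast
  then obtain z1 where z1: "cmod z1 < 1" "dist (\<phi> z1) z0 < \<eta>\<^sup>2" by auto
  obtain v m M where mm: "v\<^sup>2 = \<phi> z1 - z0" "m holomorphic_on unit_disc"
    "\<forall>z. cmod z < 1 \<longrightarrow> cmod (m z) \<le> M" "\<forall>z. cmod z < 1 \<longrightarrow> m z \<noteq> 0"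
    "\<forall>z. cmod z < 1 \<longrightarrow> \<phi> z = (1 / m z - v)\<^sup>2 + z0" "m z1 = 1 / (2 * v)"
    by (rule univalent_bounded_transform[OF \<phi> z0n z1(1)]) (assumption, rule that)
  note m = mm(1,2) mm(3-5)[rule_format] mm(6)
  have "(cmod v)\<^sup>2 < \<eta>\<^sup>2" using z1(2) m(1) by (simp add: dist_norm norm_power[symmetric])
  then have v: "cmod v < \<eta>" using \<eta> by (simp add: power_less_imp_less_base)
  have vn: "v \<noteq> 0" using m(1) z0n[OF z1(1)] by auto
  have "AE \<xi> in circle_measure. ((\<lambda>r. m (of_real r * \<xi>)) \<longlongrightarrow> radial_limit m \<xi>) (at_left 1)"
    by (rule Fatou_radial_limits[OF m(2)]) (rule m(3))
  moreover have "AE \<xi> in circle_measure. radial_limit m \<xi> \<noteq> 0"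
    by (rule nonvanishing_radial_limit_nonzero[OF m(2)]) (use m in auto)
  ultimately have mb: "AE \<xi> in circle_measure. cmod (radial_limit m \<xi>) \<le> 1 / (3 * \<eta>)"
    using sp far
  proof eventually_elim
    case (elim \<xi>)
    have "((\<lambda>r. \<phi> (of_real r * \<xi>)) \<longlongrightarrow> (1 / radial_limit m \<xi> - v)\<^sup>2 + z0) (at_left 1)"
      by (rule univalent_bounded_transform_limit[OF elim(1,2) _ mm(5)]) (use elim(3) in \<open>auto simp: norm_mult\<close>)
    from radial_limitI[OF this] have "radial_limit \<phi> \<xi> - z0 = (1 / radial_limit m \<xi> - v)\<^sup>2" by simp
    then have "e \<le> (cmod (1 / radial_limit m \<xi> - v))\<^sup>2" using elim(4) by (simp add: norm_power)
    then have "sqrt e \<le> cmod (1 / radial_limit m \<xi> - v)" by (rule real_le_lsqrt[OF norm_ge_zero])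
    also have "\<dots> \<le> cmod (1 / radial_limit m \<xi>) + cmod v" by (rule norm_triangle_ineq4)
    finally have "3 * \<eta> \<le> 1 / cmod (radial_limit m \<xi>)" using v by (simp add: \<eta>_def norm_divide)
    then show ?case using \<eta> elim(2) by (simp add: field_simps)
  qed
  have mm [measurable]: "radial_limit m \<in> borel_measurable circle_measure"
    by (intro measurable_radial_limit holomorphic_on_imp_continuous_on m)
  note [measurable] = measurable_Poisson_kernel[OF z1(1)]
  have Pint: "integrable circle_measure (\<lambda>\<xi>. Poisson_kernel z1 \<xi> * (1 / (3 * \<eta>)))"
    by (intro integrable_mult_left circle_integrable_continuous continuous_on_Poisson_kernel z1)
  have Pb: "AE \<xi> in circle_measure. cmod (Poisson_kernel z1 \<xi> *\<^sub>R radial_limit m \<xi>) \<le> Poisson_kernel z1 \<xi> * (1 / (3 * \<eta>))"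
    using mb by eventually_elim (use Poisson_kernel_nonneg[OF z1(1)] in \<open>auto intro!: mult_left_mono simp del: times_divide_eq_right\<close>)
  have "cmod (m z1) = cmod (LINT \<xi>|circle_measure. Poisson_kernel z1 \<xi> *\<^sub>R radial_limit m \<xi>)"
    by (subst bounded_holomorphic_Poisson[OF m(2,3) z1(1)]) auto
  also have "\<dots> \<le> (LINT \<xi>|circle_measure. cmod (Poisson_kernel z1 \<xi> *\<^sub>R radial_limit m \<xi>))" by (rule integral_norm_bound)
  also have "\<dots> \<le> (LINT \<xi>|circle_measure. Poisson_kernel z1 \<xi> * (1 / (3 * \<eta>)))"
  proof (rule integral_mono_AE[OF _ Pint Pb])
    show "integrable circle_measure (\<lambda>\<xi>. cmod (Poisson_kernel z1 \<xi> *\<^sub>R radial_limit m \<xi>))"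
    proof (rule Bochner_Integration.integrable_bound[OF Pint])
      show "AE \<xi> in circle_measure. norm (cmod (Poisson_kernel z1 \<xi> *\<^sub>R radial_limit m \<xi>)) \<le> norm (Poisson_kernel z1 \<xi> * (1 / (3 * \<eta>)))"
        using Pb by eventually_elim (simp only: real_norm_def abs_norm_cancel order_trans[OF _ abs_ge_self])
    qed measurable
  qed
  also have "\<dots> = 1 / (3 * \<eta>)" by (simp add: Poisson_kernel_integral[OF z1(1)])
  finally have "1 / (2 * cmod v) \<le> 1 / (3 * \<eta>)" by (simp add: m(6) norm_divide norm_mult)
  then show False using v vn \<eta> by (simp add: field_simps)
qed

section \<open>Baker domains\<close>

lemma meromorphic_map_analytic:
  assumes "meromorphic_map f" "f z \<noteq> Infty"
  shows "(\<lambda>z. the_Fin (f z)) analytic_on {z}"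
  using assms by (auto simp: meromorphic_map_def intro: nicely_meromorphic_on_imp_analytic_at[where A = UNIV])

lemma meromorphic_map_isCont:
  assumes "meromorphic_map f" "f z \<noteq> Infty"
  shows "isCont (\<lambda>z. the_Fin (f z)) z"
  using meromorphic_map_analytic[OF assms] analytic_at_imp_isCont by blast

lemma meromorphic_map_open_finite:
  assumes f: "meromorphic_map f"
  shows "open {z. f z \<noteq> Infty}"
proof (subst open_subopen, rule ballI)
  fix z assume "z \<in> {z. f z \<noteq> Infty}"
  then obtain S where S: "open S" "z \<in> S" "(\<lambda>z. the_Fin (f z)) holomorphic_on S"
    using meromorphic_map_analytic[OF f] analytic_at by blast
  then have "S \<subseteq> {z. f z \<noteq> Infty}"
    using f not_is_pole_holomorphic[of S] by (auto simp: meromorphic_map_def)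
  then show "\<exists>T. open T \<and> z \<in> T \<and> T \<subseteq> {z. f z \<noteq> Infty}" using S by blast
qed

lemma Fin_the_Fin: "x \<noteq> Infty \<Longrightarrow> Fin (the_Fin x) = x"
  by (cases x) auto

lemma iterate_Suc_Fin: "f z = Fin y \<Longrightarrow> iterate f (Suc n) z = iterate f n y"
  by (induction n) auto

lemma iterate_invariant:
  assumes "f ` U \<subseteq> Fin ` U" "y \<in> U"
  shows "iterate f n y \<in> Fin ` U"
proof (induction n)
  case 0
  then show ?case using assms(2) by simp
next
  case (Suc n)
  then obtain u where u: "iterate f n y = Fin u" "u \<in> U" by blast
  then have "f u \<in> Fin ` U" using assms(1) by blast
  then show ?case using u(1) by simp
qed

lemma open_fatou_set: "open (fatou_set f)"
proof (subst open_subopen, rule ballI)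
  fix z assume "z \<in> fatou_set f"
  then obtain V where V: "open V" "z \<in> V" "\<forall>n. \<forall>w\<in>V. iterate_defined f n w" "normal_family V (range (iterate f))"
    unfolding fatou_set_def by blast
  then have "V \<subseteq> fatou_set f" unfolding fatou_set_def by blast
  then show "\<exists>T. open T \<and> z \<in> T \<and> T \<subseteq> fatou_set f" using V(1,2) by blast
qed

lemma Baker_domain_props:
  assumes "invariant_Baker_domain f U"
  shows "open U" "connected U" "f ` U \<subseteq> Fin ` U" "U \<subseteq> fatou_set f" "U \<noteq> {}"
proof -
  have U: "U \<in> components (fatou_set f)" and fU: "f ` U \<subseteq> Fin ` U"
    using assms by (simp_all add: invariant_Baker_domain_def)
  show "open U" by (rule open_components[OF open_fatou_set U])
  show "connected U" by (rule in_components_connected[OF U])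
  show "U \<subseteq> fatou_set f" by (rule in_components_subset[OF U])
  show "U \<noteq> {}" by (rule in_components_nonempty[OF U])
  show "f ` U \<subseteq> Fin ` U" by (rule fU)
qed

text \<open>A frontier point mapped into \<open>U\<close> has a disc \<open>V\<close> around it
  whose image lies in a compact disc in \<open>U\<close>, where the iterates tend to infinity
  uniformly. Then the iterates are normal on \<open>V\<close>, and \<open>U\<close>, being a
  component of the Fatou set, contains \<open>V\<close> and with it the frontier point.\<close>

lemma Baker_domain_frontier_image:
  assumes f: "meromorphic_map f" and U: "invariant_Baker_domain f U" and z: "z \<in> frontier U" and fz: "f z = Fin w"
  shows "w \<notin> U"
proof
  assume w: "w \<in> U"
  note BU = Baker_domain_props[OF U]
  let ?F = "\<lambda>z. the_Fin (f z)"
  obtain \<rho> where \<rho>: "\<rho> > 0" "cball w \<rho> \<subseteq> U" using BU(1) w open_contains_cball by metis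
  have "isCont ?F z" using meromorphic_map_isCont[OF f, of z] fz by simp
  then have "(?F \<longlongrightarrow> ?F z) (nhds z)" by (simp only: isCont_def tendsto_at_iff_tendsto_nhds[of ?F z])
  then have "(?F \<longlongrightarrow> w) (nhds z)" using fz by simp
  then have "\<forall>\<^sub>F y in nhds z. dist (?F y) w < \<rho>" using \<rho>(1) by (rule tendstoD)
  moreover have "\<forall>\<^sub>F y in nhds z. f y \<noteq> Infty"
    using eventually_nhds_in_open[OF meromorphic_map_open_finite[OF f], of z] fz by simp
  ultimately have "\<forall>\<^sub>F y in nhds z. dist (?F y) w < \<rho> \<and> f y \<noteq> Infty" by (rule eventually_conj)
  then obtain \<delta> where \<delta>: "\<delta> > 0" "\<And>y. dist y z < \<delta> \<Longrightarrow> dist (?F y) w < \<rho> \<and> f y \<noteq> Infty"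
    by (auto simp: eventually_nhds_metric)
  define V where "V = ball z \<delta>"
  have V: "f y = Fin (?F y)" "?F y \<in> cball w \<rho>" if "y \<in> V" for y
    using \<delta>(2)[of y] that Fin_the_Fin[of "f y"] by (auto simp: V_def dist_commute)
  have itV: "iterate f (Suc n) y = iterate f n (?F y)" if "y \<in> V" for n y
    using V(1)[OF that] by (rule iterate_Suc_Fin)
  have itfin: "iterate f n y \<noteq> Infty" if "y \<in> V" for n y
  proof (cases n)
    case (Suc m)
    have "iterate f m (?F y) \<in> Fin ` U" using V(2)[OF that] \<rho>(2) by (intro iterate_invariant[OF BU(3)]) auto
    then show ?thesis using itV[OF that, of m] Suc by auto
  qed simp
  have lim: "uniform_limit (cball w \<rho>) (iterate f) (\<lambda>_. Infty) sequentially"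
    using U \<rho>(2) by (auto simp: invariant_Baker_domain_def locally_uniform_limit_def)
  have "normal_family V (range (iterate f))"
    unfolding normal_family_def
  proof (intro allI impI)
    fix s :: "nat \<Rightarrow> complex \<Rightarrow> riemann_sphere" assume "range s \<subseteq> range (iterate f)"
    then have "\<forall>k. \<exists>n. s k = iterate f n" by blast
    then obtain n where n: "\<And>k. s k = iterate f (n k)" by metis
    \<comment> \<open>Either one iterate occurs infinitely often, which gives a constant
      subsequence, or the indices tend to infinity and the whole sequence tends to
      \<open>Infty\<close>.\<close>
    show "\<exists>r g. strict_mono (r :: nat \<Rightarrow> nat) \<and> locally_uniform_limit V (s \<circ> r) g"
    proof (cases "\<exists>N. infinite {k. n k = N}")
      case True
      then obtain N where "infinite {k. n k = N}" by blast
      from infinite_enumerate[OF this] obtain r :: "nat \<Rightarrow> nat" where r: "strict_mono r" "\<And>j. n (r j) = N" by blast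
      have "s \<circ> r = (\<lambda>_. iterate f N)" by (rule ext) (simp add: n r(2))
      then have "locally_uniform_limit V (s \<circ> r) (iterate f N)"
        unfolding locally_uniform_limit_def by (simp add: uniform_limit_const)
      then show ?thesis using r(1) by blast
    next
      case False
      have nlim: "filterlim n at_top sequentially"
        unfolding filterlim_at_top
      proof (rule allI)
        fix M :: nat
        have "{k. n k < M} = (\<Union>N<M. {k. n k = N})" by auto
        then have "finite {k. n k < M}" using False by simp
        then have "\<forall>\<^sub>F k in cofinite. \<not> n k < M" by (simp add: eventually_cofinite)
        then show "\<forall>\<^sub>F k in sequentially. M \<le> n k" by (simp add: cofinite_eq_sequentially not_less)
      qed
      have "locally_uniform_limit V (s \<circ> id) (\<lambda>_. Infty)"
        unfolding locally_uniform_limit_def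
      proof (intro allI impI)
        fix K assume K: "compact K \<and> K \<subseteq> V"
        show "uniform_limit K (s \<circ> id) (\<lambda>_. Infty) sequentially"
        proof (rule uniform_limitI)
          fix e :: real assume "e > 0"
          then have "\<forall>\<^sub>F n in sequentially. \<forall>y\<in>cball w \<rho>. dist (iterate f n y) Infty < e"
            using uniform_limitD[OF lim] by blast
          then obtain n0 where "\<forall>n\<ge>n0. \<forall>y\<in>cball w \<rho>. dist (iterate f n y) Infty < e"
            unfolding eventually_sequentially by blast
          then have n0: "\<And>n y. n \<ge> n0 \<Longrightarrow> y \<in> cball w \<rho> \<Longrightarrow> dist (iterate f n y) Infty < e" by blast
          have "\<forall>\<^sub>F k in sequentially. Suc n0 \<le> n k" using nlim by (simp add: filterlim_at_top)
          then show "\<forall>\<^sub>F k in sequentially. \<forall>y\<in>K. dist ((s \<circ> id) k y) Infty < e"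
          proof eventually_elim
            case (elim k)
            show ?case
            proof
              fix y assume "y \<in> K"
              then have y: "y \<in> V" using K by blast
              obtain j where j: "n k = Suc j" "n0 \<le> j" using elim by (cases "n k") auto
              have "(s \<circ> id) k y = iterate f j (?F y)" using itV[OF y, of j] by (simp add: n j(1))
              then show "dist ((s \<circ> id) k y) Infty < e" using n0[OF j(2) V(2)[OF y]] by simp
            qed
          qed
        qed
      qed
      then show ?thesis using strict_mono_id by (metis id_def strict_mono_def)
    qed
  qed
  then have "V \<subseteq> fatou_set f"
    unfolding fatou_set_def using itfin by (intro subsetI CollectI exI[of _ V]) (auto simp: V_def iterate_defined_def)
  moreover have "V \<inter> U \<noteq> {}"
  proof -
    have "z \<in> closure U" using z by (simp add: frontier_def)
    then obtain y where "y \<in> U" "dist y z < \<delta>" using \<delta>(1) by (meson closure_approachable)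
    then have "y \<in> V \<inter> U" by (simp add: V_def dist_commute)
    then show ?thesis by blast
  qed
  moreover have "connected V" by (simp add: V_def)
  ultimately have "V \<subseteq> U"
    using U components_maximal[of U "fatou_set f" V] by (auto simp: invariant_Baker_domain_def)
  then have "z \<in> U" using \<delta>(1) by (auto simp: V_def)
  then show False using z BU(1) by (simp add: frontier_def interior_open)
qed

lemma iterate_preimage_Suc:
  "{z. iterate f (Suc n) z \<in> Fin ` S} = {z. iterate f n z \<in> Fin ` {w. f w \<in> Fin ` S}}"
proof (rule Collect_cong)
  fix z show "iterate f (Suc n) z \<in> Fin ` S \<longleftrightarrow> iterate f n z \<in> Fin ` {w. f w \<in> Fin ` S}"
  proof (cases "iterate f n z")
    case (Fin w)
    have "f w \<in> Fin ` S \<longleftrightarrow> Fin w \<in> Fin ` {w. f w \<in> Fin ` S}" by blast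
    then show ?thesis using Fin by simp
  qed auto
qed

lemma borel_iterate_preimage:
  assumes f: "meromorphic_map f" and S: "S \<in> sets borel"
  shows "{z. iterate f n z \<in> Fin ` S} \<in> sets borel"
  using S
proof (induction n arbitrary: S)
  case 0
  have "{z. iterate f 0 z \<in> Fin ` S} = S" by auto
  then show ?case using 0 by simp
next
  case (Suc n)
  let ?F = "\<lambda>z. the_Fin (f z)"
  have cont: "continuous_on {z. f z \<noteq> Infty} ?F"
    by (intro continuous_at_imp_continuous_on ballI meromorphic_map_isCont[OF f]) simp
  have oD: "{z. f z \<noteq> Infty} \<in> sets borel" using meromorphic_map_open_finite[OF f] by simp
  have "?F \<in> borel_measurable (restrict_space borel {z. f z \<noteq> Infty})"
    by (rule borel_measurable_continuous_on_restrict[OF cont])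
  then have "?F -` S \<inter> space (restrict_space borel {z. f z \<noteq> Infty}) \<in> sets (restrict_space borel {z. f z \<noteq> Infty})"
    using Suc.prems by (rule measurable_sets)
  then have "?F -` S \<inter> {z. f z \<noteq> Infty} \<in> sets borel"
    using oD by (simp add: space_restrict_space sets_restrict_space_iff)
  moreover have "{w. f w \<in> Fin ` S} = ?F -` S \<inter> {z. f z \<noteq> Infty}"
    by (auto simp: image_iff) (metis Fin_the_Fin)
  ultimately have "{w. f w \<in> Fin ` S} \<in> sets borel" by simp
  from Suc.IH[OF this] show ?case unfolding iterate_preimage_Suc .
qed

text \<open>The assumption \<open>proper\<close> supplies the omitted value \<open>z0\<close> from
  which the bounded transform of \<open>\<phi>\<close> is built.\<close>

locale Baker_domain_uniformization =
  fixes f :: "complex \<Rightarrow> riemann_sphere" and U :: "complex set" and \<phi> :: "complex \<Rightarrow> complex"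
  assumes f: "meromorphic_map f" and Baker: "invariant_Baker_domain f U" and Riemann: "Riemann_map \<phi> U"
    and proper: "U \<noteq> UNIV"
begin

abbreviation "F \<equiv> (\<lambda>z. the_Fin (f z))"
abbreviation "g \<equiv> associated_inner_function \<phi> f"

lemmas U_props = Baker_domain_props[OF Baker]

lemma \<phi>: "\<phi> holomorphic_on unit_disc" "inj_on \<phi> unit_disc" "\<phi> ` unit_disc = U"
  using Riemann by (auto simp: Riemann_map_def bij_betw_def)

lemma f_U: "z \<in> U \<Longrightarrow> f z = Fin (F z)" "z \<in> U \<Longrightarrow> F z \<in> U"
proof -
  assume "z \<in> U"
  then obtain u where "f z = Fin u" "u \<in> U" using U_props(3) by blast
  then show "f z = Fin (F z)" "F z \<in> U" by simp_all
qed

lemma \<phi>_mem: "cmod z < 1 \<Longrightarrow> \<phi> z \<in> U"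
  using \<phi>(3) by auto

lemma F_holomorphic: "F holomorphic_on U"
proof (rule analytic_imp_holomorphic)
  show "F analytic_on U"
    unfolding analytic_on_analytic_at[of F U]
  proof
    fix z assume "z \<in> U"
    then have "f z \<noteq> Infty" using f_U(1)[of z] by (metis riemann_sphere.distinct(1))
    then show "F analytic_on {z}" by (rule meromorphic_map_analytic[OF f])
  qed
qed

lemma g_props: "cmod z < 1 \<Longrightarrow> cmod (g z) < 1" "cmod z < 1 \<Longrightarrow> \<phi> (g z) = F (\<phi> z)"
proof -
  assume "cmod z < 1"
  then have "F (\<phi> z) \<in> \<phi> ` unit_disc" using f_U(2)[OF \<phi>_mem] \<phi>(3) by simp
  then show "cmod (g z) < 1" "\<phi> (g z) = F (\<phi> z)"
    using inv_into_into[of "F (\<phi> z)" \<phi> unit_disc] f_inv_into_f[of "F (\<phi> z)" \<phi> unit_disc]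
    by (auto simp: associated_inner_function_def)
qed

lemma g_holomorphic: "g holomorphic_on unit_disc"
proof -
  obtain \<psi> where \<psi>: "\<psi> holomorphic_on \<phi> ` unit_disc" "\<And>z. z \<in> unit_disc \<Longrightarrow> \<psi> (\<phi> z) = z"
    using holomorphic_has_inverse[OF \<phi>(1) open_ball \<phi>(2)] by metis
  have Fp: "(F \<circ> \<phi>) holomorphic_on unit_disc"
    by (rule holomorphic_on_compose_gen[OF \<phi>(1) F_holomorphic]) (use \<phi>(3) in auto)
  have "(\<psi> \<circ> (F \<circ> \<phi>)) holomorphic_on unit_disc"
    by (rule holomorphic_on_compose_gen[OF Fp \<psi>(1)]) (use f_U(2) \<phi>_mem \<phi>(3) in auto)
  moreover have "(\<psi> \<circ> (F \<circ> \<phi>)) z = g z" if "z \<in> unit_disc" for z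
    using \<psi>(2)[of "g z"] g_props[of z] that by simp
  ultimately show ?thesis by (rule holomorphic_transform)
qed

text \<open>The limit point \<open>l\<close> is no pole of \<open>f\<close>: the curve approaches
  \<open>l\<close> inside \<open>U\<close>, so without meeting it, and \<open>F\<close> would tend
  to infinity along the curve instead of to \<open>l'\<close>. What remains is continuity of
  \<open>F\<close> at \<open>l\<close>.\<close>

lemma boundary_value_step:
  assumes l: "((\<lambda>r. \<phi> (of_real r * \<xi>)) \<longlongrightarrow> l) (at_left 1)" "l \<in> frontier U" "cmod \<xi> = 1"
    and l': "((\<lambda>r. \<phi> (g (of_real r * \<xi>))) \<longlongrightarrow> l') (at_left 1)"
  shows "f l = Fin l'"
proof -
  have ev: "\<forall>\<^sub>F r in at_left (1::real). of_real r * \<xi> \<in> unit_disc"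
    by (intro eventually_at_leftI[of 0]) (use l(3) in \<open>auto simp: norm_mult\<close>)
  have "\<forall>\<^sub>F r in at_left (1::real). \<phi> (g (of_real r * \<xi>)) = F (\<phi> (of_real r * \<xi>))"
    using ev by eventually_elim (simp add: g_props)
  with l' have F': "((\<lambda>r. F (\<phi> (of_real r * \<xi>))) \<longlongrightarrow> l') (at_left 1)" by (rule Lim_transform_eventually)
  have "f l \<noteq> Infty"
  proof
    assume "f l = Infty"
    then have "filterlim F at_infinity (at l)" using f by (simp add: meromorphic_map_def is_pole_def)
    moreover have "filterlim (\<lambda>r. \<phi> (of_real r * \<xi>)) (at l) (at_left 1)"
      unfolding filterlim_at
    proof
      have "l \<notin> U" using l(2) U_props(1) by (simp add: frontier_def interior_open)
      then show "\<forall>\<^sub>F r in at_left 1. \<phi> (of_real r * \<xi>) \<in> UNIV \<and> \<phi> (of_real r * \<xi>) \<noteq> l"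
        using ev by (auto elim!: eventually_mono intro: \<phi>_mem)
    qed (rule l(1))
    ultimately have "filterlim (\<lambda>r. F (\<phi> (of_real r * \<xi>))) at_infinity (at_left 1)" by (rule filterlim_compose)
    then show False using not_tendsto_and_filterlim_at_infinity[OF trivial_limit_at_left_real F'] by blast
  qed
  moreover have "((\<lambda>r. F (\<phi> (of_real r * \<xi>))) \<longlongrightarrow> F l) (at_left 1)"
    by (rule isCont_tendsto_compose[OF meromorphic_map_isCont[OF f \<open>f l \<noteq> Infty\<close>] l(1)])
  then have "F l = l'" using F' tendsto_unique[OF trivial_limit_at_left_real] by blast
  ultimately show ?thesis using Fin_the_Fin[of "f l"] by simp
qed

lemma \<phi>_radial_limit:
  "AE \<xi> in circle_measure. ((\<lambda>r. \<phi> (of_real r * \<xi>)) \<longlongrightarrow> radial_limit \<phi> \<xi>) (at_left 1) \<and> radial_limit \<phi> \<xi> \<in> frontier U"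
proof -
  obtain z0 where z0: "z0 \<notin> U" using proper by blast
  have "AE \<xi> in circle_measure. ((\<lambda>r. \<phi> (of_real r * \<xi>)) \<longlongrightarrow> radial_limit \<phi> \<xi>) (at_left 1)"
    by (rule univalent_radial_limit[OF \<phi>(1,2), of z0]) (use z0 \<phi>_mem in auto)
  moreover have "AE \<xi> in circle_measure. \<xi> \<in> unit_circle" using AE_space[of circle_measure] by simp
  ultimately show ?thesis
  proof eventually_elim
    case (elim \<xi>)
    then show ?case using Riemann_map_radial_limit_frontier[OF \<phi>(1,2) elim(1)] \<phi>(3) by simp
  qed
qed

definition G :: "complex \<Rightarrow> complex" where
  "G \<xi> = (if cmod (radial_limit g \<xi>) = 1 then radial_limit g \<xi> else 1)"

sublocale inner_boundary_map g G
proof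
  show "g holomorphic_on unit_disc" by (rule g_holomorphic)
  show "cmod (g z) < 1" if "cmod z < 1" for z by (rule g_props(1)[OF that])
  have rl [measurable]: "radial_limit g \<in> borel_measurable circle_measure"
    by (intro measurable_radial_limit holomorphic_on_imp_continuous_on g_holomorphic)
  have "G \<in> circle_measure \<rightarrow>\<^sub>M restrict_space borel unit_circle"
  proof (rule measurable_restrict_space2)
    show "G \<in> borel_measurable circle_measure" unfolding G_def[abs_def] by measurable
  qed (auto simp: G_def)
  then show "G \<in> circle_measure \<rightarrow>\<^sub>M circle_measure"
    by (simp cong: measurable_cong_sets add: sets_circle_measure)
  have "AE \<xi> in circle_measure. ((\<lambda>r. g (of_real r * \<xi>)) \<longlongrightarrow> radial_limit g \<xi>) (at_left 1)"
    by (rule Fatou_radial_limits[OF g_holomorphic, of 1]) (use g_props(1) in \<open>simp add: less_imp_le\<close>)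
  moreover have "AE \<xi> in circle_measure. \<xi> \<in> unit_circle" using AE_space[of circle_measure] by simp
  ultimately show "AE \<xi> in circle_measure. ((\<lambda>r. g (of_real r * \<xi>)) \<longlongrightarrow> G \<xi>) (at_left 1)"
    using \<phi>_radial_limit
  proof eventually_elim
    case (elim \<xi>)
    have x: "cmod \<xi> = 1" using elim(2) by simp
    have le: "cmod (radial_limit g \<xi>) \<le> 1"
      by (rule radial_limit_norm_le[OF elim(1) x]) (use g_props(1) in \<open>simp add: less_imp_le\<close>)
    \<comment> \<open>Here \<open>g\<close> turns out to be inner. If its limit were inside the
      disc, \<open>\<phi>\<close> would be continuous there, and \<open>f\<close> would send a
      frontier point of \<open>U\<close> into \<open>U\<close>.\<close>
    have "\<not> cmod (radial_limit g \<xi>) < 1"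
    proof
      assume lt: "cmod (radial_limit g \<xi>) < 1"
      then have "isCont \<phi> (radial_limit g \<xi>)"
        using holomorphic_on_imp_continuous_on[OF \<phi>(1)] by (simp add: continuous_on_eq_continuous_at)
      then have "((\<lambda>r. \<phi> (g (of_real r * \<xi>))) \<longlongrightarrow> \<phi> (radial_limit g \<xi>)) (at_left 1)"
        by (rule isCont_tendsto_compose[OF _ elim(1)])
      then have "f (radial_limit \<phi> \<xi>) = Fin (\<phi> (radial_limit g \<xi>))"
        using elim(3) x by (intro boundary_value_step) auto
      then show False
        using Baker_domain_frontier_image[OF f Baker] elim(3) \<phi>_mem[OF lt] by blast
    qed
    then show ?case using le elim(1) by (simp add: G_def)
  qed
qed

text \<open>One step of the orbit is understood outside a null set. Since \<open>G\<close> pulls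
  null sets back to null sets, this holds along the whole orbit of almost every
  \<open>\<xi>\<close>.\<close>

lemma boundary_orbit:
  "AE \<xi> in circle_measure. \<forall>n. iterate f n (radial_limit \<phi> \<xi>) = Fin (radial_limit \<phi> ((G ^^ n) \<xi>)) \<and>
     radial_limit \<phi> ((G ^^ n) \<xi>) \<in> frontier U"
proof -
  obtain z0 where z0: "z0 \<notin> U" using proper by blast
  have "AE \<xi> in circle_measure. ((\<lambda>r. \<phi> (g (of_real r * \<xi>))) \<longlongrightarrow> radial_limit \<phi> (G \<xi>)) (at_left 1)"
    by (rule univalent_radial_limit_compose[OF \<phi>(1,2), of z0]) (use z0 \<phi>_mem in auto)
  moreover have "AE \<xi> in circle_measure. \<xi> \<in> unit_circle" using AE_space[of circle_measure] by simp
  ultimately have "AE \<xi> in circle_measure. f (radial_limit \<phi> \<xi>) = Fin (radial_limit \<phi> (G \<xi>)) \<and> radial_limit \<phi> \<xi> \<in> frontier U"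
    using \<phi>_radial_limit
  proof eventually_elim
    case (elim \<xi>)
    then show ?case by (auto intro: boundary_value_step)
  qed
  from AE_funpow_G[OF this] show ?thesis
  proof eventually_elim
    case (elim \<xi>)
    have "iterate f n (radial_limit \<phi> \<xi>) = Fin (radial_limit \<phi> ((G ^^ n) \<xi>))" for n
      by (induction n) (use elim in auto)
    then show ?case using elim by blast
  qed
qed

end

section \<open>Dense trajectories on the frontier\<close>

context Baker_domain_uniformization
begin

text \<open>With a countable basis density amounts to countably many visits. Each basic set that
  meets the frontier contains a disc centred on it and so has a preimage of positive measure in the
  circle.\<close>

lemma full_measure_if_orbits_visit:
  assumes visit: "\<And>E. E \<in> sets circle_measure \<Longrightarrow> measure circle_measure E > 0 \<Longrightarrow>
      AE \<xi> in circle_measure. \<exists>n. (G ^^ n) \<xi> \<in> E"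
  shows "full_harmonic_measure \<phi> U (dense_trajectory_points f (frontier U))"
proof -
  let ?J = "frontier U" and ?\<phi> = "radial_limit \<phi>"
  obtain \<B> :: "complex set set" where \<B>: "countable \<B>" "topological_basis \<B>"
    using ex_countable_basis[where 'a = complex] by (elim exE conjE) (rule that)
  define \<B>' where "\<B>' = {B \<in> \<B>. B \<inter> ?J \<noteq> {}}"
  have \<B>': "countable \<B>'" unfolding \<B>'_def using \<B>(1) by (rule countable_subset[rotated]) auto
  \<comment> \<open>A Borel set of points with dense trajectories, described by the iterates of
    \<open>f\<close> in the plane. Its complement in the frontier is an honest Borel null set, and
    the completion takes care of the subset in question.\<close>
  define A where "A = (\<Inter>n. {z. iterate f n z \<in> Fin ` ?J}) \<inter> (\<Inter>B\<in>\<B>'. \<Union>n. {z. iterate f n z \<in> Fin ` B})"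
  have oB: "open B" if "B \<in> \<B>" for B using \<B>(2) that by (rule topological_basis_open)
  have A_borel: "A \<in> sets borel"
  proof -
    have 1: "(\<Inter>n. {z. iterate f n z \<in> Fin ` ?J}) \<in> sets borel"
      by (intro sets.countable_INT'' borel_iterate_preimage[OF f]) auto
    have 2: "(\<Union>n. {z. iterate f n z \<in> Fin ` B}) \<in> sets borel" if "B \<in> \<B>'" for B
      using oB that by (intro sets.countable_UN image_subsetI borel_iterate_preimage[OF f]) (auto simp: \<B>'_def)
    have 3: "(\<Inter>B\<in>\<B>'. \<Union>n. {z. iterate f n z \<in> Fin ` B}) \<in> sets borel"
      using \<B>' 2 by (intro sets.countable_INT'') auto
    show ?thesis unfolding A_def using 1 3 by (rule sets.Int)
  qed
  have A_dense: "A \<subseteq> dense_trajectory_points f ?J"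
  proof
    fix z assume z: "z \<in> A"
    define x where "x n = the_Fin (iterate f n z)" for n
    have xn: "iterate f n z = Fin (x n)" "x n \<in> ?J" for n
    proof -
      have "iterate f n z \<in> Fin ` ?J" using z by (auto simp: A_def)
      then show "iterate f n z = Fin (x n)" "x n \<in> ?J" by (auto simp: x_def)
    qed
    have "?J \<subseteq> closure (range x)"
    proof
      fix y assume y: "y \<in> ?J"
      show "y \<in> closure (range x)"
      proof (rule ccontr)
        assume "y \<notin> closure (range x)"
        then have "y \<in> - closure (range x)" "open (- closure (range x))" by auto
        then obtain B where B: "B \<in> \<B>" "y \<in> B" "B \<subseteq> - closure (range x)"
          using topological_basisE[OF \<B>(2)] by metis
        then have "B \<in> \<B>'" using y by (auto simp: \<B>'_def)
        then obtain n where "iterate f n z \<in> Fin ` B" using z unfolding A_def by blast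
        then have "x n \<in> B" by (auto simp: x_def)
        then show False using B(3) closure_subset[of "range x"] by blast
      qed
    qed
    moreover have "z \<in> ?J" using xn[of 0] by simp
    ultimately show "z \<in> dense_trajectory_points f ?J"
      unfolding dense_trajectory_points_def using xn by blast
  qed
  have phim: "?\<phi> \<in> borel_measurable circle_measure"
    by (intro measurable_radial_limit holomorphic_on_imp_continuous_on \<phi>)
  have "AE \<xi> in circle_measure. \<forall>B\<in>\<B>'. \<exists>n. ?\<phi> ((G ^^ n) \<xi>) \<in> B"
    unfolding AE_ball_countable[OF \<B>']
  proof
    fix B assume B: "B \<in> \<B>'"
    then obtain y where y: "y \<in> B" "y \<in> ?J" "open B" using oB by (auto simp: \<B>'_def)
    obtain e where e: "e > 0" "ball y e \<subseteq> B" using openE[OF y(3,1)] by blast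
    define E where "E = ?\<phi> -` B \<inter> space circle_measure"
    have E: "E \<in> sets circle_measure" unfolding E_def by (rule measurable_sets[OF phim]) (use y(3) in simp)
    have "0 < measure circle_measure {\<xi> \<in> unit_circle. ?\<phi> \<xi> \<in> ball y e}"
      using y(2) U_props(1) e(1) by (intro harmonic_measure_ball_pos) (simp_all add: \<phi>)
    also have "\<dots> \<le> measure circle_measure E"
      by (rule circle.finite_measure_mono[OF _ E]) (use e(2) in \<open>auto simp: E_def\<close>)
    finally have "AE \<xi> in circle_measure. \<exists>n. (G ^^ n) \<xi> \<in> E" by (rule visit[OF E])
    then show "AE \<xi> in circle_measure. \<exists>n. ?\<phi> ((G ^^ n) \<xi>) \<in> B"
      by eventually_elim (auto simp: E_def)
  qed
  then have "AE \<xi> in circle_measure. ?\<phi> \<xi> \<in> A"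
    using boundary_orbit
  proof eventually_elim
    case (elim \<xi>)
    have it: "iterate f n (?\<phi> \<xi>) = Fin (?\<phi> ((G ^^ n) \<xi>))" "?\<phi> ((G ^^ n) \<xi>) \<in> ?J" for n
      using elim(2) by auto
    have "\<exists>n. iterate f n (?\<phi> \<xi>) \<in> Fin ` B" if "B \<in> \<B>'" for B
      using elim(1) that unfolding it(1) by blast
    moreover have "iterate f n (?\<phi> \<xi>) \<in> Fin ` ?J" for n unfolding it(1) using it(2) by blast
    ultimately show ?case unfolding A_def by blast
  qed
  moreover have N: "?J - A \<in> sets borel" using A_borel by (intro sets.Diff) auto
  ultimately have "AE \<xi> in circle_measure. ?\<phi> \<xi> \<notin> ?J - A" by (auto elim: eventually_mono)
  then have "emeasure (harmonic_measure \<phi>) (?J - A) = 0"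
  proof -
    assume ae: "AE \<xi> in circle_measure. ?\<phi> \<xi> \<notin> ?J - A"
    have s: "?\<phi> -` (?J - A) \<inter> space circle_measure \<in> sets circle_measure" by (rule measurable_sets[OF phim N])
    have "emeasure (harmonic_measure \<phi>) (?J - A) = emeasure circle_measure (?\<phi> -` (?J - A) \<inter> space circle_measure)"
      unfolding harmonic_measure_def by (rule emeasure_distr[OF phim N])
    also have "\<dots> = 0"
    proof -
      have "AE \<xi> in circle_measure. \<xi> \<notin> ?\<phi> -` (?J - A) \<inter> space circle_measure"
        using ae by eventually_elim auto
      then show ?thesis using AE_iff_null_sets[OF s] by (simp only: null_setsD1)
    qed
    finally show ?thesis .
  qed
  then have "?J - A \<in> null_sets (completion (harmonic_measure \<phi>))"
    using N by (intro null_sets_completionI) (simp add: null_sets_def harmonic_measure_def)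
  moreover have "?J - dense_trajectory_points f ?J \<subseteq> ?J - A" using A_dense by blast
  ultimately show ?thesis
    unfolding full_harmonic_measure_def by (rule null_sets_completion_subset[rotated])
qed

text \<open>The degree counts preimages with multiplicity. All multiplicities are at least 1, so it
  also bounds the number of distinct preimages, and \<open>\<phi>\<close> transports the bound to
  the disc.\<close>

lemma finite_degree_finite_valence:
  assumes deg: "map_degree f U < \<infinity>" and nc: "\<not> g constant_on unit_disc"
  shows "\<exists>N. \<forall>w. cmod w < 1 \<longrightarrow> finite {z \<in> unit_disc. g z = w} \<and> card {z \<in> unit_disc. g z = w} \<le> N"
proof -
  have Fnc: "\<not> F constant_on U"
  proof
    assume "F constant_on U"
    then obtain c where c: "\<forall>z\<in>U. F z = c" unfolding constant_on_def by blast
    then have "g z = inv_into unit_disc \<phi> c" if "z \<in> unit_disc" for z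
      using \<phi>_mem[of z] that by (simp add: associated_inner_function_def)
    then show False using nc unfolding constant_on_def by blast
  qed
  have "\<not> f constant_on U"
  proof
    assume "f constant_on U"
    then obtain c where "\<forall>z\<in>U. f z = c" unfolding constant_on_def by blast
    then have "\<forall>z\<in>U. F z = the_Fin c" by simp
    then show False using Fnc unfolding constant_on_def by blast
  qed
  then have "(SUP w. preimage_count f U w) < \<infinity>" using deg by (simp add: map_degree_def)
  then obtain N where N: "(SUP w. preimage_count f U w) = enat N" by (metis enat_ord_simps(4) infinity_ileE less_infinityE)
  have mult: "1 \<le> local_multiplicity f z" if z: "z \<in> U" for z
  proof -
    have h: "(\<lambda>x. F x - F z) holomorphic_on U" by (intro holomorphic_intros F_holomorphic)
    \<comment> \<open>The order of a zero is positive provided that the function does not vanish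
      identically nearby; identical vanishing would make \<open>F\<close> constant on
      \<open>U\<close> by analytic continuation.\<close>
    have "\<exists>\<^sub>F x in at z. F x - F z \<noteq> 0"
    proof (rule ccontr)
      assume "\<not> (\<exists>\<^sub>F x in at z. F x - F z \<noteq> 0)"
      then have "\<forall>\<^sub>F x in at z. F x = F z" by (simp add: frequently_def)
      then obtain d where d: "d > 0" "\<And>x. x \<noteq> z \<Longrightarrow> dist x z < d \<Longrightarrow> F x = F z"
        by (auto simp: eventually_at)
      have "F constant_on (ball z d \<inter> U)"
        unfolding constant_on_def
      proof (intro exI ballI)
        fix x assume "x \<in> ball z d \<inter> U"
        then show "F x = F z" using d(2)[of x] by (cases "x = z") (auto simp: dist_commute)
      qed
      moreover have "z islimpt ball z d \<inter> U"
        by (rule interior_limit_point) (use d(1) z U_props(1) in \<open>simp add: interior_open open_Int\<close>)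
      ultimately have "F constant_on U"
        using analytic_continuation'[OF F_holomorphic U_props(1,2), of "ball z d \<inter> U" z] z by blast
      then show False using Fnc by simp
    qed
    then have "zorder (\<lambda>x. F x - F z) z > 0"
      using zorder_pos_iff[OF h U_props(1) z] by simp
    moreover obtain u where u: "f z = Fin u" using U_props(3) z by blast
    moreover have "F z = u" using u by simp
    ultimately show ?thesis by (simp add: local_multiplicity_def)
  qed
  have "finite {z \<in> unit_disc. g z = w} \<and> card {z \<in> unit_disc. g z = w} \<le> N" if w: "cmod w < 1" for w
  \<comment> \<open>Finiteness is obtained together with the bound: \<open>preimage_count\<close> is
    a supremum over finite sets of preimages, hence bounds the size of each of them.\<close>
  proof (rule finite_if_finite_subsets_card_bdd)
    fix H assume H: "H \<subseteq> {z \<in> unit_disc. g z = w}" "finite H"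
    have sub: "\<phi> ` H \<subseteq> {z \<in> U. f z = Fin (\<phi> w)}"
    proof
      fix y assume "y \<in> \<phi> ` H"
      then obtain z where z: "cmod z < 1" "g z = w" "y = \<phi> z" using H by auto
      then show "y \<in> {z \<in> U. f z = Fin (\<phi> w)}"
        using f_U(1)[OF \<phi>_mem[OF z(1)]] g_props(2)[OF z(1)] \<phi>_mem by simp
    qed
    have "H \<subseteq> unit_disc" using H(1) by blast
    with \<phi>(2) have "inj_on \<phi> H" by (rule inj_on_subset)
    then have "card H = (\<Sum>z\<in>\<phi> ` H. 1)" by (simp add: card_image)
    also have "\<dots> \<le> (\<Sum>z\<in>\<phi> ` H. local_multiplicity f z)"
      using sub mult by (intro sum_mono) auto
    finally have "enat (card H) \<le> enat (\<Sum>z\<in>\<phi> ` H. local_multiplicity f z)" by simp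
    also have "\<dots> \<le> preimage_count f U (Fin (\<phi> w))"
      unfolding preimage_count_def using sub H(2) by (intro SUP_upper) auto
    also have "\<dots> \<le> enat N" unfolding N[symmetric] by (rule SUP_upper) simp
    finally show "card H \<le> N" by simp
  qed
  then show ?thesis by blast
qed

theorem full_measure_if_doubly_parabolic:
  assumes dp: "doubly_parabolic_type g"
    and alt: "map_degree f U < \<infinity> \<or> (\<exists>p. Denjoy_Wolff_point g p \<and> \<not> singular_point g p)"
  shows "full_harmonic_measure \<phi> U (dense_trajectory_points f (frontier U))"
proof -
  have contr: "(\<lambda>n. pseudohyperbolic ((g ^^ n) z) ((g ^^ n) w)) \<longlonglongrightarrow> 0"
    if "cmod z < 1" "cmod w < 1" for z w
    by (rule doubly_parabolic_contracts[OF dp _ that]) (rule disc)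
  have rho: "(\<lambda>n. pseudohyperbolic ((g ^^ Suc n) 0) ((g ^^ n) 0)) \<longlonglongrightarrow> 0"
    using contr[of "g 0" 0] disc[of 0] by (simp add: funpow_swap1)
  have nofix: "g z \<noteq> z" if "cmod z < 1" for z
  proof
    assume "g z = z"
    obtain V \<psi> where "Cowen_model g V UNIV \<psi> (\<lambda>\<omega>. \<omega> + 1)" using dp by (auto simp: doubly_parabolic_type_def)
    then have "\<psi> (g z) = \<psi> z + 1" using that by (simp add: Cowen_model_def)
    then show False using \<open>g z = z\<close> by simp
  qed
  have "\<exists>p. cmod p = 1 \<and> \<not> singular_point g p \<and> (\<lambda>n. (g ^^ n) 0) \<longlonglongrightarrow> p"
    using alt
  proof
    assume deg: "map_degree f U < \<infinity>"
    have nc: "\<not> g constant_on unit_disc"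
    proof
      assume "g constant_on unit_disc"
      then obtain c where "\<And>z. z \<in> unit_disc \<Longrightarrow> g z = c" unfolding constant_on_def by blast
      then have c: "g z = c" if "cmod z < 1" for z using that by simp
      then have "cmod c < 1" using disc[of 0] by simp
      then show False using c nofix by blast
    qed
    obtain N where N: "\<And>w. cmod w < 1 \<Longrightarrow> finite {z \<in> unit_disc. g z = w} \<and> card {z \<in> unit_disc. g z = w} \<le> N"
      using finite_degree_finite_valence[OF deg nc] by blast
    have "\<exists>s>1. \<exists>h. h holomorphic_on ball 0 s \<and> (\<forall>z. cmod z < 1 \<longrightarrow> h z = g z)"
      by (rule finite_valence_extension[OF nc]) (rule N)
    then obtain s h where sh: "s > 1" "h holomorphic_on ball 0 s" "\<And>z. cmod z < 1 \<Longrightarrow> h z = g z" by blast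
    \<comment> \<open>The limit point is not known beforehand, but \<open>g\<close> extends across
      the whole circle, so every point of the circle is non-singular.\<close>
    have "\<exists>p. cmod p = 1 \<and> (\<lambda>n. (g ^^ n) 0) \<longlonglongrightarrow> p"
      by (rule finite_valence_orbit_converges[OF sh(1,2) _ _ rho]) (use sh(3) nofix in auto)
    moreover have "\<not> singular_point g p" if "cmod p = 1" for p
      unfolding singular_point_def using sh that by (auto intro!: exI[of _ "ball 0 s"] exI[of _ h])
    ultimately show ?thesis by blast
  next
    assume "\<exists>p. Denjoy_Wolff_point g p \<and> \<not> singular_point g p"
    then obtain p where p: "Denjoy_Wolff_point g p" "\<not> singular_point g p" by blast
    have "uniform_limit {0} (\<lambda>n. g ^^ n) (\<lambda>_. p) sequentially"
    proof -
      have "compact {0::complex} \<and> {0::complex} \<subseteq> unit_disc" by simp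
      then show ?thesis using p(1) unfolding Denjoy_Wolff_point_def locally_uniform_limit_def by blast
    qed
    then have "(\<lambda>n. (g ^^ n) 0) \<longlonglongrightarrow> p" by (rule tendsto_uniform_limitI) simp
    moreover have "cmod p = 1" using p(1) by (simp add: Denjoy_Wolff_point_def)
    ultimately show ?thesis using p(2) by blast
  qed
  then obtain p where p: "cmod p = 1" "\<not> singular_point g p" "(\<lambda>n. (g ^^ n) 0) \<longlonglongrightarrow> p" by blast
  have div: "\<not> summable (\<lambda>n. 1 - cmod ((g ^^ n) 0))"
    by (rule nonsingular_Denjoy_Wolff_diverges[OF p(2,1,3) rho])
  show ?thesis
    by (rule full_measure_if_orbits_visit) (rule AE_orbit_visits[OF div contr])
qed

end

theorem theoremB:
  fixes f :: "complex \<Rightarrow> riemann_sphere" and U :: "complex set" and \<phi> :: "complex \<Rightarrow> complex"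
  assumes "meromorphic_map f"
    and "map_degree f UNIV > 1"
    and "invariant_Baker_domain f U"
    and "simply_connected U"
    and "Riemann_map \<phi> U"
    and "doubly_parabolic_type (associated_inner_function \<phi> f)"
  shows "(map_degree f U < \<infinity> \<longrightarrow>
            full_harmonic_measure \<phi> U (dense_trajectory_points f (frontier U))) \<and>
         ((\<exists>p. Denjoy_Wolff_point (associated_inner_function \<phi> f) p \<and>
               \<not> singular_point (associated_inner_function \<phi> f) p) \<longrightarrow>
            full_harmonic_measure \<phi> U (dense_trajectory_points f (frontier U)))"
proof (cases "U = UNIV")
  case True
  \<comment> \<open>The frontier of the plane is empty, so there is no exceptional set.\<close>
  then show ?thesis by (simp add: full_harmonic_measure_def)
next
  case False
  interpret Baker_domain_uniformization f U \<phi> using assms False by unfold_locales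
  show ?thesis using full_measure_if_doubly_parabolic[OF assms(6)] by blast
qed

end
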